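(* All-Pairs Non-Decreasing Paths on undirected graphs with $n$ vertices can be solved by a randomized algorithm in time $\mathcal{O}(n^2 \log n)$, correct with high probability.
   Context: Let $G=(V,E)$ be an undirected graph with $n=|V|$ vertices and real edge weights $w(e)$, $e \in E$. A path is a sequence of edges $e_1,\dots,e_\ell$ such that $e_i$ and $e_{i+1}$ share an endpoint for all $1 \le i \le \ell-1$; it is non-decreasing if $w(e_i) \le w(e_{i+1})$ for all $1 \le i \le \ell-1$, and the weight of a non-decreasing path is $w(e_\ell)$, the weight of its last edge. The All-Pairs Non-Decreasing Paths problem (APNP) asks, for every ordered pair of vertices $(u,v)$, to determine the minimum weight of a non-decreasing path from $u$ to $v$ (or report that none exists). Model of computation: arithmetic operations on $\mathcal{O}(\log n)$-bit numbers take constant time. *)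

theory Defs
  imports
    "HOL-Probability.Probability"
    "HOL-Library.Landau_Symbols"
    "HOL-Library.Log_Nat"
begin

section \<open>Non-decreasing paths in undirected graphs\<close>

text \<open>Finite simple undirected graphs on the vertex set \<open>{..<n}\<close>; an edge is the set of its two
  endpoints.\<close>

definition ugraph :: "nat \<Rightarrow> nat set set \<Rightarrow> bool" where
  "ugraph n E \<longleftrightarrow> (\<forall>e\<in>E. e \<subseteq> {..<n} \<and> card e = 2)"

definition edge_path :: "nat set set \<Rightarrow> nat \<Rightarrow> nat \<Rightarrow> nat set list \<Rightarrow> bool" where
  "edge_path E u v p \<longleftrightarrow> p \<noteq> [] \<and> set p \<subseteq> E \<and> successively (\<lambda>e f. e \<inter> f \<noteq> {}) p \<and>
     u \<in> hd p \<and> v \<in> last p"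

definition non_decreasing :: "(nat set \<Rightarrow> real) \<Rightarrow> nat set list \<Rightarrow> bool" where
  "non_decreasing w p \<longleftrightarrow> successively (\<lambda>e f. w e \<le> w f) p"

definition path_weight :: "(nat set \<Rightarrow> real) \<Rightarrow> nat set list \<Rightarrow> real" where
  "path_weight w p = w (last p)"

definition nd_path_weights ::
    "nat set set \<Rightarrow> (nat set \<Rightarrow> real) \<Rightarrow> nat \<Rightarrow> nat \<Rightarrow> real set" where
  "nd_path_weights E w u v = {path_weight w p | p. edge_path E u v p \<and> non_decreasing w p}"

text \<open>Consecutive edges of an \<open>edge_path\<close> only have to share an endpoint.  Insisting that the
  edges be traversed one after the other, along a sequence \<open>xs\<close> of vertices, gives the same
  weights.\<close>

definition walk_along :: "nat list \<Rightarrow> nat set list \<Rightarrow> bool" where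
  "walk_along xs p \<longleftrightarrow> length xs = Suc (length p) \<and> (\<forall>i<length p. p ! i = {xs ! i, xs ! Suc i})"

lemma walk_along_snoc:
  assumes "walk_along xs p"
  shows "walk_along (xs @ [y]) (p @ [{last xs, y}])"
  using assms unfolding walk_along_def
  by (cases xs rule: rev_cases) (auto simp: nth_append less_Suc_eq)

lemma nd_path_imp_walk:
  assumes "ugraph n E" and "p \<noteq> []" and "set p \<subseteq> E" and "u \<in> hd p" and "v \<in> last p"
    and "successively (\<lambda>e f. e \<inter> f \<noteq> {}) p" and "non_decreasing w p"
  shows "\<exists>xs q. walk_along xs q \<and> q \<noteq> [] \<and> set q \<subseteq> E \<and> hd xs = u \<and> last xs = v \<and>
           non_decreasing w q \<and> w (last q) = w (last p)"
  using assms(2-)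
proof (induction p arbitrary: v rule: rev_induct)
  case Nil
  then show ?case by simp
next
  case (snoc e p)
  have eE: "e \<in> E" and v: "v \<in> e" using snoc.prems by auto
  have card: "card e = 2" using assms(1) eE by (auto simp: ugraph_def)
  have other: "\<exists>y. e = {z, y}" if "z \<in> e" for z
    using card that by (auto simp: card_2_iff)
  have step: "\<exists>xs q. walk_along xs q \<and> q \<noteq> [] \<and> set q \<subseteq> E \<and> hd xs = u \<and> last xs = v \<and>
      non_decreasing w q \<and> w (last q) = w (last (p @ [e]))"
    if z: "z \<in> e" and W: "walk_along xs q" "set q \<subseteq> E" "hd xs = u" "last xs = z"
      "non_decreasing w q" "q \<noteq> [] \<Longrightarrow> w (last q) \<le> w e" for z xs q
  proof -
    obtain y where y: "e = {z, y}" using other[OF z] by blast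
    have xs: "xs \<noteq> []" using W(1) by (auto simp: walk_along_def)
    have 1: "walk_along (xs @ [y]) (q @ [e])"
      using walk_along_snoc[OF W(1), of y] W(4) y by simp
    have nd1: "non_decreasing w (q @ [e])"
      using W(5,6) by (auto simp: non_decreasing_def successively_append_iff)
    show ?thesis
    proof (cases "v = y")
      case True
      show ?thesis
        by (rule exI[of _ "xs @ [y]"], rule exI[of _ "q @ [e]"])
          (use 1 nd1 True xs W eE in auto)
    next
      case False
      then have vz: "v = z" using v y by auto
      have 2: "walk_along ((xs @ [y]) @ [z]) ((q @ [e]) @ [e])"
        using walk_along_snoc[OF 1, of z] y by (simp add: insert_commute)
      have nd2: "non_decreasing w ((q @ [e]) @ [e])"
        using nd1 unfolding non_decreasing_def by (subst successively_append_iff) auto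
      show ?thesis
        by (rule exI[of _ "(xs @ [y]) @ [z]"], rule exI[of _ "(q @ [e]) @ [e]"])
          (use 2 nd2 vz xs W eE in auto)
    qed
  qed
  show ?case
  proof (cases "p = []")
    case True
    have "u \<in> e" using snoc.prems True by simp
    then show ?thesis
      by (rule step[of u "[u]" "[]"]) (auto simp: walk_along_def non_decreasing_def)
  next
    case False
    obtain z where z: "z \<in> last p" "z \<in> e"
      using snoc.prems(5) False by (auto simp: successively_append_iff)
    have "w (last p) \<le> w e" and "non_decreasing w p"
      using snoc.prems(6) False by (auto simp: non_decreasing_def successively_append_iff)
    moreover obtain xs q where "walk_along xs q" "q \<noteq> []" "set q \<subseteq> E" "hd xs = u" "last xs = z"
      "non_decreasing w q" "w (last q) = w (last p)"
      using snoc.IH[of z] z(1) False snoc.prems calculation(2)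
      by (auto simp: successively_append_iff)
    ultimately show ?thesis using step[of z xs q] z(2) by auto
  qed
qed

lemma nd_path_weights_walks:
  assumes "ugraph n E"
  shows "nd_path_weights E w u v =
    {path_weight w p | p xs. walk_along xs p \<and> p \<noteq> [] \<and> set p \<subseteq> E \<and>
       hd xs = u \<and> last xs = v \<and> non_decreasing w p}" (is "_ = ?R")
proof
  show "nd_path_weights E w u v \<subseteq> ?R"
  proof
    fix x assume "x \<in> nd_path_weights E w u v"
    then obtain p where x: "x = w (last p)" and nd: "non_decreasing w p"
      and p: "p \<noteq> []" "set p \<subseteq> E" "u \<in> hd p" "v \<in> last p"
        "successively (\<lambda>e f. e \<inter> f \<noteq> {}) p"
      by (auto simp: nd_path_weights_def edge_path_def path_weight_def)
    show "x \<in> ?R"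
      using nd_path_imp_walk[OF assms p nd] unfolding x path_weight_def mem_Collect_eq by metis
  qed
next
  have edge_path: "edge_path E (hd xs) (last xs) p"
    if W: "walk_along xs p" and p: "p \<noteq> []" "set p \<subseteq> E" for xs p
  proof -
    have len: "length xs = Suc (length p)" and nth: "p ! i = {xs ! i, xs ! Suc i}"
      if "i < length p" for i
      using W that by (auto simp: walk_along_def)
    have 0: "0 < length p" using p by simp
    have xs: "xs \<noteq> []" using len[OF 0] by auto
    have "hd xs \<in> hd p" using nth[OF 0] p(1) xs by (simp add: hd_conv_nth)
    moreover have "last xs \<in> last p"
      using nth[of "length p - 1"] 0 len[OF 0] p(1) xs by (simp add: last_conv_nth)
    moreover have "p ! i \<inter> p ! Suc i \<noteq> {}" if "Suc i < length p" for i
      using nth[of i] nth[of "Suc i"] that by simp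
    then have "successively (\<lambda>e f. e \<inter> f \<noteq> {}) p"
      by (simp add: successively_conv_nth)
    ultimately show ?thesis using p by (simp add: edge_path_def)
  qed
  show "?R \<subseteq> nd_path_weights E w u v"
  proof
    fix x assume "x \<in> ?R"
    then obtain p xs where "x = path_weight w p" "non_decreasing w p"
      and "walk_along xs p" "p \<noteq> []" "set p \<subseteq> E" "hd xs = u" "last xs = v"
      by blast
    then show "x \<in> nd_path_weights E w u v"
      using edge_path[of xs p] unfolding nd_path_weights_def by blast
  qed
qed


section \<open>A randomized word RAM with a comparison-only store for weights\<close>

text \<open>
  Programs work on \<open>b\<close>-bit words, represented by the natural numbers below \<open>2 ^ b\<close>.  Words live in
  registers and in finitely many word arrays (the arrays are named by constants in the program
  text and their cells are addressed by words).  The real edge weights live in a separate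
  family of arrays; they can be copied and compared, and nothing else, so no computation can be
  hidden in exact real arithmetic.
\<close>

datatype wop = Add | Sub | Mul | Div | Mod | Less | Equal

datatype exp =
    Const nat
  | Reg nat
  | Read nat exp                \<comment> \<open>array, index\<close>
  | Op wop exp exp
  | WLess nat exp nat exp       \<comment> \<open>compares two cells of weight arrays\<close>

datatype com =
    Skip
  | Assign nat exp
  | Write nat exp exp           \<comment> \<open>array, index, new value\<close>
  | WCopy nat exp nat exp       \<comment> \<open>target array and index, source array and index\<close>
  | Rand nat                    \<comment> \<open>draws a uniformly random word into a register\<close>
  | Seq com com
  | If exp com com
  | While exp com

record state =
  reg :: "nat \<Rightarrow> nat"
  mem :: "nat \<Rightarrow> nat \<Rightarrow> nat"
  wmem :: "nat \<Rightarrow> nat \<Rightarrow> real"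
  pos :: nat                    \<comment> \<open>number of random words drawn so far\<close>

fun wop_sem :: "nat \<Rightarrow> wop \<Rightarrow> nat \<Rightarrow> nat \<Rightarrow> nat" where
  "wop_sem b Add x y = (x + y) mod 2 ^ b"
| "wop_sem b Sub x y = (x + 2 ^ b - y) mod 2 ^ b"
| "wop_sem b Mul x y = (x * y) mod 2 ^ b"
| "wop_sem b Div x y = x div y"
| "wop_sem b Mod x y = x mod y"
| "wop_sem b Less x y = of_bool (x < y)"
| "wop_sem b Equal x y = of_bool (x = y)"

fun eval :: "nat \<Rightarrow> state \<Rightarrow> exp \<Rightarrow> nat" where
  "eval b s (Const k) = k mod 2 ^ b"
| "eval b s (Reg x) = reg s x"
| "eval b s (Read a e) = mem s a (eval b s e)"
| "eval b s (Op f e e') = wop_sem b f (eval b s e) (eval b s e')"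
| "eval b s (WLess a e a' e') = of_bool (wmem s a (eval b s e) < wmem s a' (eval b s e'))"

fun cost :: "exp \<Rightarrow> nat" where
  "cost (Const k) = 1"
| "cost (Reg x) = 1"
| "cost (Read a e) = 1 + cost e"
| "cost (Op f e e') = 1 + cost e + cost e'"
| "cost (WLess a e a' e') = 1 + cost e + cost e'"

text \<open>\<open>exec b \<rho> c s t s'\<close>: with word size \<open>b\<close> and random tape \<open>\<rho>\<close> (the \<open>i\<close>-th random word drawn
  is \<open>\<rho> i\<close>), the program \<open>c\<close> started in \<open>s\<close> halts in \<open>s'\<close> after time \<open>t\<close>.  A word other than \<open>0\<close>
  counts as true.\<close>

inductive exec :: "nat \<Rightarrow> (nat \<Rightarrow> nat) \<Rightarrow> com \<Rightarrow> state \<Rightarrow> nat \<Rightarrow> state \<Rightarrow> bool"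
  for b :: nat and \<rho> :: "nat \<Rightarrow> nat" where
  Skip: "exec b \<rho> Skip s 1 s"
| Assign: "exec b \<rho> (Assign x e) s (1 + cost e) (s\<lparr>reg := (reg s)(x := eval b s e)\<rparr>)"
| Write: "exec b \<rho> (Write a e e') s (1 + cost e + cost e')
    (s\<lparr>mem := (mem s)(a := (mem s a)(eval b s e := eval b s e'))\<rparr>)"
| WCopy: "exec b \<rho> (WCopy a e a' e') s (1 + cost e + cost e')
    (s\<lparr>wmem := (wmem s)(a := (wmem s a)(eval b s e := wmem s a' (eval b s e')))\<rparr>)"
| Rand: "exec b \<rho> (Rand x) s 1 (s\<lparr>reg := (reg s)(x := \<rho> (pos s)), pos := Suc (pos s)\<rparr>)"
| Seq: "exec b \<rho> c s t s' \<Longrightarrow> exec b \<rho> d s' t' s'' \<Longrightarrow> exec b \<rho> (Seq c d) s (t + t') s''"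
| IfTrue: "eval b s e \<noteq> 0 \<Longrightarrow> exec b \<rho> c s t s' \<Longrightarrow> exec b \<rho> (If e c d) s (1 + cost e + t) s'"
| IfFalse: "eval b s e = 0 \<Longrightarrow> exec b \<rho> d s t s' \<Longrightarrow> exec b \<rho> (If e c d) s (1 + cost e + t) s'"
| WhileFalse: "eval b s e = 0 \<Longrightarrow> exec b \<rho> (While e c) s (1 + cost e) s"
| WhileTrue: "eval b s e \<noteq> 0 \<Longrightarrow> exec b \<rho> c s t s' \<Longrightarrow> exec b \<rho> (While e c) s' t' s'' \<Longrightarrow>
    exec b \<rho> (While e c) s (1 + cost e + t + t') s''"

inductive_cases exec_SkipE: "exec b \<rho> Skip s t s'"
inductive_cases exec_AssignE: "exec b \<rho> (Assign x e) s t s'"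
inductive_cases exec_WriteE: "exec b \<rho> (Write a e e') s t s'"
inductive_cases exec_WCopyE: "exec b \<rho> (WCopy a e a' e') s t s'"
inductive_cases exec_RandE: "exec b \<rho> (Rand x) s t s'"
inductive_cases exec_SeqE: "exec b \<rho> (Seq c d) s t s'"
inductive_cases exec_IfE: "exec b \<rho> (If e c d) s t s'"
inductive_cases exec_WhileE: "exec b \<rho> (While e c) s t s'"

lemma exec_deterministic:
  "exec b \<rho> c s t s' \<Longrightarrow> exec b \<rho> c s t' s'' \<Longrightarrow> t' = t \<and> s'' = s'"
proof (induction arbitrary: t' s'' rule: exec.induct)
  case Skip
  then show ?case by (rule exec_SkipE) simp
next
  case Assign
  then show ?case by (rule exec_AssignE) simp
next
  case Write
  then show ?case by (rule exec_WriteE) simp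
next
  case WCopy
  then show ?case by (rule exec_WCopyE) simp
next
  case Rand
  then show ?case by (rule exec_RandE) simp
next
  case (Seq c s t s1 d t1 s2)
  from Seq.prems obtain ta sa tb where "exec b \<rho> c s ta sa" "exec b \<rho> d sa tb s''" "t' = ta + tb"
    by (rule exec_SeqE)
  then show ?case using Seq.IH(1)[of ta sa] Seq.IH(2)[of tb s''] by simp
next
  case (IfTrue s e c t s' d)
  from IfTrue.prems show ?case
  proof (rule exec_IfE)
    fix ta
    assume "exec b \<rho> c s ta s''" "t' = Suc (cost e + ta)"
    then show ?thesis using IfTrue.IH[of ta s''] by simp
  next
    assume "eval b s e = 0"
    then show ?thesis using IfTrue.hyps by simp
  qed
next
  case (IfFalse s e d t s' c)
  from IfFalse.prems show ?case
  proof (rule exec_IfE)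
    assume "0 < eval b s e"
    then show ?thesis using IfFalse.hyps by simp
  next
    fix ta
    assume "exec b \<rho> d s ta s''" "t' = Suc (cost e + ta)"
    then show ?thesis using IfFalse.IH[of ta s''] by simp
  qed
next
  case (WhileFalse s e c)
  from WhileFalse.prems show ?case
    by (rule exec_WhileE) (use WhileFalse.hyps in auto)
next
  case (WhileTrue s e c t s1 t1 s2)
  from WhileTrue.prems show ?case
  proof (rule exec_WhileE)
    assume "eval b s e = 0"
    then show ?thesis using WhileTrue.hyps by simp
  next
    fix ta sa tb
    assume "exec b \<rho> c s ta sa" "exec b \<rho> (While e c) sa tb s''" "t' = Suc (cost e + ta + tb)"
    then show ?thesis using WhileTrue.IH(1)[of ta sa] WhileTrue.IH(2)[of tb s''] by simp
  qed
qed

text \<open>A run of length \<open>t\<close> reads at most \<open>t\<close> cells of the random tape.\<close>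

lemma exec_pos_le: "exec b \<rho> c s t s' \<Longrightarrow> pos s' \<le> pos s + t"
  by (induction rule: exec.induct) auto

definition words :: "nat \<Rightarrow> state \<Rightarrow> bool" where
  "words b s \<longleftrightarrow> (\<forall>x. reg s x < 2 ^ b) \<and> (\<forall>a i. mem s a i < 2 ^ b)"

lemma eval_word:
  assumes "words b s" and "0 < b"
  shows "eval b s e < 2 ^ b"
proof -
  have one: "(1::nat) < 2 ^ b" using one_less_power[of "2::nat" b] assms(2) by simp
  have op: "wop_sem b f x y < 2 ^ b" if x: "x < 2 ^ b" for f x y
  proof (cases f)
    case Div
    then show ?thesis using le_less_trans[OF div_le_dividend x] by simp
  next
    case Mod
    then show ?thesis using le_less_trans[OF mod_less_eq_dividend x] by simp
  qed (use one in \<open>simp_all add: of_bool_def\<close>)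
  show ?thesis
  proof (induction e)
    case (Op f e e')
    then show ?case by (simp add: op)
  qed (use assms(1) one in \<open>simp_all add: words_def of_bool_def\<close>)
qed

lemma exec_words:
  assumes "exec b \<rho> c s t s'" and "words b s" and b: "0 < b" and \<rho>: "\<And>i. \<rho> i < 2 ^ b"
  shows "words b s'"
  using assms(1,2)
proof (induction rule: exec.induct)
  case (Assign x e s)
  then show ?case using eval_word[OF Assign b] by (simp add: words_def)
next
  case (Write a e e' s)
  then show ?case using eval_word[OF Write b] by (simp add: words_def)
next
  case (WCopy a e a' e' s)
  then show ?case by (simp add: words_def)
next
  case (Rand x s)
  then show ?case using \<rho> by (simp add: words_def)
qed simp_all


section \<open>The problem on this machine\<close>

text \<open>\<open>\<Theta>(log n)\<close> bits: \<open>c\<close> times the length of the binary representation of \<open>n + 1\<close>.  For \<open>c \<ge> 2\<close>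
  all cells of an \<open>n \<times> n\<close> array are addressable.\<close>

definition word_size :: "nat \<Rightarrow> nat \<Rightarrow> nat" where
  "word_size c n = c * floorlog 2 (Suc n)"

text \<open>\<open>T\<close> independent uniformly random \<open>b\<close>-bit words.\<close>

definition random_tape :: "nat \<Rightarrow> nat \<Rightarrow> (nat \<Rightarrow> nat) pmf" where
  "random_tape b T = Pi_pmf {..<T} 0 (\<lambda>_. pmf_of_set {..<2 ^ b})"

text \<open>The input: \<open>n\<close> in register \<open>0\<close>; in cell \<open>u * n + v\<close> of word array \<open>0\<close> whether \<open>{u, v}\<close> is an
  edge, and in the same cell of weight array \<open>0\<close> its weight if it is one.  All other cells
  are \<open>0\<close>.\<close>

definition input :: "nat \<Rightarrow> nat set set \<Rightarrow> (nat set \<Rightarrow> real) \<Rightarrow> state" where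
  "input n E w =
    \<lparr>reg = (\<lambda>_. 0)(0 := n),
     mem = (\<lambda>_ _. 0)(0 := (\<lambda>i. of_bool (i < n * n \<and> {i div n, i mod n} \<in> E))),
     wmem = (\<lambda>_ _. 0)(0 := (\<lambda>i. if i < n * n \<and> {i div n, i mod n} \<in> E
                                 then w {i div n, i mod n} else 0)),
     pos = 0\<rparr>"

text \<open>The output for the pair \<open>(u, v)\<close> is expected in cell \<open>u * n + v\<close> of the word and weight arrays
  \<open>1\<close>: a flag telling whether there is a non-decreasing path, and the minimum weight if so.\<close>

definition apnp_solution :: "nat \<Rightarrow> nat set set \<Rightarrow> (nat set \<Rightarrow> real) \<Rightarrow> state \<Rightarrow> bool" where
  "apnp_solution n E w s \<longleftrightarrow>
    (\<forall>u<n. \<forall>v<n.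
      if nd_path_weights E w u v = {} then mem s 1 (u * n + v) = 0
      else mem s 1 (u * n + v) = 1 \<and>
        wmem s 1 (u * n + v) \<in> nd_path_weights E w u v \<and>
        (\<forall>x \<in> nd_path_weights E w u v. wmem s 1 (u * n + v) \<le> x))"

lemma word_size_pos: "2 \<le> c \<Longrightarrow> 0 < word_size c n"
  by (simp add: word_size_def floorlog_def)

lemma square_less_word:
  assumes "2 \<le> c"
  shows "(n + 1) * (n + 1) < 2 ^ word_size c n"
proof -
  let ?l = "floorlog 2 (Suc n)"
  have n: "n + 1 < 2 ^ ?l"
    using floorlog_bounds[of "Suc n" 2] by simp
  have "(n + 1) * (n + 1) < 2 ^ ?l * 2 ^ ?l"
    by (rule mult_strict_mono[OF n n]) auto
  also have "\<dots> = 2 ^ (2 * ?l)" by (simp add: mult_2 power_add)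
  also have "\<dots> \<le> 2 ^ (c * ?l)" using assms by (intro power_increasing mult_right_mono) auto
  finally show ?thesis by (simp add: word_size_def)
qed

lemma words_input:
  assumes "2 \<le> c"
  shows "words (word_size c n) (input n E w)"
proof -
  have "(1::nat) < 2 ^ word_size c n"
    using one_less_power[of "2::nat" "word_size c n"] word_size_pos[OF assms, of n] by simp
  moreover have "n < 2 ^ word_size c n"
    using square_less_word[OF assms, of n] by simp
  ultimately show ?thesis by (auto simp: words_def input_def)
qed

end

theory Submission
  imports Defs "HOL-Real_Asymp.Real_Asymp"
begin

text \<open>Process the edges by increasing weight and maintain for every vertex \<open>v\<close> the set \<open>R v\<close> of
  vertices from which \<open>v\<close> has been reached.  Since edges can be traversed both ways, all vertices of
  a connected component of the edges of the current weight end up with the union of their sets, and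
  the pairs that are new get the current weight as their label.  There are at most \<open>n\<^sup>2\<close> new
  pairs in total, so it suffices to find each element in which two sets differ in logarithmic time,
  and to recognize equal sets in constant time.  For this the sets are stored as complete binary
  trees in which equal subtrees have equal identifiers.  Identifiers are looked up in a table
  indexed directly by the pair of identifiers of the children, which is possible because the memory
  is initially zero and polynomially large; this makes the algorithm deterministic.  A
  tournament tree supplies the edges in sorted order, both globally and for each vertex, so that a
  component is explored by extracting its edges.\<close>

section \<open>Weakest preconditions with elapsed time\<close>

text \<open>The time bound is a potential argument. There can be about \<open>n * n\<close> rounds,
  so a round must not touch all vertices: it may spend O(\<open>k\<close>) time for each directed
  edge that it removes and for each pair that it adds, where \<open>k\<close> is the bit length of
  \<open>n + 1\<close>. There are at most \<open>n * n\<close> of either kind. A component with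
  \<open>q\<close> vertices is discovered through at least \<open>q - 1\<close> removed edges, so
  work per vertex is covered as well. Identifiers obey the same accounting: an insertion recomputes
  the \<open>k\<close> inner nodes above a leaf and creates at most one identifier for each. Hence
  identifiers stay below \<open>L ^ 3\<close>, pair codes below \<open>L ^ 6\<close>, and words of
  \<open>8 * k\<close> bits suffice. The labels are right because of a strictness invariant: next to
  a processed edge at \<open>u\<close>, every remaining edge at \<open>u\<close> is strictly
  heavier. Pairs added in the current round therefore impose nothing on the edges processed before
  it. No random word is drawn, so the success probability is one.\<close>

definition wp :: "nat \<Rightarrow> (nat \<Rightarrow> nat) \<Rightarrow> com \<Rightarrow> (state \<Rightarrow> nat \<Rightarrow> bool) \<Rightarrow> state \<Rightarrow> nat \<Rightarrow> bool" where
  "wp b \<rho> c Q s \<tau> \<longleftrightarrow> (\<exists>t s'. exec b \<rho> c s t s' \<and> Q s' (\<tau> + t))"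

text \<open>Symbolic execution leaves the state and the clock in an unpredictable syntactic form;
  this rule replaces them by named ones and leaves two equations for the simplifier.\<close>

lemma wp_cong: "wp b \<rho> c Q s \<tau> \<Longrightarrow> s' = s \<Longrightarrow> \<tau>' = \<tau> \<Longrightarrow> wp b \<rho> c Q s' \<tau>'"
  by simp

text \<open>Determinism turns the existential run in \<open>wp\<close> into an equivalence, so
  straight-line code can be executed by rewriting.\<close>

lemma wp_exec: "exec b \<rho> c s t s' \<Longrightarrow> wp b \<rho> c Q s \<tau> \<longleftrightarrow> Q s' (\<tau> + t)"
  unfolding wp_def using exec_deterministic by blast

lemmas wp_Skip = wp_exec[OF exec.Skip]
  and wp_Assign = wp_exec[OF exec.Assign]
  and wp_Write = wp_exec[OF exec.Write]
  and wp_WCopy = wp_exec[OF exec.WCopy]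

lemma wp_Seq: "wp b \<rho> (Seq c d) Q s \<tau> \<longleftrightarrow> wp b \<rho> c (wp b \<rho> d Q) s \<tau>"
  unfolding wp_def
proof safe
  fix t s' assume "exec b \<rho> (Seq c d) s t s'" "Q s' (\<tau> + t)"
  then show "\<exists>t s'. exec b \<rho> c s t s' \<and> (\<exists>ta s'a. exec b \<rho> d s' ta s'a \<and> Q s'a (\<tau> + t + ta))"
    by (elim exec_SeqE) (metis add.assoc)
qed (metis add.assoc exec.Seq)

lemma wp_If:
  "wp b \<rho> (com.If e c d) Q s \<tau> \<longleftrightarrow>
     (if eval b s e \<noteq> 0 then wp b \<rho> c Q s (\<tau> + (1 + cost e)) else wp b \<rho> d Q s (\<tau> + (1 + cost e)))"
proof -
  have "exec b \<rho> (com.If e c d) s t s' \<longleftrightarrow>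
      (\<exists>t'. t = 1 + cost e + t' \<and> exec b \<rho> (if eval b s e \<noteq> 0 then c else d) s t' s')" for t s'
    by (auto intro: exec.IfTrue[simplified] exec.IfFalse[simplified] elim!: exec_IfE)
  then have "wp b \<rho> (com.If e c d) Q s \<tau> \<longleftrightarrow>
      (\<exists>t' s'. exec b \<rho> (if eval b s e \<noteq> 0 then c else d) s t' s' \<and> Q s' (\<tau> + (1 + cost e + t')))"
    unfolding wp_def by metis
  then show ?thesis unfolding wp_def by (simp add: add.assoc)
qed

lemmas wp_simps = wp_Skip wp_Assign wp_Write wp_WCopy wp_Seq wp_If

text \<open>Every iteration takes time, so a bound on the time is also a termination argument.\<close>

lemma wp_While:
  assumes init: "I s \<tau>"
    and step: "\<And>s \<tau>. I s \<tau> \<Longrightarrow> eval b s e \<noteq> 0 \<Longrightarrow> wp b \<rho> c I s (\<tau> + (1 + cost e))"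
    and exit: "\<And>s \<tau>. I s \<tau> \<Longrightarrow> eval b s e = 0 \<Longrightarrow> Q s (\<tau> + (1 + cost e))"
    and bound: "\<And>s \<tau>. I s \<tau> \<Longrightarrow> \<tau> \<le> B"
  shows "wp b \<rho> (While e c) Q s \<tau>"
  using init
proof (induction "B - \<tau>" arbitrary: s \<tau> rule: less_induct)
  case less
  show ?case
  proof (cases "eval b s e = 0")
    case True
    then show ?thesis
      using exit[OF less.prems True] exec.WhileFalse[OF True] unfolding wp_def by blast
  next
    case False
    obtain t s' where 1: "exec b \<rho> c s t s'" "I s' (\<tau> + (1 + cost e) + t)"
      using step[OF less.prems False] unfolding wp_def by blast
    have "\<tau> + (1 + cost e) + t \<le> B" using bound[OF 1(2)] .
    then have "B - (\<tau> + (1 + cost e) + t) < B - \<tau>" by simp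
    then obtain t' s'' where 2: "exec b \<rho> (While e c) s' t' s''"
      "Q s'' (\<tau> + (1 + cost e) + t + t')"
      using less.hyps[OF _ 1(2)] unfolding wp_def by blast
    show ?thesis unfolding wp_def
      using exec.WhileTrue[of b s e, OF False 1(1) 2(1)] 2(2) by (metis add.assoc)
  qed
qed

section \<open>Labels of non-decreasing paths\<close>

text \<open>A one-edge path may start and end at the same endpoint, since \<open>edge_path\<close>
  only asks for membership in the first and the last edge. So the diagonal pairs of non-isolated
  vertices need labels too.\<close>

lemma nd_path_weights_edge:
  assumes "{u, v} \<in> E" shows "w {u, v} \<in> nd_path_weights E w u u"
  unfolding nd_path_weights_def mem_Collect_eq
  by (rule exI[of _ "[{u, v}]"])
     (use assms in \<open>auto simp: edge_path_def non_decreasing_def path_weight_def\<close>)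

lemma nd_path_weights_extend:
  assumes "x \<in> nd_path_weights E w u a" "x \<le> w {a, v}" "{a, v} \<in> E"
  shows "w {a, v} \<in> nd_path_weights E w u v"
proof -
  obtain p where p: "x = w (last p)" "edge_path E u a p" "non_decreasing w p"
    using assms(1) unfolding nd_path_weights_def path_weight_def by blast
  have "edge_path E u v (p @ [{a, v}])"
    using p(2) assms(3) unfolding edge_path_def by (auto simp: successively_append_iff)
  moreover have "non_decreasing w (p @ [{a, v}])"
    using p(1,2,3) assms(2) unfolding edge_path_def non_decreasing_def
    by (auto simp: successively_append_iff)
  ultimately show ?thesis
    unfolding nd_path_weights_def path_weight_def
    by (intro CollectI exI[of _ "p @ [{a, v}]"]) simp
qed

text \<open>Soundness of merging a component: a label of at most \<open>g\<close> can be prolonged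
  along any walk of edges of weight \<open>g\<close>. The case \<open>c = a\<close> covers the empty
  walk, which does not raise the label to \<open>g\<close>.\<close>

lemma nd_path_weights_rtrancl:
  assumes "x \<in> nd_path_weights E w u a" "x \<le> g" and "(a, c) \<in> {(y, z). {y, z} \<in> E \<and> w {y, z} = g}\<^sup>*"
  shows "c = a \<or> g \<in> nd_path_weights E w u c"
  using assms(3)
proof (induction rule: rtrancl_induct)
  case base
  then show ?case by simp
next
  case (step y z)
  then show ?case
    using nd_path_weights_extend[OF assms(1), of z] nd_path_weights_extend[of g E w u y z] assms(2)
    by auto
qed

text \<open>Induction on the path, splitting off its last edge. Consecutive edges share some
  endpoint, and an edge may be entered and left at the same one; the claim \<open>ends\<close>
  therefore carries a label from one endpoint of an edge to either endpoint.\<close>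

lemma labels_complete:
  assumes G: "ugraph n E"
    and self: "\<And>x y. {x, y} \<in> E \<Longrightarrow> x \<in> R x \<and> D x x \<le> w {x, y}"
    and step: "\<And>x y u. {x, y} \<in> E \<Longrightarrow> u \<in> R x \<Longrightarrow> D u x \<le> w {x, y} \<Longrightarrow> u \<in> R y \<and> D u y \<le> w {x, y}"
    and x: "x \<in> nd_path_weights E w u v"
  shows "u \<in> R v \<and> D u v \<le> (x :: real)"
proof -
  have ends: "v \<in> R z \<and> D v z \<le> w e" if "e \<in> E" "a \<in> e" "v \<in> R a" "D v a \<le> w e" "z \<in> e" for e a z v
  proof (cases "z = a")
    case True
    then show ?thesis using that by simp
  next
    case False
    have "card e = 2" using that G by (auto simp: ugraph_def)
    then have "e = {a, z}" using that False by (auto simp: card_2_iff)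
    then show ?thesis using step[of a z v] that by simp
  qed
  have "u \<in> R v \<and> D u v \<le> w (last p)" if "edge_path E u v p" "non_decreasing w p" for p
    using that
  proof (induction p arbitrary: v rule: rev_induct)
    case Nil
    then show ?case by (simp add: edge_path_def)
  next
    case (snoc e p)
    have e: "e \<in> E" "v \<in> e" using snoc.prems by (auto simp: edge_path_def)
    show ?case
    proof (cases "p = []")
      case True
      have "u \<in> e" using snoc.prems True by (auto simp: edge_path_def)
      moreover have "card e = 2" using e G by (auto simp: ugraph_def)
      ultimately obtain y where "e = {u, y}" by (auto simp: card_2_iff)
      then have "u \<in> R u \<and> D u u \<le> w e" using self[of u y] e by simp
      then show ?thesis using ends[OF e(1) \<open>u \<in> e\<close> _ _ e(2)] by simp
    next
      case False
      then obtain a where a: "a \<in> last p" "a \<in> e"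
        using snoc.prems by (auto simp: edge_path_def successively_append_iff)
      have "edge_path E u a p" "non_decreasing w p" "w (last p) \<le> w e"
        using snoc.prems False a
        by (auto simp: edge_path_def non_decreasing_def successively_append_iff)
      then have "u \<in> R a \<and> D u a \<le> w e" using snoc.IH[of a] by fastforce
      then show ?thesis using ends[OF e(1) a(2) _ _ e(2)] by simp
    qed
  qed
  then show ?thesis using x unfolding nd_path_weights_def path_weight_def by auto
qed

section \<open>Tournament trees in heap layout\<close>

text \<open>A node stores the winning leaf itself, with \<open>0\<close> for an empty subtree; the
  weight is looked up at the leaf.\<close>

definition best :: "(nat \<Rightarrow> real) \<Rightarrow> nat \<Rightarrow> nat \<Rightarrow> nat" where
  "best wt l r = (if l = 0 then r else if r = 0 then l else if wt r < wt l then r else l)"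

definition tournament :: "nat \<Rightarrow> (nat \<Rightarrow> real) \<Rightarrow> (nat \<Rightarrow> nat) \<Rightarrow> nat set \<Rightarrow> bool" where
  "tournament M wt t A \<longleftrightarrow> A \<subseteq> {M..<2 * M} \<and> (\<forall>j\<in>{M..<2 * M}. t j = (if j \<in> A then j else 0)) \<and>
     (\<forall>i\<in>{1..<M}. t i = best wt (t (2 * i)) (t (2 * i + 1)))"

text \<open>In heap layout the parent of \<open>j\<close> is \<open>j div 2\<close>, so for positive
  \<open>i\<close> this says that \<open>i\<close> is \<open>j\<close> or an ancestor of it.\<close>

definition below :: "nat \<Rightarrow> nat \<Rightarrow> bool" where
  "below i j \<longleftrightarrow> (\<exists>m. j div 2 ^ m = i)"

lemma below_children:
  assumes "i \<noteq> j"
  shows "below i j \<longleftrightarrow> below (2 * i) j \<or> below (2 * i + 1) j"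
proof
  assume "below i j"
  then obtain m where m: "j div 2 ^ m = i" by (auto simp: below_def)
  with assms obtain m' where "m = Suc m'" by (cases m) auto
  then have "j div 2 ^ m' div 2 = i"
    using m by (simp add: div_mult2_eq[symmetric] mult.commute)
  then have "j div 2 ^ m' = 2 * i \<or> j div 2 ^ m' = 2 * i + 1" by linarith
  then show "below (2 * i) j \<or> below (2 * i + 1) j" by (auto simp: below_def)
next
  have "below i j" if "j div 2 ^ m div 2 = i" for m
    using that unfolding below_def
    by (intro exI[of _ "Suc m"]) (simp add: div_mult2_eq[symmetric] mult.commute)
  moreover assume "below (2 * i) j \<or> below (2 * i + 1) j"
  then obtain m where "j div 2 ^ m = 2 * i \<or> j div 2 ^ m = 2 * i + 1" by (auto simp: below_def)
  then have "j div 2 ^ m div 2 = i" by auto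
  ultimately show "below i j" by blast
qed

lemma below_leaf:
  assumes "below i j" "M \<le> i" "j < 2 * M"
  shows "i = j"
proof (rule ccontr)
  assume "i \<noteq> j"
  obtain m where m: "j div 2 ^ m = i" using assms by (auto simp: below_def)
  with \<open>i \<noteq> j\<close> obtain m' where m': "m = Suc m'" by (cases m) auto
  have "j div 2 ^ m = j div 2 div 2 ^ m'"
    using m' by (simp add: div_mult2_eq)
  also have "\<dots> \<le> j div 2" by simp
  finally show False using m assms by linarith
qed

text \<open>Stated for every node and not only for the root because inner nodes will serve as
  priority queues of single vertices. The induction goes from the leaves to the root along
  \<open>2 * M - i\<close>.\<close>

lemma tournament_node:
  assumes T: "tournament M wt t A" and i: "1 \<le> i" "i < 2 * M"
  shows "(t i = 0 \<longrightarrow> (\<forall>j\<in>A. \<not> below i j)) \<and>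
         (t i \<noteq> 0 \<longrightarrow> t i \<in> A \<and> below i (t i) \<and> (\<forall>j\<in>A. below i j \<longrightarrow> wt (t i) \<le> wt j))"
  using i
proof (induction "2 * M - i" arbitrary: i rule: less_induct)
  case less
  have A: "A \<subseteq> {M..<2 * M}" using T by (simp add: tournament_def)
  show ?case
  proof (cases "i < M")
    case False
    then have "t i = (if i \<in> A then i else 0)"
      using T less.prems by (auto simp: tournament_def)
    moreover have "j = i" if "j \<in> A" "below i j" for j
      using below_leaf[of i j M] that A False by auto
    moreover have "below i i" unfolding below_def by (rule exI[of _ 0]) simp
    ultimately show ?thesis using less.prems by auto
  next
    case True
    have l: "(t (2 * i) = 0 \<longrightarrow> (\<forall>j\<in>A. \<not> below (2 * i) j)) \<and>
         (t (2 * i) \<noteq> 0 \<longrightarrow> t (2 * i) \<in> A \<and> below (2 * i) (t (2 * i)) \<and>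
            (\<forall>j\<in>A. below (2 * i) j \<longrightarrow> wt (t (2 * i)) \<le> wt j))"
      by (rule less.hyps) (use True less.prems in auto)
    have r: "(t (2 * i + 1) = 0 \<longrightarrow> (\<forall>j\<in>A. \<not> below (2 * i + 1) j)) \<and>
         (t (2 * i + 1) \<noteq> 0 \<longrightarrow> t (2 * i + 1) \<in> A \<and> below (2 * i + 1) (t (2 * i + 1)) \<and>
            (\<forall>j\<in>A. below (2 * i + 1) j \<longrightarrow> wt (t (2 * i + 1)) \<le> wt j))"
      by (rule less.hyps) (use True less.prems in auto)
    have ti: "t i = best wt (t (2 * i)) (t (2 * i + 1))"
      using T True less.prems by (simp add: tournament_def)
    have b: "below i j \<longleftrightarrow> below (2 * i) j \<or> below (2 * i + 1) j" if "j \<in> A" for j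
      using below_children[of i j] that A True by auto
    consider "t (2 * i) = 0" "t i = t (2 * i + 1)" | "t (2 * i) \<noteq> 0" "t (2 * i + 1) = 0" "t i = t (2 * i)"
      | "t (2 * i) \<noteq> 0" "t (2 * i + 1) \<noteq> 0" "t i = t (2 * i)" "wt (t (2 * i)) \<le> wt (t (2 * i + 1))"
      | "t (2 * i) \<noteq> 0" "t (2 * i + 1) \<noteq> 0" "t i = t (2 * i + 1)" "wt (t (2 * i + 1)) \<le> wt (t (2 * i))"
      unfolding ti best_def by (cases "t (2 * i) = 0"; cases "t (2 * i + 1) = 0";
          cases "wt (t (2 * i + 1)) < wt (t (2 * i))") simp_all
    then show ?thesis
    proof cases
      case 1
      then show ?thesis using l r b by metis
    next
      case 2
      then show ?thesis using l r b by metis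
    next
      case 3
      then show ?thesis using l r b by (metis order_trans)
    next
      case 4
      then show ?thesis using l r b by (metis order_trans)
    qed
  qed
qed

section \<open>Hash-consed set trees in heap layout\<close>

text \<open>Row \<open>v\<close> of \<open>rd\<close> is a complete binary tree with leaves \<open>L, \<dots>, 2 * L - 1\<close>; an inner node holds
  an identifier that \<open>tab\<close> assigns to the pair of identifiers of its children, coded in base \<open>K\<close>.
  The identifier \<open>0\<close> stands both for an empty subtree and for a pair without identifier.
  Nodes in \<open>X\<close> are out of date.\<close>

definition forest :: "nat \<Rightarrow> nat \<Rightarrow> nat \<Rightarrow> (nat \<Rightarrow> nat \<Rightarrow> nat) \<Rightarrow> (nat \<Rightarrow> nat) \<Rightarrow> nat \<Rightarrow>
    (nat \<times> nat) set \<Rightarrow> bool" where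
  "forest n L K rd tab c X \<longleftrightarrow>
     (\<forall>v<n. \<forall>i. 1 \<le> i \<and> i < L \<and> (v, i) \<notin> X \<longrightarrow>
        rd v i = tab (rd v (2 * i) * K + rd v (2 * i + 1)) \<and>
        (rd v i = 0 \<longrightarrow> rd v (2 * i) = 0 \<and> rd v (2 * i + 1) = 0)) \<and>
     (\<forall>v<n. \<forall>i<2 * L. rd v i \<le> Suc c) \<and> tab 0 = 0 \<and> (\<forall>a. tab a \<le> c) \<and>
     (\<forall>a a'. tab a = tab a' \<longrightarrow> tab a \<noteq> 0 \<longrightarrow> a = a')"

lemma forestD:
  assumes "forest n L K rd tab c X"
  shows "v < n \<Longrightarrow> 1 \<le> i \<Longrightarrow> i < L \<Longrightarrow> (v, i) \<notin> X \<Longrightarrow> rd v i = tab (rd v (2 * i) * K + rd v (2 * i + 1))"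
    and "v < n \<Longrightarrow> 1 \<le> i \<Longrightarrow> i < L \<Longrightarrow> (v, i) \<notin> X \<Longrightarrow> rd v i = 0 \<Longrightarrow> rd v (2 * i) = 0 \<and> rd v (2 * i + 1) = 0"
    and "v < n \<Longrightarrow> i < 2 * L \<Longrightarrow> rd v i \<le> Suc c"
    and "tab 0 = 0" and "tab a \<le> c" and "tab a = tab a' \<Longrightarrow> tab a \<noteq> 0 \<Longrightarrow> a = a'"
  using assms unfolding forest_def by blast+

text \<open>Equality descends from parent to child: a common nonzero identifier determines the pair
  code by injectivity of \<open>tab\<close>, and the code determines both children as digits in base
  \<open>K\<close>; an identifier \<open>0\<close> forces empty children. An identifier may occur on
  several levels, which is harmless because only nodes at the same position are compared.\<close>

lemma forest_eqD:
  assumes F: "forest n L K rd tab c {}" and K: "Suc c < K" and xz: "x < n" "z < n"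
    and root: "rd x 1 = rd z 1" and i: "1 \<le> i" "i < 2 * L"
  shows "rd x i = rd z i"
  using i
proof (induction i rule: less_induct)
  case (less i)
  show ?case
  proof (cases "i = 1")
    case True
    then show ?thesis using root by simp
  next
    case False
    define h where "h = i div 2"
    have h: "1 \<le> h" "h < L" "h < i" and i: "i = 2 * h \<or> i = 2 * h + 1"
      using less.prems False by (auto simp: h_def)
    have eq: "rd x h = rd z h" using less.IH[of h] h by auto
    have node: "rd v h = tab (rd v (2 * h) * K + rd v (2 * h + 1))"
      "rd v h = 0 \<Longrightarrow> rd v (2 * h) = 0 \<and> rd v (2 * h + 1) = 0" if "v < n" for v
      using forestD(1,2)[OF F that h(1,2)] by simp_all
    have lt: "rd v j < K" if "v < n" "j < 2 * L" for v j
    proof -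
      have "rd v j \<le> Suc c" using forestD(3)[OF F that] .
      then show ?thesis using K by simp
    qed
    have "rd x (2 * h) = rd z (2 * h) \<and> rd x (2 * h + 1) = rd z (2 * h + 1)"
    proof (cases "rd x h = 0")
      case True
      then show ?thesis using node[OF xz(1)] node[OF xz(2)] eq by simp
    next
      case False
      have e: "rd x (2 * h) * K + rd x (2 * h + 1) = rd z (2 * h) * K + rd z (2 * h + 1)"
        using node(1)[OF xz(1)] node(1)[OF xz(2)] eq False forestD(6)[OF F] by metis
      have dm: "(p * K + q) div K = p" "(p * K + q) mod K = q" if "q < K" for p q
        using that by auto
      show ?thesis
        using dm[OF lt[OF xz(1), of "2 * h + 1"], of "rd x (2 * h)"]
          dm[OF lt[OF xz(2), of "2 * h + 1"], of "rd z (2 * h)"] h unfolding e by simp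
    qed
    then show ?thesis using i by auto
  qed
qed

text \<open>Recomputing the outdated node \<open>h\<close> makes its parent the outdated one. A
  fresh entry for \<open>a\<close> disturbs no other current node: a current node whose code has no
  identifier is \<open>0\<close>, so its children are \<open>0\<close> and its code is
  \<open>0\<close>, whereas \<open>a\<close> is not. Injectivity survives because
  \<open>Suc c\<close> exceeds all identifiers in use.\<close>

lemma forest_step:
  assumes F: "forest n L K rd tab c {(t, h)}" and t: "t < n" and h: "1 \<le> h" "h < L"
    and K: "0 < K"
    and child: "rd t (2 * h) \<noteq> 0 \<or> rd t (2 * h + 1) \<noteq> 0"
    and a: "a = rd t (2 * h) * K + rd t (2 * h + 1)"
    and rd': "\<And>v i. v < n \<Longrightarrow> i < 2 * L \<Longrightarrow> rd' v i = (if v = t \<and> i = h then tab' a else rd v i)"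
    and tab': "tab' = (if tab a = 0 then tab(a := Suc c) else tab)"
    and c': "c' = (if tab a = 0 then Suc c else c)"
  shows "forest n L K rd' tab' c' {(t, h div 2)}" and "rd' t h \<noteq> 0"
proof -
  have a0: "a \<noteq> 0" using a child K by auto
  have tab0: "tab 0 = 0" and tab_le: "tab x \<le> c" and inj: "tab x = tab y \<Longrightarrow> tab x \<noteq> 0 \<Longrightarrow> x = y" for x y
    using forestD(4-6)[OF F] by blast+
  have rd_le: "rd v i \<le> Suc c" if "v < n" "i < 2 * L" for v i
    using forestD(3)[OF F that] .
  have a': "tab' a \<noteq> 0" using tab' by auto
  show "rd' t h \<noteq> 0" using rd' a' t h by auto
  have le': "tab' x \<le> c'" for x using tab_le[of x] by (auto simp: tab' c' le_SucI)
  show "forest n L K rd' tab' c' {(t, h div 2)}"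
    unfolding forest_def
  proof (intro conjI allI impI)
    fix v i
    assume v: "v < n" and vi: "1 \<le> i \<and> i < L \<and> (v, i) \<notin> {(t, h div 2)}"
    have kids: "rd' v (2 * i) = rd v (2 * i)" "rd' v (2 * i + 1) = rd v (2 * i + 1)"
      using rd'[OF v] vi by auto
    show "rd' v i = tab' (rd' v (2 * i) * K + rd' v (2 * i + 1))"
      "rd' v i = 0 \<Longrightarrow> rd' v (2 * i) = 0" "rd' v i = 0 \<Longrightarrow> rd' v (2 * i + 1) = 0"
    proof -
      have *: "rd' v i = tab' (rd v (2 * i) * K + rd v (2 * i + 1)) \<and>
        (rd' v i = 0 \<longrightarrow> rd v (2 * i) = 0 \<and> rd v (2 * i + 1) = 0)"
      proof (cases "v = t \<and> i = h")
        case True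
        have "rd' v i = tab' a" using rd'[OF v, of i] vi True by simp
        moreover have "rd v (2 * i) * K + rd v (2 * i + 1) = a" using True a by simp
        ultimately show ?thesis using a' by metis
      next
        case False
        then have e: "rd' v i = rd v i" using rd'[OF v, of i] vi by auto
        have o: "rd v i = tab (rd v (2 * i) * K + rd v (2 * i + 1))"
          "rd v i = 0 \<Longrightarrow> rd v (2 * i) = 0 \<and> rd v (2 * i + 1) = 0"
          using forestD(1,2)[OF F v, of i] vi False by auto
        define a2 where "a2 = rd v (2 * i) * K + rd v (2 * i + 1)"
        have "tab' a2 = tab a2"
        proof (cases "tab a2 = 0")
          case True
          then have "a2 = 0" using o unfolding a2_def by simp
          then show ?thesis using a0 by (simp add: tab')
        next
          case False
          then show ?thesis by (auto simp: tab')
        qed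
        then show ?thesis using e o unfolding a2_def by metis
      qed
      then show "rd' v i = tab' (rd' v (2 * i) * K + rd' v (2 * i + 1))"
        "rd' v i = 0 \<Longrightarrow> rd' v (2 * i) = 0" "rd' v i = 0 \<Longrightarrow> rd' v (2 * i + 1) = 0"
        unfolding kids by blast+
    qed
  next
    fix v i assume "v < n" "i < 2 * L"
    then show "rd' v i \<le> Suc c'"
      using rd'[of v i] rd_le[of v i] le'[of a] by (simp add: c')
  next
    show "tab' 0 = 0" using a0 tab0 by (auto simp: tab')
  next
    fix x show "tab' x \<le> c'" by (rule le')
  next
    fix x y assume "tab' x = tab' y" "tab' x \<noteq> 0"
    then show "x = y"
      using inj[of x y] tab_le[of x] tab_le[of y] by (auto simp: tab' split: if_splits)
  qed
qed

section \<open>The program and its address arithmetic\<close>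

text \<open>Registers: 0 \<open>n\<close>; 1 the power of two \<open>L > n + 1\<close>; 2 \<open>L * L\<close>; 3 the base \<open>L ^ 3\<close> of the
  pair coding; 4 the number of identifiers in use; 5 the current tree node; 6 an edge; 7 the start
  vertex of the component; 8 the current vertex; 9 the row that receives an element; 10 a leaf
  carrying the current weight; 11 and 12 position and length of the queue; 13 a neighbour;
  14 a code of a pair.  Word arrays: 2 the set trees; 3 the tournament tree, whose leaf
  \<open>L * L + u * L + v\<close> is the edge from \<open>u\<close> to \<open>v\<close>, so that the edges at \<open>u\<close> are those below the
  node \<open>L + u\<close>; 4 the queue; 5 the visited marks; 6 the identifiers.  Weight array 2 holds the
  weights by leaf.\<close>

definition dbl :: "exp \<Rightarrow> exp" where "dbl e = Op Add e e"
definition dbl1 :: "exp \<Rightarrow> exp" where "dbl1 e = Op Add (Op Add e e) (Const 1)"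
definition half :: "exp \<Rightarrow> exp" where "half e = Op Div e (Const 2)"
definition inc :: "nat \<Rightarrow> com" where "inc r = Assign r (Op Add (Reg r) (Const 1))"
definition node :: "nat \<Rightarrow> exp \<Rightarrow> exp" where
  "node r e = Op Add (Op Mul (Reg r) (Op Add (Reg 1) (Reg 1))) e"
definition out_cell :: exp where
  "out_cell = Op Add (Op Mul (Op Sub (Reg 5) (Reg 1)) (Reg 0)) (Reg 9)"
definition pair_code :: exp where
  "pair_code = Op Add (Op Mul (Read 2 (node 9 (dbl (Reg 5)))) (Reg 3)) (Read 2 (node 9 (dbl1 (Reg 5))))"

definition play :: com where
  "play = com.If (Read 3 (dbl (Reg 5)))
     (com.If (Read 3 (dbl1 (Reg 5)))
       (com.If (WLess 2 (Read 3 (dbl1 (Reg 5))) 2 (Read 3 (dbl (Reg 5))))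
         (Write 3 (Reg 5) (Read 3 (dbl1 (Reg 5))))
         (Write 3 (Reg 5) (Read 3 (dbl (Reg 5)))))
       (Write 3 (Reg 5) (Read 3 (dbl (Reg 5)))))
     (Write 3 (Reg 5) (Read 3 (dbl1 (Reg 5))))"

definition replay :: com where
  "replay = While (Op Less (Const 1) (Reg 5)) (Seq (Assign 5 (half (Reg 5))) play)"

definition rehash :: com where
  "rehash = Seq (Assign 5 (half (Reg 5))) (Seq (Assign 14 pair_code)
     (Seq (com.If (Read 6 (Reg 14)) Skip (Seq (inc 4) (Write 6 (Reg 14) (Reg 4))))
       (Write 2 (node 9 (Reg 5)) (Read 6 (Reg 14)))))"

text \<open>The output is written before the climb, while register 5 still is the leaf from which
  \<open>out_cell\<close> recovers the source vertex.\<close>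

definition insert_elem :: com where
  "insert_elem = Seq (Write 2 (node 9 (Reg 5)) (Const 1)) (Seq (Write 1 out_cell (Const 1))
     (Seq (WCopy 1 out_cell 2 (Reg 10)) (While (Op Less (Const 1) (Reg 5)) rehash)))"

lemma costs [simp]:
  "cost (dbl e) = 1 + 2 * cost e" "cost (dbl1 e) = 3 + 2 * cost e" "cost (half e) = 2 + cost e"
  "cost (node r e) = 6 + cost e" "cost out_cell = 7" "cost pair_code = 25"
  by (simp_all add: dbl_def dbl1_def half_def node_def out_cell_def pair_code_def)

section \<open>Frame conditions and index arithmetic\<close>

definition frame :: "nat set \<Rightarrow> nat set \<Rightarrow> nat set \<Rightarrow> state \<Rightarrow> state \<Rightarrow> bool" where
  "frame rs ms ws s s' \<longleftrightarrow> (\<forall>r. r \<notin> rs \<longrightarrow> reg s' r = reg s r) \<and> (\<forall>a. a \<notin> ms \<longrightarrow> mem s' a = mem s a) \<and>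
     (\<forall>a. a \<notin> ws \<longrightarrow> wmem s' a = wmem s a)"

lemma frame_refl [simp]: "frame rs ms ws s s"
  by (simp add: frame_def)

lemma frame_trans:
  "frame rs ms ws s s' \<Longrightarrow> frame rs' ms' ws' s' s'' \<Longrightarrow> rs' \<subseteq> rs \<Longrightarrow> ms' \<subseteq> ms \<Longrightarrow> ws' \<subseteq> ws \<Longrightarrow>
     frame rs ms ws s s''"
  unfolding frame_def by (metis subsetD)

lemma frameD:
  assumes "frame rs ms ws s s'"
  shows "r \<notin> rs \<Longrightarrow> reg s' r = reg s r" "a \<notin> ms \<Longrightarrow> mem s' a = mem s a" "a \<notin> ws \<Longrightarrow> wmem s' a = wmem s a"
  using assms unfolding frame_def by blast+

lemma row_index_inj:
  fixes i j v t m :: nat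
  assumes "i < m" "j < m"
  shows "v * m + i = t * m + j \<longleftrightarrow> v = t \<and> i = j"
proof
  assume eq: "v * m + i = t * m + j"
  have "(v * m + i) div m = v" "(t * m + j) div m = t"
    "(v * m + i) mod m = i" "(t * m + j) mod m = j" using assms by auto
  then show "v = t \<and> i = j" using eq by metis
qed simp

lemma row_index_less:
  fixes i v m n :: nat
  assumes "i < m" "v < n"
  shows "v * m + i < n * m"
proof -
  have "v * m + i < Suc v * m" using assms by simp
  also have "\<dots> \<le> n * m" using assms by (intro mult_right_mono) auto
  finally show ?thesis .
qed

text \<open>The largest numbers that occur are pair codes, below \<open>L ^ 6\<close>; words hold
  everything below \<open>L ^ 8\<close>, so the arithmetic never wraps around.\<close>

locale machine =
  fixes n k L b :: nat and \<rho> :: "nat \<Rightarrow> nat"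
  assumes L_def: "L = 2 ^ k" and b_def: "b = 8 * k" and n_less: "Suc n < L"
begin

lemma k_pos: "1 \<le> k" using L_def n_less by (cases k) auto

lemma k_less: "k < L" unfolding L_def by simp

lemma L_ge: "2 \<le> L" using n_less by simp

lemma word_eq: "2 ^ b = L ^ 8"
  unfolding L_def b_def by (simp add: power_mult[symmetric] mult.commute)

lemma L_pow_le: "i \<le> j \<Longrightarrow> L ^ i \<le> L ^ j"
  using L_ge by (intro power_increasing) auto

lemma less_word: "x \<le> L ^ 7 \<Longrightarrow> x < 2 ^ b"
proof -
  assume "x \<le> L ^ 7"
  also have "L ^ 7 < L ^ 8" using L_ge by (intro power_strict_increasing) auto
  finally show ?thesis by (simp add: word_eq)
qed

lemma L_le: "L * L \<le> L ^ 3" "2 * L \<le> L * L" "L ^ 3 \<le> L ^ 7" "L ^ 6 \<le> L ^ 7"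
proof -
  show "L * L \<le> L ^ 3" using L_pow_le[of 2 3] by (simp add: power2_eq_square)
  show "2 * L \<le> L * L" using L_ge by simp
qed (simp_all add: L_pow_le)

lemma less_word3: "x \<le> L ^ 3 \<Longrightarrow> x < 2 ^ b"
  using L_le less_word by (meson order_trans)

lemma less_word2: "x \<le> 2 * (L * L) \<Longrightarrow> x < 2 ^ b"
proof (rule less_word3)
  assume "x \<le> 2 * (L * L)"
  also have "\<dots> \<le> L * (L * L)" using L_ge by (intro mult_right_mono) auto
  finally show "x \<le> L ^ 3" by (simp add: power3_eq_cube)
qed

lemma less_word1: "x \<le> 2 * L \<Longrightarrow> x < 2 ^ b"
  using L_le by (intro less_word2) linarith

lemma b_pos [simp]: "0 < b" using b_def k_pos by simp

lemma small_consts [simp]: "Suc 0 < 2 ^ b" "1 mod 2 ^ b = (1 :: nat)" "Suc 0 mod 2 ^ b = Suc 0"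
  "2 mod 2 ^ b = (2 :: nat)"
  using less_word1[of 1] less_word1[of 2] L_ge by auto

lemma code_less: "p < L ^ 3 \<Longrightarrow> q < L ^ 3 \<Longrightarrow> p * L ^ 3 + q < 2 ^ b" "p < L ^ 3 \<Longrightarrow> p * L ^ 3 < 2 ^ b"
proof -
  show *: "p * L ^ 3 + q < 2 ^ b" if "p < L ^ 3" "q < L ^ 3" for p q
    using row_index_less[OF that(2,1)] L_le less_word[of "p * L ^ 3 + q"] by (simp flip: power_add)
  show "p * L ^ 3 < 2 ^ b" if "p < L ^ 3" using *[of p 0] that L_ge by simp
qed

lemma eval_dbl: "2 * eval b s e + 1 < 2 ^ b \<Longrightarrow> eval b s (dbl e) = 2 * eval b s e"
  "2 * eval b s e + 1 < 2 ^ b \<Longrightarrow> eval b s (dbl1 e) = 2 * eval b s e + 1"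
  by (simp_all add: dbl_def dbl1_def mult_2)

lemma eval_half: "eval b s (half e) = eval b s e div 2"
  by (simp add: half_def)

lemma eval_node:
  assumes "reg s 1 = L" "reg s r < L" "eval b s e < 2 * L"
  shows "eval b s (node r e) = reg s r * (2 * L) + eval b s e"
proof -
  have 1: "reg s r * (2 * L) + eval b s e < L * (2 * L)" by (rule row_index_less[OF assms(3,2)])
  then have "reg s r * (2 * L) + eval b s e < 2 ^ b" by (intro less_word2) simp
  then show ?thesis using assms less_word1[of "2 * L"] by (simp add: node_def mult_2)
qed

lemma sub_word: "y \<le> x \<Longrightarrow> x < M \<Longrightarrow> (x + M - y) mod M = x - y" for x y M :: nat
proof -
  assume "y \<le> x" "x < M"
  then have "x + M - y = (x - y) + M" "x - y < M" by linarith+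
  then show ?thesis by (metis mod_add_self2 mod_less)
qed

lemma pair_less: "u < n \<Longrightarrow> v < n \<Longrightarrow> u * n + v < L * L"
proof -
  assume "u < n" "v < n"
  then have "u * n + v < n * n" by (rule row_index_less[rotated])
  also have "\<dots> \<le> L * L" using n_less by (intro mult_mono) auto
  finally show ?thesis .
qed

lemma eval_out_cell:
  assumes "reg s 1 = L" "reg s 0 = n" "reg s 5 = L + u" "reg s 9 = v" "u < n" "v < n"
  shows "eval b s out_cell = u * n + v"
proof -
  have "u * n + v < 2 ^ b" using pair_less[OF assms(5,6)] by (intro less_word2) simp
  moreover have "L + u < 2 ^ b" using assms n_less by (intro less_word1) simp
  ultimately show ?thesis using sub_word[of L "L + u" "2 ^ b"] assms by (simp add: out_cell_def)
qed

section \<open>Inserting an element into a set tree\<close>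

definition rd :: "state \<Rightarrow> nat \<Rightarrow> nat \<Rightarrow> nat" where
  "rd s v i = mem s 2 (v * (2 * L) + i)"

definition static :: "state \<Rightarrow> bool" where
  "static s \<longleftrightarrow> reg s 0 = n \<and> reg s 1 = L \<and> reg s 2 = L * L \<and> reg s 3 = L ^ 3"

text \<open>\<open>X\<close> contains the nodes that may be out of date. \<open>c\<close> is a
  budget and not the number of identifiers: it is fixed for a whole insertion while register 4
  grows, and its bound \<open>k * (n * n)\<close> keeps the pair codes within a word.\<close>

definition represents :: "(nat \<times> nat) set \<Rightarrow> nat \<Rightarrow> state \<Rightarrow> (nat \<Rightarrow> nat set) \<Rightarrow> (nat \<Rightarrow> nat \<Rightarrow> real) \<Rightarrow> bool" where
  "represents X c s R D \<longleftrightarrow> static s \<and> (\<forall>v<n. R v \<subseteq> {..<n}) \<and>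
     forest n L (L ^ 3) (rd s) (mem s 6) (reg s 4) X \<and> reg s 4 \<le> c \<and> c \<le> k * (n * n) \<and>
     (\<forall>v<n. \<forall>u<L. rd s v (L + u) = of_bool (u \<in> R v)) \<and>
     (\<forall>u<n. \<forall>v<n. mem s 1 (u * n + v) = of_bool (u \<in> R v) \<and>
        (u \<in> R v \<longrightarrow> wmem s 1 (u * n + v) = D u v))"

text \<open>The origin of the base \<open>L ^ 3\<close> of the pair coding: at most \<open>k\<close>
  identifiers for each of at most \<open>n * n\<close> insertions, where \<open>k\<close> and
  \<open>n\<close> are below \<open>L\<close>.\<close>

lemma ids_bound: "c \<le> k * (n * n) \<Longrightarrow> Suc c < L ^ 3"
proof -
  assume "c \<le> k * (n * n)"
  moreover have "k * (n * n) + 1 \<le> k * (n * n + 1)" using k_pos by (simp add: algebra_simps)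
  moreover have "n * n + 1 \<le> L * L" using mult_mono[of "Suc n" L "Suc n" L] n_less by simp
  then have "k * (n * n + 1) \<le> k * (L * L)" by (rule mult_le_mono2)
  moreover have "k * (L * L) < L * (L * L)" using k_less L_ge by simp
  ultimately have "Suc c < L * (L * L)" by linarith
  then show ?thesis by (simp add: power3_eq_cube mult.assoc)
qed

text \<open>One level of the climb, with \<open>m\<close> identifiers left in the budget. The node
  climbed from is a nonzero child of \<open>h\<close>, so the pair code is not \<open>0\<close> and
  the table entry of the empty pair stays \<open>0\<close>.\<close>

lemma wp_rehash:
  assumes R: "represents {(t, h)} c s R D" and c: "reg s 4 + m \<le> c"
    and h: "h = reg s 5 div 2" "1 \<le> h" "h < L" and t: "reg s 9 = t" "t < n"
    and nz: "rd s t (reg s 5) \<noteq> 0"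
    and Q: "\<And>s' \<tau>'. frame {4, 5, 14} {2, 6} {} s s' \<Longrightarrow> represents {(t, h div 2)} c s' R D \<Longrightarrow>
       reg s' 5 = h \<Longrightarrow> reg s' 4 \<le> reg s 4 + 1 \<Longrightarrow> rd s' t h \<noteq> 0 \<Longrightarrow> \<tau>' \<le> \<tau> + 60 \<Longrightarrow> Q s' \<tau>'"
    and m: "1 \<le> m"
  shows "wp b \<rho> rehash Q s \<tau>"
proof -
  define p q a where "p = rd s t (2 * h)" and "q = rd s t (2 * h + 1)" and "a = p * L ^ 3 + q"
  define tab' where "tab' = (if mem s 6 a = 0 then (mem s 6)(a := Suc (reg s 4)) else mem s 6)"
  define c' where "c' = (if mem s 6 a = 0 then Suc (reg s 4) else reg s 4)"
  have st: "reg s 0 = n" "reg s 1 = L" "reg s 2 = L * L" "reg s 3 = L ^ 3"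
    and F: "forest n L (L ^ 3) (rd s) (mem s 6) (reg s 4) {(t, h)}" and cb: "reg s 4 \<le> c" "c \<le> k * (n * n)"
    using R by (auto simp: represents_def static_def)
  have tL: "t < L" using t n_less by simp
  have pq: "p < L ^ 3" "q < L ^ 3"
    using forestD(3)[OF F t(2), of "2 * h"] forestD(3)[OF F t(2), of "2 * h + 1"] h
      ids_bound[of "reg s 4"] cb by (auto simp: p_def q_def)
  have h2: "2 * h < 2 ^ b" "2 * h + 1 < 2 ^ b" using h by (auto intro!: less_word1)
  define s1 where "s1 = s\<lparr>reg := (reg s)(5 := h)\<rparr>"
  have "eval b s1 (node 9 (dbl (Reg 5))) = t * (2 * L) + 2 * h"
    "eval b s1 (node 9 (dbl1 (Reg 5))) = t * (2 * L) + (2 * h + 1)"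
    using eval_node[of s1 9 "dbl (Reg 5)"] eval_node[of s1 9 "dbl1 (Reg 5)"] eval_dbl[of s1 "Reg 5"] h2 h st t tL
    by (simp_all add: s1_def)
  moreover have "p * L ^ 3 + q < 2 ^ b" "p * L ^ 3 < 2 ^ b" using code_less pq by blast+
  ultimately have a: "eval b s1 pair_code = a"
    using st by (simp add: pair_code_def a_def p_def q_def rd_def s1_def)
  define s2 where "s2 = s1\<lparr>reg := (reg s1)(14 := a)\<rparr>"
  have S4: "Suc (reg s 4) < 2 ^ b" using ids_bound[of "reg s 4"] cb by (intro less_word3) simp
  have kids: "rd s t (2 * h) \<noteq> 0 \<or> rd s t (2 * h + 1) \<noteq> 0"
  proof -
    have "reg s 5 = 2 * h \<or> reg s 5 = 2 * h + 1" using h by linarith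
    then show ?thesis using nz by metis
  qed
  have final: "Q s' \<tau>'"
    if "frame {4, 5, 14} {2, 6} {} s s'" "reg s' 5 = h" "reg s' 4 = c'" "mem s' 6 = tab'"
      "mem s' 2 = (mem s 2)(t * (2 * L) + h := tab' a)" "\<tau>' \<le> \<tau> + 60" for s' \<tau>'
  proof (rule Q)
    have idx: "v * (2 * L) + i = t * (2 * L) + h \<longleftrightarrow> v = t \<and> i = h" if "i < 2 * L" for v i
      using row_index_inj[of i "2 * L" h v t] that h by auto
    have rd': "rd s' v i = (if v = t \<and> i = h then tab' a else rd s v i)" if "i < 2 * L" for v i
      using idx[OF that, of v] \<open>mem s' 2 = _\<close> by (simp add: rd_def)
    have "forest n L (L ^ 3) (rd s') tab' c' {(t, h div 2)}" "rd s' t h \<noteq> 0"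
      by (rule forest_step[where a = a and tab' = tab' and c' = c', OF F t(2) h(2,3) _ kids _ rd'];
          use L_ge in \<open>simp add: a_def p_def q_def tab'_def c'_def\<close>)+
    moreover have "rd s' v (L + u) = rd s v (L + u)" if "u < L" for u v
      using rd'[of "L + u" v] that h by auto
    moreover have "c' \<le> c" using c m by (auto simp: c'_def)
    ultimately show "represents {(t, h div 2)} c s' R D" "rd s' t h \<noteq> 0"
      using R that unfolding represents_def static_def by (auto simp: frame_def)
    show "reg s' 4 \<le> reg s 4 + 1" using that by (simp add: c'_def)
  qed fact+
  have nd: "eval b s' (node 9 (Reg 5)) = t * (2 * L) + h" if "reg s' = (reg s2)(4 := x) \<or> reg s' = reg s2" for s' x
    using eval_node[of s' 9 "Reg 5"] that h st t tL by (auto simp: s2_def s1_def)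
  have "wp b \<rho> rehash Q s \<tau> \<longleftrightarrow> wp b \<rho> (Seq (com.If (Read 6 (Reg 14)) Skip (Seq (inc 4) (Write 6 (Reg 14) (Reg 4))))
       (Write 2 (node 9 (Reg 5)) (Read 6 (Reg 14)))) Q s2 (\<tau> + 30)"
    using a by (simp add: rehash_def wp_simps eval_half h(1) s1_def s2_def)
  also have \<dots>
  proof (cases "mem s 6 a = 0")
    case True
    have r4: "reg s2 4 = reg s 4" "reg s2 14 = a" "mem s2 = mem s" by (simp_all add: s2_def s1_def)
    show ?thesis
      unfolding wp_simps inc_def
      using True r4 S4 nd[of "s2\<lparr>reg := (reg s2)(4 := Suc (reg s 4)),
        mem := (mem s)(6 := (mem s 6)(a := Suc (reg s 4)))\<rparr>" "Suc (reg s 4)"]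
      by (auto intro!: final simp: frame_def s2_def s1_def c'_def tab'_def)
  next
    case False
    have r4: "reg s2 14 = a" "mem s2 = mem s" by (simp_all add: s2_def s1_def)
    show ?thesis
      unfolding wp_simps inc_def
      using False r4 nd[of s2]
      by (auto intro!: final simp: frame_def s2_def s1_def c'_def tab'_def)
  qed
  finally show ?thesis .
qed

section \<open>The number of reached pairs as a potential\<close>

definition npairs :: "(nat \<Rightarrow> nat set) \<Rightarrow> nat" where
  "npairs R = (\<Sum>v<n. card (R v))"

lemma npairs_le:
  assumes "\<forall>v<n. R v \<subseteq> {..<n}" shows "npairs R \<le> n * n"
proof -
  have "npairs R \<le> (\<Sum>v<n. n)" unfolding npairs_def
    using assms card_mono[of "{..<n}"] by (intro sum_mono) fastforce
  then show ?thesis by simp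
qed

lemma npairs_insert:
  assumes "\<forall>v<n. R v \<subseteq> {..<n}" "t < n" "u \<notin> R t"
  shows "npairs (R(t := insert u (R t))) = Suc (npairs R)"
proof -
  have "finite (R t)" using assms by (meson finite_lessThan finite_subset)
  then have "card (insert u (R t)) = Suc (card (R t))" using assms by simp
  moreover have "(\<Sum>v\<in>{..<n} - {t}. card ((R(t := insert u (R t))) v)) = (\<Sum>v\<in>{..<n} - {t}. card (R v))"
    by (intro sum.cong) auto
  ultimately show ?thesis
    unfolding npairs_def using assms(2) by (simp add: sum.remove[of "{..<n}" t])
qed

lemma npairs_mono:
  assumes "\<forall>v<n. R' v \<subseteq> {..<n}" "\<And>v. v < n \<Longrightarrow> R v \<subseteq> R' v"
  shows "npairs R \<le> npairs R'"
  unfolding npairs_def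
proof (rule sum_mono)
  fix v assume "v \<in> {..<n}"
  then show "card (R v) \<le> card (R' v)"
    using assms finite_subset[of "R' v" "{..<n}"] by (intro card_mono) auto
qed

text \<open>The root is node \<open>1\<close>; when the climb has passed it, the outdated node is
  the nonexistent node \<open>0\<close>.\<close>

lemma forest_hole_0: "forest n L K r tab c {(t, 0)} \<Longrightarrow> forest n L K r tab c {}"
  unfolding forest_def by (metis empty_iff insertE not_one_le_zero prod.inject)

text \<open>A leaf lies \<open>k\<close> levels below the root, so each reached pair entitles to
  \<open>k\<close> identifiers.\<close>

definition represents0 :: "state \<Rightarrow> (nat \<Rightarrow> nat set) \<Rightarrow> (nat \<Rightarrow> nat \<Rightarrow> real) \<Rightarrow> bool" where
  "represents0 s R D \<longleftrightarrow> represents {} (k * npairs R) s R D"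

lemma represents0D:
  assumes "represents0 s R D"
  shows "static s" "v < n \<Longrightarrow> R v \<subseteq> {..<n}" "npairs R \<le> n * n"
    "v < n \<Longrightarrow> u < L \<Longrightarrow> rd s v (L + u) = of_bool (u \<in> R v)"
    "reg s 0 = n" "reg s 1 = L" "reg s 2 = L * L" "reg s 3 = L ^ 3"
  using assms npairs_le[of R] unfolding represents0_def represents_def static_def by blast+

lemma represents0_cong:
  assumes "represents0 s R D"
    and "reg s' 0 = reg s 0" "reg s' 1 = reg s 1" "reg s' 2 = reg s 2" "reg s' 3 = reg s 3" "reg s' 4 = reg s 4"
    and "mem s' 1 = mem s 1" "mem s' 2 = mem s 2" "mem s' 6 = mem s 6" "wmem s' 1 = wmem s 1"
  shows "represents0 s' R D"
proof -
  have "rd s' = rd s" using assms by (simp add: rd_def fun_eq_iff)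
  then show ?thesis
    using assms unfolding represents0_def represents_def static_def by metis
qed

text \<open>\<open>D\<close> is chosen in advance: it already assigns the current weight to pairs
  that are still missing from \<open>R\<close>, so that an insertion changes \<open>R\<close>
  alone.\<close>

lemma wp_insert_elem:
  assumes R: "represents0 s R D"
    and s: "reg s 9 = t" "reg s 5 = L + u" "t < n" "u < n" and new: "u \<notin> R t"
    and D: "D u t = wmem s 2 (reg s 10)"
    and Q: "\<And>s' \<tau>'. frame {4, 5, 14} {1, 2, 6} {1} s s' \<Longrightarrow> represents0 s' (R(t := insert u (R t))) D \<Longrightarrow>
       \<tau>' \<le> \<tau> + 100 * k \<Longrightarrow> Q s' \<tau>'"
  shows "wp b \<rho> insert_elem Q s \<tau>"
proof -
  define R' where "R' = R(t := insert u (R t))"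
  define s1 where "s1 = s\<lparr>mem := (mem s)(2 := (mem s 2)(t * (2 * L) + (L + u) := 1),
     1 := (mem s 1)(u * n + t := 1)), wmem := (wmem s)(1 := (wmem s 1)(u * n + t := wmem s 2 (reg s 10)))\<rparr>"
  have st: "reg s 0 = n" "reg s 1 = L" and sub: "\<forall>v<n. R v \<subseteq> {..<n}"
    and F: "forest n L (L ^ 3) (rd s) (mem s 6) (reg s 4) {}"
    and cb: "reg s 4 \<le> k * npairs R"
    using R by (auto simp: represents0_def represents_def static_def)
  have sub': "\<forall>v<n. R' v \<subseteq> {..<n}" using sub s by (auto simp: R'_def)
  have tot: "npairs R' = Suc (npairs R)" unfolding R'_def by (rule npairs_insert[OF sub s(3) new])
  have uL: "L + u < 2 * L" using s n_less by simp
  have "wp b \<rho> insert_elem Q s \<tau> \<longleftrightarrow>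
      wp b \<rho> (While (Op Less (Const 1) (Reg 5)) rehash) Q s1 (\<tau> + 27)"
  proof -
    have n1: "eval b s' (node 9 (Reg 5)) = t * (2 * L) + (L + u)" if "reg s' = reg s" for s'
      using eval_node[of s' 9 "Reg 5"] that st s uL n_less by simp
    have n2: "eval b s' out_cell = u * n + t" if "reg s' = reg s" for s'
      using eval_out_cell[of s' u t] that st s by simp
    show ?thesis by (simp add: insert_elem_def wp_simps n1 n2 s1_def add.commute[of _ \<tau>])
  qed
  also have \<dots>
  \<comment> \<open>Here \<open>m\<close> bounds the bit length of the current node, thus the levels
    left, the identifiers still allowed and the time still available. The root has bit length
    \<open>1\<close>, whence the extra \<open>1\<close> in the identifier budget and in
    \<open>k + 1\<close>.\<close>
  proof (rule wp_While[where I = "\<lambda>s' \<tau>'. \<exists>m. frame {4, 5, 14} {1, 2, 6} {1} s s' \<and>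
      represents {(t, reg s' 5 div 2)} (k * npairs R') s' R' D \<and> reg s' 4 + m \<le> k * npairs R' + 1 \<and>
      rd s' t (reg s' 5) \<noteq> 0 \<and> 1 \<le> reg s' 5 \<and> reg s' 5 < 2 ^ m \<and> reg s' 5 < 2 * L \<and>
      \<tau>' + 64 * m \<le> \<tau> + 27 + 64 * (k + 1)" and B = "\<tau> + 27 + 64 * (k + 1)"])
    have rd1: "rd s1 v i = (if v = t \<and> i = L + u then 1 else rd s v i)" if "i < 2 * L" for v i
      using row_index_inj[OF that uL, of v t] by (simp add: rd_def s1_def)
    have F1: "forest n L (L ^ 3) (rd s1) (mem s 6) (reg s 4) {(t, (L + u) div 2)}"
      unfolding forest_def
    proof (intro conjI allI impI)
      fix v i assume v: "v < n" and i: "1 \<le> i \<and> i < L \<and> (v, i) \<notin> {(t, (L + u) div 2)}"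
      have e: "rd s1 v i = rd s v i" using rd1[of i v] i by auto
      have e1: "rd s1 v (2 * i) = rd s v (2 * i)" using rd1[of "2 * i" v] i by auto
      have e2: "rd s1 v (2 * i + 1) = rd s v (2 * i + 1)" using rd1[of "2 * i + 1" v] i by auto
      show "rd s1 v i = mem s 6 (rd s1 v (2 * i) * L ^ 3 + rd s1 v (2 * i + 1))"
        "rd s1 v i = 0 \<Longrightarrow> rd s1 v (2 * i) = 0" "rd s1 v i = 0 \<Longrightarrow> rd s1 v (2 * i + 1) = 0"
        unfolding e e1 e2 using forestD(1,2)[OF F v, of i] i by blast+
    next
      \<comment> \<open>The leaf value \<open>1\<close> is the reason for the bound
        \<open>Suc c\<close> on nodes: no identifier may be in use yet.\<close>
      fix v i assume "v < n" "i < 2 * L"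
      then show "rd s1 v i \<le> Suc (reg s 4)" using rd1[of i v] forestD(3)[OF F, of v i] by auto
    qed (use forestD(4-6)[OF F] in blast)+
    have rep1: "represents {(t, (L + u) div 2)} (k * npairs R') s1 R' D"
      unfolding represents_def
    proof (intro conjI allI impI)
      show "static s1" using R by (simp add: represents0_def represents_def static_def s1_def)
      show "R' v \<subseteq> {..<n}" if "v < n" for v using sub' that by blast
      show "forest n L (L ^ 3) (rd s1) (mem s1 6) (reg s1 4) {(t, (L + u) div 2)}"
        using F1 by (simp add: s1_def)
      show "reg s1 4 \<le> k * npairs R'" using cb by (simp add: s1_def tot)
      show "k * npairs R' \<le> k * (n * n)" using npairs_le[OF sub'] by simp
      show "rd s1 v (L + u') = of_bool (u' \<in> R' v)" if "v < n" "u' < L" for v u'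
        using rd1[of "L + u'" v] represents0D(4)[OF R that] that by (auto simp: R'_def)
      show "mem s1 1 (u' * n + v) = of_bool (u' \<in> R' v)" "u' \<in> R' v \<Longrightarrow> wmem s1 1 (u' * n + v) = D u' v"
        if "u' < n" "v < n" for u' v
      proof -
        have "mem s 1 (u' * n + v) = of_bool (u' \<in> R v)" "u' \<in> R v \<Longrightarrow> wmem s 1 (u' * n + v) = D u' v"
          using R that by (auto simp: represents0_def represents_def)
        then show "mem s1 1 (u' * n + v) = of_bool (u' \<in> R' v)" "u' \<in> R' v \<Longrightarrow> wmem s1 1 (u' * n + v) = D u' v"
          using row_index_inj[OF that(2) s(3), of u' u] D by (auto simp: R'_def s1_def split: if_splits)
      qed
    qed
    show "\<exists>m. frame {4, 5, 14} {1, 2, 6} {1} s s1 \<and>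
      represents {(t, reg s1 5 div 2)} (k * npairs R') s1 R' D \<and> reg s1 4 + m \<le> k * npairs R' + 1 \<and>
      rd s1 t (reg s1 5) \<noteq> 0 \<and> 1 \<le> reg s1 5 \<and> reg s1 5 < 2 ^ m \<and> reg s1 5 < 2 * L \<and>
      \<tau> + 27 + 64 * m \<le> \<tau> + 27 + 64 * (k + 1)"
    proof (intro exI[of _ "k + 1"] conjI)
      show "frame {4, 5, 14} {1, 2, 6} {1} s s1" by (simp add: frame_def s1_def)
      show "represents {(t, reg s1 5 div 2)} (k * npairs R') s1 R' D" using rep1 s by (simp add: s1_def)
      show "reg s1 4 + (k + 1) \<le> k * npairs R' + 1" using cb by (simp add: s1_def tot)
      show "rd s1 t (reg s1 5) \<noteq> 0" using rd1[OF uL, of t] s by (simp add: s1_def)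
      show "reg s1 5 < 2 ^ (k + 1)" "reg s1 5 < 2 * L" "1 \<le> reg s1 5"
        using s n_less by (simp_all add: s1_def flip: L_def)
    qed simp
  next
    fix s' \<tau>'
    assume "\<exists>m. frame {4, 5, 14} {1, 2, 6} {1} s s' \<and>
      represents {(t, reg s' 5 div 2)} (k * npairs R') s' R' D \<and> reg s' 4 + m \<le> k * npairs R' + 1 \<and>
      rd s' t (reg s' 5) \<noteq> 0 \<and> 1 \<le> reg s' 5 \<and> reg s' 5 < 2 ^ m \<and> reg s' 5 < 2 * L \<and>
      \<tau>' + 64 * m \<le> \<tau> + 27 + 64 * (k + 1)" (is "\<exists>m. ?I s' \<tau>' m")
    then obtain m where I: "?I s' \<tau>' m" ..
    have m1: "1 \<le> m" using I by (cases m) auto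
    {
      assume "eval b s' (Op Less (Const 1) (Reg 5)) \<noteq> 0"
      then have gt: "1 < reg s' 5" by (simp split: if_splits)
      have m: "2 \<le> m" using I gt by (cases m; cases "m - 1") auto
      show "wp b \<rho> rehash (\<lambda>s' \<tau>'. \<exists>m. ?I s' \<tau>' m) s' (\<tau>' + (1 + cost (Op Less (Const 1) (Reg 5))))"
      proof (rule wp_rehash[where m = "m - 1"])
        show "represents {(t, reg s' 5 div 2)} (k * npairs R') s' R' D" using I by blast
        show "reg s' 4 + (m - 1) \<le> k * npairs R'" using I m by auto
        show "reg s' 5 div 2 = reg s' 5 div 2" ..
        show "1 \<le> reg s' 5 div 2" "reg s' 5 div 2 < L" using I gt by auto
        show "reg s' 9 = t" using frameD(1)[OF conjunct1[OF I], of 9] s by simp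
        show "rd s' t (reg s' 5) \<noteq> 0" using I by blast
        show "1 \<le> m - 1" using m by simp
        fix s2 \<tau>2
        assume 2: "frame {4, 5, 14} {2, 6} {} s' s2"
          "represents {(t, reg s' 5 div 2 div 2)} (k * npairs R') s2 R' D" "reg s2 5 = reg s' 5 div 2"
          "reg s2 4 \<le> reg s' 4 + 1" "rd s2 t (reg s' 5 div 2) \<noteq> 0"
          "\<tau>2 \<le> \<tau>' + (1 + cost (Op Less (Const 1) (Reg 5))) + 60"
        show "\<exists>m. ?I s2 \<tau>2 m"
        proof (intro exI[of _ "m - 1"] conjI)
          show "frame {4, 5, 14} {1, 2, 6} {1} s s2" by (rule frame_trans[OF conjunct1[OF I] 2(1)]) auto
          have "(2 :: nat) ^ m = 2 * 2 ^ (m - 1)" using m by (cases m) auto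
          then show "reg s2 5 < 2 ^ (m - 1)" using I 2(3) by auto
          show "\<tau>2 + 64 * (m - 1) \<le> \<tau> + 27 + 64 * (k + 1)" using I 2(6) m by auto
        qed (use I 2 m gt in auto)
      qed (fact s)
    next
      assume "eval b s' (Op Less (Const 1) (Reg 5)) = 0"
      then have i1: "reg s' 5 = 1" using I by (simp split: if_splits)
      show "Q s' (\<tau>' + (1 + cost (Op Less (Const 1) (Reg 5))))"
      proof (rule Q)
        show "frame {4, 5, 14} {1, 2, 6} {1} s s'" using I by blast
        have "represents {(t, 0)} (k * npairs R') s' R' D" using I i1 by simp
        then have "represents {} (k * npairs R') s' R' D"
          unfolding represents_def using forest_hole_0 by blast
        then show "represents0 s' (R(t := insert u (R t))) D" by (simp add: represents0_def R'_def)
        show "\<tau>' + (1 + cost (Op Less (Const 1) (Reg 5))) \<le> \<tau> + 100 * k" using I m1 k_pos by simp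
      qed
    next
      show "\<tau>' \<le> \<tau> + 27 + 64 * (k + 1)" using I by simp
    }
  qed
  finally show ?thesis .
qed

section \<open>Merging two set trees\<close>

definition descend :: com where
  "descend = While (Op Less (Reg 5) (Reg 1)) (Seq (Assign 5 (dbl (Reg 5)))
     (com.If (Op Equal (Read 2 (node 7 (Reg 5))) (Read 2 (node 8 (Reg 5)))) (inc 5) Skip))"

definition merge :: com where
  "merge = While (Op Equal (Op Equal (Read 2 (node 7 (Const 1))) (Read 2 (node 8 (Const 1)))) (Const 0))
     (Seq (Assign 5 (Const 1)) (Seq descend
       (Seq (com.If (Read 2 (node 7 (Reg 5))) (Assign 9 (Reg 8)) (Assign 9 (Reg 7))) insert_elem)))"

lemma eval_root:
  assumes "reg s 1 = L" "reg s r < n"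
  shows "eval b s (Read 2 (node r (Const 1))) = rd s (reg s r) 1"
  using eval_node[of s r "Const 1"] assms n_less by (simp add: rd_def)

lemma eval_entry:
  assumes "reg s 1 = L" "reg s r < n" "reg s 5 < 2 * L"
  shows "eval b s (Read 2 (node r (Reg 5))) = rd s (reg s r) (reg s 5)"
  using eval_node[of s r "Reg 5"] assms n_less by (simp add: rd_def)

text \<open>Nodes are functions of their children, so two different nodes at the same position have
  different left or different right children. On level \<open>m\<close> the current node lies
  between \<open>2 ^ m\<close> and \<open>2 ^ Suc m\<close>, which bounds the number of turns by
  \<open>k\<close>.\<close>

lemma wp_descend:
  assumes R: "represents0 s R D" and s: "reg s 7 = x" "reg s 8 = z" "x < n" "z < n" "reg s 5 = 1"
    and diff: "rd s x 1 \<noteq> rd s z 1"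
    and Q: "\<And>u \<tau>'. u < L \<Longrightarrow> rd s x (L + u) \<noteq> rd s z (L + u) \<Longrightarrow> \<tau>' \<le> \<tau> + 34 * k + 4 \<Longrightarrow>
      Q (s\<lparr>reg := (reg s)(5 := L + u)\<rparr>) \<tau>'"
  shows "wp b \<rho> descend Q s \<tau>"
  unfolding descend_def
proof (rule wp_While[where B = "\<tau> + 34 * k" and I = "\<lambda>s' \<tau>'. \<exists>i m. s' = s\<lparr>reg := (reg s)(5 := i)\<rparr> \<and>
    2 ^ m \<le> i \<and> i < 2 ^ Suc m \<and> m \<le> k \<and> rd s x i \<noteq> rd s z i \<and> \<tau>' \<le> \<tau> + 34 * m"])
  have "reg s = (reg s)(5 := 1)" using s by (simp add: fun_eq_iff)
  then have "s = s\<lparr>reg := (reg s)(5 := 1)\<rparr>" by (metis state.surjective state.update_convs(1))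
  then show "\<exists>i m. s = s\<lparr>reg := (reg s)(5 := i)\<rparr> \<and>
    2 ^ m \<le> i \<and> i < 2 ^ Suc m \<and> m \<le> k \<and> rd s x i \<noteq> rd s z i \<and> \<tau> \<le> \<tau> + 34 * m"
    using diff by (intro exI[of _ 1] exI[of _ 0]) auto
next
  note st = represents0D(5-8)[OF R]
  have F: "forest n L (L ^ 3) (rd s) (mem s 6) (reg s 4) {}"
    using R by (simp add: represents0_def represents_def)
  fix s' \<tau>'
  assume "\<exists>i m. s' = s\<lparr>reg := (reg s)(5 := i)\<rparr> \<and>
    2 ^ m \<le> i \<and> i < 2 ^ Suc m \<and> m \<le> k \<and> rd s x i \<noteq> rd s z i \<and> \<tau>' \<le> \<tau> + 34 * m"
    (is "\<exists>i m. ?I s' \<tau>' i m")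
  then obtain i m where I: "?I s' \<tau>' i m" by blast
  have s': "s' = s\<lparr>reg := (reg s)(5 := i)\<rparr>" using I by blast
  have i1: "1 \<le> i" using I one_le_power[of "2 :: nat" m] by linarith
  {
    assume "eval b s' (Op Less (Reg 5) (Reg 1)) \<noteq> 0"
    then have iL: "i < L" using st I by (simp split: if_splits)
    have mk: "m < k"
    proof (rule ccontr)
      assume "\<not> m < k"
      then have "m = k" using I by simp
      then show False using I iL L_def by simp
    qed
    define s2 where "s2 = s\<lparr>reg := (reg s)(5 := 2 * i)\<rparr>"
    have "2 * i + 1 < 2 ^ b" using iL by (intro less_word1) simp
    then have d: "eval b s' (dbl (Reg 5)) = 2 * i" using eval_dbl(1)[of s' "Reg 5"] s' by simp
    have e: "eval b s2 (Read 2 (node 7 (Reg 5))) = rd s x (2 * i)"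
      "eval b s2 (Read 2 (node 8 (Reg 5))) = rd s z (2 * i)"
      using eval_entry[of s2 7] eval_entry[of s2 8] st s iL by (auto simp: s2_def rd_def)
    have pow: "2 ^ Suc m \<le> 2 * i" "2 * i + 1 < 2 ^ Suc (Suc m)" using I by auto
    have kids: "rd s x (2 * i) \<noteq> rd s z (2 * i) \<or> rd s x (2 * i + 1) \<noteq> rd s z (2 * i + 1)"
      using forestD(1)[OF F s(3) i1 iL] forestD(1)[OF F s(4) i1 iL] I by fastforce
    have w: "wp b \<rho> (com.If (Op Equal (Read 2 (node 7 (Reg 5))) (Read 2 (node 8 (Reg 5)))) (inc 5) Skip)
      (\<lambda>s' \<tau>'. \<exists>i m. ?I s' \<tau>' i m) s2 (\<tau>' + 8)"
    proof (cases "rd s x (2 * i) = rd s z (2 * i)")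
      case True
      have "Suc (2 * i) < 2 ^ b" using \<open>2 * i + 1 < 2 ^ b\<close> by simp
      then have "wp b \<rho> (com.If (Op Equal (Read 2 (node 7 (Reg 5))) (Read 2 (node 8 (Reg 5)))) (inc 5) Skip)
        (\<lambda>s' \<tau>'. \<exists>i m. ?I s' \<tau>' i m) s2 (\<tau>' + 8) \<longleftrightarrow>
        (\<exists>i' m'. ?I (s\<lparr>reg := (reg s)(5 := 2 * i + 1)\<rparr>) (\<tau>' + 8 + 22) i' m')"
        using e True by (simp add: wp_simps inc_def s2_def add.commute[of _ \<tau>'])
      also have \<dots>
        using I pow mk kids True by - (rule exI[of _ "2 * i + 1"], rule exI[of _ "Suc m"], auto simp: fun_upd_def)
      finally show ?thesis .
    next
      case False
      have "wp b \<rho> (com.If (Op Equal (Read 2 (node 7 (Reg 5))) (Read 2 (node 8 (Reg 5)))) (inc 5) Skip)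
        (\<lambda>s' \<tau>'. \<exists>i m. ?I s' \<tau>' i m) s2 (\<tau>' + 8) \<longleftrightarrow>
        (\<exists>i' m'. ?I s2 (\<tau>' + 8 + 19) i' m')"
        using e False by (simp add: wp_simps inc_def add.commute[of _ \<tau>'])
      also have \<dots>
        using I pow mk kids False by - (rule exI[of _ "2 * i"], rule exI[of _ "Suc m"], auto simp: s2_def fun_upd_def)
      finally show ?thesis .
    qed
    show "wp b \<rho> (Seq (Assign 5 (dbl (Reg 5)))
     (com.If (Op Equal (Read 2 (node 7 (Reg 5))) (Read 2 (node 8 (Reg 5)))) (inc 5) Skip))
      (\<lambda>s' \<tau>'. \<exists>i m. ?I s' \<tau>' i m) s' (\<tau>' + (1 + cost (Op Less (Reg 5) (Reg 1))))"
      unfolding wp_Seq wp_Assign d by (rule wp_cong[OF w]) (simp_all add: s' s2_def)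
  next
    assume "eval b s' (Op Less (Reg 5) (Reg 1)) = 0"
    then have iL: "L \<le> i" using st I by (simp split: if_splits)
    have "i < 2 * L"
    proof -
      have "i < 2 ^ Suc m" using I by blast
      also have "(2 :: nat) ^ Suc m \<le> 2 ^ Suc k" using I by (intro power_increasing) auto
      finally show ?thesis by (simp add: L_def)
    qed
    then have "Q (s\<lparr>reg := (reg s)(5 := L + (i - L))\<rparr>) (\<tau>' + (1 + cost (Op Less (Reg 5) (Reg 1))))"
      using iL I by (intro Q) (auto intro: order_trans)
    then show "Q s' (\<tau>' + (1 + cost (Op Less (Reg 5) (Reg 1))))" using iL s' by simp
  next
    show "\<tau>' \<le> \<tau> + 34 * k" using I by (auto intro: order_trans)
  }
qed

text \<open>Each turn costs at most \<open>200 * k\<close> and adds one pair, so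
  \<open>npairs\<close> pays for all turns and the \<open>20\<close> is left over for the final
  test. Elements only move between the two sets, hence their union is invariant; equal roots mean
  equal sets by \<open>forest_eqD\<close>, so both sets then are that union. The case
  \<open>x = z\<close> is included and ends at once.\<close>

lemma wp_merge:
  assumes R: "represents0 s R D" and s: "reg s 7 = x" "reg s 8 = z" "x < n" "z < n"
    and D: "\<And>u v. u < n \<Longrightarrow> v < n \<Longrightarrow> u \<notin> R v \<Longrightarrow> D u v = wmem s 2 (reg s 10)"
    and Q: "\<And>s' \<tau>' R'. frame {4, 5, 9, 14} {1, 2, 6} {1} s s' \<Longrightarrow> represents0 s' R' D \<Longrightarrow>
       R' = R(x := R x \<union> R z, z := R x \<union> R z) \<Longrightarrow> npairs R \<le> npairs R' \<Longrightarrow>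
       \<tau>' + 200 * k * npairs R \<le> \<tau> + 20 + 200 * k * npairs R' \<Longrightarrow> Q s' \<tau>'"
  shows "wp b \<rho> merge Q s \<tau>"
  unfolding merge_def
proof (rule wp_While[where B = "\<tau> + 200 * k * (n * n)" and
    I = "\<lambda>s' \<tau>'. \<exists>R'. frame {4, 5, 9, 14} {1, 2, 6} {1} s s' \<and> represents0 s' R' D \<and>
      (\<forall>v<n. R v \<subseteq> R' v) \<and> R' x \<union> R' z = R x \<union> R z \<and> (\<forall>v. v \<noteq> x \<and> v \<noteq> z \<longrightarrow> R' v = R v) \<and>
      \<tau>' + 200 * k * npairs R \<le> \<tau> + 200 * k * npairs R'"])
  show "\<exists>R'. frame {4, 5, 9, 14} {1, 2, 6} {1} s s \<and> represents0 s R' D \<and>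
      (\<forall>v<n. R v \<subseteq> R' v) \<and> R' x \<union> R' z = R x \<union> R z \<and> (\<forall>v. v \<noteq> x \<and> v \<noteq> z \<longrightarrow> R' v = R v) \<and>
      \<tau> + 200 * k * npairs R \<le> \<tau> + 200 * k * npairs R'"
    using R by (intro exI[of _ R]) auto
next
  fix s' \<tau>'
  assume "\<exists>R'. frame {4, 5, 9, 14} {1, 2, 6} {1} s s' \<and> represents0 s' R' D \<and>
      (\<forall>v<n. R v \<subseteq> R' v) \<and> R' x \<union> R' z = R x \<union> R z \<and> (\<forall>v. v \<noteq> x \<and> v \<noteq> z \<longrightarrow> R' v = R v) \<and>
      \<tau>' + 200 * k * npairs R \<le> \<tau> + 200 * k * npairs R'" (is "\<exists>R'. ?I s' \<tau>' R'")
  then obtain R' where I: "?I s' \<tau>' R'" by blast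
  have R': "represents0 s' R' D" and fr: "frame {4, 5, 9, 14} {1, 2, 6} {1} s s'" using I by blast+
  note st = represents0D(5-8)[OF R']
  have rs: "reg s' 7 = x" "reg s' 8 = z" "reg s' 10 = reg s 10" "wmem s' 2 = wmem s 2"
    using s fr by (auto simp: frame_def)
  have root: "eval b s' (Read 2 (node 7 (Const 1))) = rd s' x 1" "eval b s' (Read 2 (node 8 (Const 1))) = rd s' z 1"
    using eval_root[of s' 7] eval_root[of s' 8] rs s st by auto
  let ?c = "Op Equal (Op Equal (Read 2 (node 7 (Const 1))) (Read 2 (node 8 (Const 1)))) (Const 0)"
  have cond: "eval b s' ?c \<noteq> 0 \<longleftrightarrow> rd s' x 1 \<noteq> rd s' z 1"
    using root by (simp del: eval.simps(3))
  have tot: "npairs R \<le> npairs R'" using represents0D(2)[OF R'] I by (intro npairs_mono) auto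
  {
    assume "eval b s' ?c \<noteq> 0"
    then have ne: "rd s' x 1 \<noteq> rd s' z 1" using cond by simp
    define s1 where "s1 = s'\<lparr>reg := (reg s')(5 := 1)\<rparr>"
    have R1: "represents0 s1 R' D" by (rule represents0_cong[OF R']) (simp_all add: s1_def)
    have "wp b \<rho> descend (wp b \<rho> (Seq (com.If (Read 2 (node 7 (Reg 5))) (Assign 9 (Reg 8)) (Assign 9 (Reg 7))) insert_elem)
      (\<lambda>s' \<tau>'. \<exists>R'. ?I s' \<tau>' R')) s1 (\<tau>' + 22)"
    proof (rule wp_descend[OF R1, of x z])
      show "reg s1 7 = x" "reg s1 8 = z" "x < n" "z < n" "reg s1 5 = 1"
        using rs s by (simp_all add: s1_def)
      show "rd s1 x 1 \<noteq> rd s1 z 1" using ne by (simp add: s1_def rd_def)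
      fix u \<tau>2
      assume u: "u < L" "rd s1 x (L + u) \<noteq> rd s1 z (L + u)" and \<tau>2: "\<tau>2 \<le> \<tau>' + 22 + 34 * k + 4"
      define t where "t = (if rd s1 x (L + u) \<noteq> 0 then z else x)"
      define s2 where "s2 = s1\<lparr>reg := (reg s1)(5 := L + u)\<rparr>"
      have leaf: "rd s1 v (L + u) = of_bool (u \<in> R' v)" if "v < n" for v
        using represents0D(4)[OF R1 that u(1)] .
      have tn: "t < n" and txz: "t = x \<or> t = z" using s by (auto simp: t_def)
      have ut: "u \<notin> R' t" "u \<in> R' x \<union> R' z"
        using u leaf[OF s(3)] leaf[OF s(4)] by (auto simp: t_def split: if_splits)
      have un: "u < n" using ut represents0D(2)[OF R' s(3)] represents0D(2)[OF R' s(4)] by auto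
      have e: "eval b s2 (Read 2 (node 7 (Reg 5))) = rd s1 x (L + u)"
        using eval_entry[of s2 7] rs s st u by (simp add: s2_def s1_def rd_def)
      define s3 where "s3 = s2\<lparr>reg := (reg s2)(9 := t)\<rparr>"
      have step: "wp b \<rho> insert_elem (\<lambda>s' \<tau>'. \<exists>R'. ?I s' \<tau>' R') s3 \<tau>3" if \<tau>3: "\<tau>3 \<le> \<tau>2 + 11" for \<tau>3
      proof (rule wp_insert_elem[of s3 R' D t u])
        show "represents0 s3 R' D" by (rule represents0_cong[OF R']) (simp_all add: s1_def s2_def s3_def)
        show "reg s3 9 = t" "reg s3 5 = L + u" by (simp_all add: s2_def s3_def)
        have "u \<notin> R t" using I tn ut by auto
        then show "D u t = wmem s3 2 (reg s3 10)"
          using D[OF un tn] rs by (simp add: s1_def s2_def s3_def)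
        fix s4 \<tau>4
        assume 4: "frame {4, 5, 14} {1, 2, 6} {1} s3 s4"
          "represents0 s4 (R'(t := insert u (R' t))) D" "\<tau>4 \<le> \<tau>3 + 100 * k"
        have "frame {4, 5, 9, 14} {1, 2, 6} {1} s s3"
          using fr by (auto simp: frame_def s1_def s2_def s3_def)
        then have 5: "frame {4, 5, 9, 14} {1, 2, 6} {1} s s4"
          by (rule frame_trans[OF _ 4(1)]) auto
        have "npairs (R'(t := insert u (R' t))) = Suc (npairs R')"
          using represents0D(2)[OF R'] tn ut(1) by (intro npairs_insert) auto
        moreover have "\<tau>4 + 200 * k * npairs R \<le> \<tau>' + 200 * k * npairs R + 200 * k"
          using 4(3) \<tau>3 \<tau>2 k_pos by simp
        ultimately have "\<tau>4 + 200 * k * npairs R \<le> \<tau> + 200 * k * npairs (R'(t := insert u (R' t)))"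
          using I by simp
        then show "\<exists>R'. ?I s4 \<tau>4 R'"
        proof (intro exI[of _ "R'(t := insert u (R' t))"] conjI)
          show "\<forall>v<n. R v \<subseteq> (R'(t := insert u (R' t))) v" using I by auto
          show "(R'(t := insert u (R' t))) x \<union> (R'(t := insert u (R' t))) z = R x \<union> R z"
            using I ut(2) txz by auto
          show "\<forall>v. v \<noteq> x \<and> v \<noteq> z \<longrightarrow> (R'(t := insert u (R' t))) v = R v" using I txz by auto
        qed (use 4(2) 5 in blast)+
      qed (use tn un ut in simp_all)
      have r: "reg s2 7 = x" "reg s2 8 = z" using rs by (simp_all add: s2_def s1_def)
      show "wp b \<rho> (Seq (com.If (Read 2 (node 7 (Reg 5))) (Assign 9 (Reg 8)) (Assign 9 (Reg 7))) insert_elem)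
        (\<lambda>s' \<tau>'. \<exists>R'. ?I s' \<tau>' R') (s1\<lparr>reg := (reg s1)(5 := L + u)\<rparr>) \<tau>2"
        unfolding s2_def[symmetric] wp_Seq wp_If e wp_Assign
        by (split if_split, intro conjI impI; rule wp_cong[OF step[OF order_refl]]; simp add: r s3_def t_def)
    qed
    note w = this
    show "wp b \<rho> (Seq (Assign 5 (Const 1)) (Seq descend
       (Seq (com.If (Read 2 (node 7 (Reg 5))) (Assign 9 (Reg 8)) (Assign 9 (Reg 7))) insert_elem)))
       (\<lambda>s' \<tau>'. \<exists>R'. ?I s' \<tau>' R') s' (\<tau>' + (1 + cost ?c))"
      unfolding wp_Seq[of _ _ "Assign 5 (Const 1)"] wp_Seq[of _ _ descend] wp_Assign
      by (rule wp_cong[OF w]) (simp_all add: s1_def)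
  next
    assume "eval b s' ?c = 0"
    then have eq: "rd s' x 1 = rd s' z 1" using cond by simp
    have F: "forest n L (L ^ 3) (rd s') (mem s' 6) (reg s' 4) {}" and "reg s' 4 \<le> k * (n * n)"
      using R' unfolding represents0_def represents_def by (blast, meson order_trans)
    have "u \<in> R' x \<longleftrightarrow> u \<in> R' z" if "u < L" for u
    proof -
      have "rd s' x (L + u) = rd s' z (L + u)"
        using forest_eqD[OF F ids_bound s(3,4) eq, of "L + u"] that \<open>reg s' 4 \<le> _\<close> L_ge by simp
      then have "of_bool (u \<in> R' x) = (of_bool (u \<in> R' z) :: nat)"
        using represents0D(4)[OF R' s(3) that] represents0D(4)[OF R' s(4) that] by simp
      then show ?thesis by (simp only: of_bool_eq_iff)
    qed
    moreover have "R' x \<subseteq> {..<L}" "R' z \<subseteq> {..<L}"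
      using represents0D(2)[OF R' s(3)] represents0D(2)[OF R' s(4)] n_less by auto
    ultimately have "R' x = R' z" by blast
    then have eqR: "R' = R(x := R x \<union> R z, z := R x \<union> R z)" using I by (auto simp: fun_eq_iff)
    show "Q s' (\<tau>' + (1 + cost ?c))"
      by (rule Q[OF fr R' eqR tot]) (use I in simp)
  next
    have "200 * k * npairs R' \<le> 200 * k * (n * n)" using represents0D(3)[OF R'] by simp
    then show "\<tau>' \<le> \<tau> + 200 * k * (n * n)" using I by linarith
  }
qed

section \<open>Extracting edges from the tournament tree\<close>

definition remove_edge :: com where
  "remove_edge = Seq (Write 3 (Reg 6) (Const 0)) (Seq (Assign 5 (Reg 6)) replay)"

lemma wp_play:
  assumes i: "reg s 5 = i" "2 * i + 1 < 2 ^ b"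
    and Q: "\<And>\<tau>'. \<tau>' \<le> \<tau> + 40 \<Longrightarrow>
      Q (s\<lparr>mem := (mem s)(3 := (mem s 3)(i := best (wmem s 2) (mem s 3 (2 * i)) (mem s 3 (2 * i + 1))))\<rparr>) \<tau>'"
  shows "wp b \<rho> play Q s \<tau>"
proof -
  have e: "eval b s (dbl (Reg 5)) = 2 * i" "eval b s (dbl1 (Reg 5)) = 2 * i + 1"
    using eval_dbl[of s "Reg 5"] i by simp_all
  show ?thesis
    using Q unfolding play_def
    by (cases "mem s 3 (2 * i) = 0"; cases "mem s 3 (2 * i + 1) = 0";
        cases "wmem s 2 (mem s 3 (2 * i + 1)) < wmem s 2 (mem s 3 (2 * i))")
      (simp_all add: wp_simps e i(1) best_def)
qed

text \<open>Only the parent of the current node may violate its equation, and recomputing it passes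
  the violation on to its own parent; at \<open>i = 1\<close> that is node \<open>0\<close>, outside
  the tree. The leaves have \<open>2 * k + 1\<close> bits, which gives the number of turns.\<close>

lemma wp_replay:
  assumes j: "reg s 5 = j" "1 \<le> j" "j < 2 * (L * L)"
    and t: "\<And>i. 1 \<le> i \<Longrightarrow> i < L * L \<Longrightarrow> i \<noteq> j div 2 \<Longrightarrow>
      mem s 3 i = best (wmem s 2) (mem s 3 (2 * i)) (mem s 3 (2 * i + 1))"
    and Q: "\<And>t' \<tau>'. \<forall>i. 1 \<le> i \<and> i < L * L \<longrightarrow> t' i = best (wmem s 2) (t' (2 * i)) (t' (2 * i + 1)) \<Longrightarrow>
      \<forall>i\<ge>L * L. t' i = mem s 3 i \<Longrightarrow> \<tau>' \<le> \<tau> + 100 * k + 54 \<Longrightarrow>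
      Q (s\<lparr>reg := (reg s)(5 := 1), mem := (mem s)(3 := t')\<rparr>) \<tau>'"
  shows "wp b \<rho> replay Q s \<tau>"
  unfolding replay_def
proof (rule wp_While[where B = "\<tau> + 50 * (2 * k + 1)" and I = "\<lambda>s' \<tau>'. \<exists>i t' m.
    s' = s\<lparr>reg := (reg s)(5 := i), mem := (mem s)(3 := t')\<rparr> \<and> 1 \<le> i \<and> i < 2 * (L * L) \<and> i < 2 ^ m \<and>
    (\<forall>i'. 1 \<le> i' \<and> i' < L * L \<and> i' \<noteq> i div 2 \<longrightarrow> t' i' = best (wmem s 2) (t' (2 * i')) (t' (2 * i' + 1))) \<and>
    (\<forall>i\<ge>L * L. t' i = mem s 3 i) \<and> \<tau>' + 50 * m \<le> \<tau> + 50 * (2 * k + 1)"])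
  have LL: "2 * (L * L) = 2 ^ (2 * k + 1)" unfolding L_def by (simp add: mult_2 power_add)
  have "s = s\<lparr>reg := (reg s)(5 := j), mem := (mem s)(3 := mem s 3)\<rparr>"
    using j(1) by (simp add: fun_upd_idem)
  then show "\<exists>i t' m.
    s = s\<lparr>reg := (reg s)(5 := i), mem := (mem s)(3 := t')\<rparr> \<and> 1 \<le> i \<and> i < 2 * (L * L) \<and> i < 2 ^ m \<and>
    (\<forall>i'. 1 \<le> i' \<and> i' < L * L \<and> i' \<noteq> i div 2 \<longrightarrow> t' i' = best (wmem s 2) (t' (2 * i')) (t' (2 * i' + 1))) \<and>
    (\<forall>i\<ge>L * L. t' i = mem s 3 i) \<and> \<tau> + 50 * m \<le> \<tau> + 50 * (2 * k + 1)"
    using j t LL by (intro exI[of _ j] exI[of _ "mem s 3"] exI[of _ "2 * k + 1"] conjI) auto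
next
  fix s' \<tau>'
  assume "\<exists>i t' m.
    s' = s\<lparr>reg := (reg s)(5 := i), mem := (mem s)(3 := t')\<rparr> \<and> 1 \<le> i \<and> i < 2 * (L * L) \<and> i < 2 ^ m \<and>
    (\<forall>i'. 1 \<le> i' \<and> i' < L * L \<and> i' \<noteq> i div 2 \<longrightarrow> t' i' = best (wmem s 2) (t' (2 * i')) (t' (2 * i' + 1))) \<and>
    (\<forall>i\<ge>L * L. t' i = mem s 3 i) \<and> \<tau>' + 50 * m \<le> \<tau> + 50 * (2 * k + 1)"
    (is "\<exists>i t' m. ?I s' \<tau>' i t' m")
  then obtain i t' m where I: "?I s' \<tau>' i t' m" by blast
  have s': "s' = s\<lparr>reg := (reg s)(5 := i), mem := (mem s)(3 := t')\<rparr>"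
    and i: "1 \<le> i" "i < 2 * (L * L)" "i < 2 ^ m"
    and t': "\<And>i'. 1 \<le> i' \<Longrightarrow> i' < L * L \<Longrightarrow> i' \<noteq> i div 2 \<Longrightarrow> t' i' = best (wmem s 2) (t' (2 * i')) (t' (2 * i' + 1))"
    and leaves: "\<And>i. L * L \<le> i \<Longrightarrow> t' i = mem s 3 i" and \<tau>': "\<tau>' + 50 * m \<le> \<tau> + 50 * (2 * k + 1)"
    using I by blast+
  have m1: "1 \<le> m" using i by (cases m) auto
  {
    assume "eval b s' (Op Less (Const 1) (Reg 5)) \<noteq> 0"
    then have gt: "1 < i" using s' by (simp split: if_splits)
    obtain m' where m: "m = Suc m'" and m'1: "1 \<le> m'" using i gt by (cases m; cases "m - 1") auto
    define h where "h = i div 2"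
    have h: "1 \<le> h" "h < L * L" "h < 2 ^ m'" using i gt m by (auto simp: h_def)
    define t2 where "t2 = t'(h := best (wmem s 2) (t' (2 * h)) (t' (2 * h + 1)))"
    have w: "wp b \<rho> play (\<lambda>s' \<tau>'. \<exists>i t' m. ?I s' \<tau>' i t' m) (s\<lparr>reg := (reg s)(5 := h), mem := (mem s)(3 := t')\<rparr>) (\<tau>' + 8)"
    proof (rule wp_play[where i = h])
      show "2 * h + 1 < 2 ^ b" using h by (intro less_word2) simp
      fix \<tau>2 assume \<tau>2: "\<tau>2 \<le> \<tau>' + 8 + 40"
      have "?I (s\<lparr>reg := (reg s)(5 := h), mem := (mem s)(3 := t2)\<rparr>) \<tau>2 h t2 m'"
      proof (intro conjI allI impI)
        fix i' assume i': "1 \<le> i' \<and> i' < L * L \<and> i' \<noteq> h div 2"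
        have ne: "2 * i' \<noteq> h" "2 * i' + 1 \<noteq> h" using i' by auto
        show "t2 i' = best (wmem s 2) (t2 (2 * i')) (t2 (2 * i' + 1))"
        proof (cases "i' = h")
          case True
          then show ?thesis using ne by (simp add: t2_def)
        next
          case False
          then show ?thesis using ne t'[of i'] i' by (simp add: t2_def h_def)
        qed
      next
        show "h < 2 * (L * L)" using h by simp
        show "t2 i' = mem s 3 i'" if "L * L \<le> i'" for i' using leaves[OF that] that h by (simp add: t2_def)
        show "\<tau>2 + 50 * m' \<le> \<tau> + 50 * (2 * k + 1)" using \<tau>2 \<tau>' m by simp
      qed (use h in \<open>simp_all add: fun_upd_def\<close>)
      then have "\<exists>i t' m. ?I (s\<lparr>reg := (reg s)(5 := h), mem := (mem s)(3 := t2)\<rparr>) \<tau>2 i t' m" by blast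
      then show "\<exists>i t'' m. ?I (s\<lparr>reg := (reg s)(5 := h), mem := (mem s)(3 := t')\<rparr>\<lparr>mem := (mem (s\<lparr>reg := (reg s)(5 := h), mem := (mem s)(3 := t')\<rparr>))
          (3 := (mem (s\<lparr>reg := (reg s)(5 := h), mem := (mem s)(3 := t')\<rparr>) 3)(h := best (wmem (s\<lparr>reg := (reg s)(5 := h), mem := (mem s)(3 := t')\<rparr>) 2)
             (mem (s\<lparr>reg := (reg s)(5 := h), mem := (mem s)(3 := t')\<rparr>) 3 (2 * h))
             (mem (s\<lparr>reg := (reg s)(5 := h), mem := (mem s)(3 := t')\<rparr>) 3 (2 * h + 1))))\<rparr>) \<tau>2 i t'' m"
        by (simp add: t2_def)
    qed simp
    show "wp b \<rho> (Seq (Assign 5 (half (Reg 5))) play) (\<lambda>s' \<tau>'. \<exists>i t' m. ?I s' \<tau>' i t' m) s'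
        (\<tau>' + (1 + cost (Op Less (Const 1) (Reg 5))))"
      unfolding wp_Seq wp_Assign eval_half by (rule wp_cong[OF w]) (simp_all add: s' h_def)
  next
    assume "eval b s' (Op Less (Const 1) (Reg 5)) = 0"
    then have i1: "i = 1" using s' i by (simp split: if_splits)
    show "Q s' (\<tau>' + (1 + cost (Op Less (Const 1) (Reg 5))))"
      unfolding s' i1
    proof (rule Q)
      show "\<forall>i. 1 \<le> i \<and> i < L * L \<longrightarrow> t' i = best (wmem s 2) (t' (2 * i)) (t' (2 * i + 1))"
        using t' i1 by (metis div_less less_numeral_extra(4) not_one_le_zero one_less_numeral_iff semiring_norm(76))
      show "\<forall>i\<ge>L * L. t' i = mem s 3 i" using leaves by blast
      show "\<tau>' + (1 + cost (Op Less (Const 1) (Reg 5))) \<le> \<tau> + 100 * k + 54" using \<tau>' m1 by simp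
    qed
  next
    show "\<tau>' \<le> \<tau> + 50 * (2 * k + 1)" using \<tau>' by simp
  }
qed

lemma wp_remove_edge:
  assumes T: "tournament (L * L) (wmem s 2) (mem s 3) A" and j: "reg s 6 = j" "j \<in> A"
    and Q: "\<And>t' \<tau>'. tournament (L * L) (wmem s 2) t' (A - {j}) \<Longrightarrow> \<tau>' \<le> \<tau> + 160 * k \<Longrightarrow>
      Q (s\<lparr>reg := (reg s)(5 := 1), mem := (mem s)(3 := t')\<rparr>) \<tau>'"
  shows "wp b \<rho> remove_edge Q s \<tau>"
proof -
  have jr: "L * L \<le> j" "j < 2 * (L * L)" using T j by (auto simp: tournament_def)
  define s1 where "s1 = s\<lparr>reg := (reg s)(5 := j), mem := (mem s)(3 := (mem s 3)(j := 0))\<rparr>"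
  have w: "wp b \<rho> replay Q s1 (\<tau> + 5)"
  proof (rule wp_replay[where j = j])
    show "reg s1 5 = j" by (simp add: s1_def)
    show "1 \<le> j" using jr L_ge by (cases L) auto
    show "j < 2 * (L * L)" by fact
    show "mem s1 3 i = best (wmem s1 2) (mem s1 3 (2 * i)) (mem s1 3 (2 * i + 1))"
      if "1 \<le> i" "i < L * L" "i \<noteq> j div 2" for i
    proof -
      have "mem s 3 i = best (wmem s 2) (mem s 3 (2 * i)) (mem s 3 (2 * i + 1))"
        using T that(1,2) unfolding tournament_def by auto
      moreover have "i \<noteq> j" "2 * i \<noteq> j" "2 * i + 1 \<noteq> j" using that jr by auto
      ultimately show ?thesis by (simp add: s1_def)
    qed
    fix t' \<tau>'
    assume 1: "\<forall>i. 1 \<le> i \<and> i < L * L \<longrightarrow> t' i = best (wmem s1 2) (t' (2 * i)) (t' (2 * i + 1))"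
      "\<forall>i\<ge>L * L. t' i = mem s1 3 i" "\<tau>' \<le> \<tau> + 5 + 100 * k + 54"
    have "tournament (L * L) (wmem s 2) t' (A - {j})"
      unfolding tournament_def
    proof (intro conjI ballI)
      show "A - {j} \<subseteq> {L * L..<2 * (L * L)}" using T by (auto simp: tournament_def)
      show "t' i = (if i \<in> A - {j} then i else 0)" if "i \<in> {L * L..<2 * (L * L)}" for i
        using 1(2) T that by (simp add: tournament_def s1_def)
      show "t' i = best (wmem s 2) (t' (2 * i)) (t' (2 * i + 1))" if "i \<in> {1..<L * L}" for i
        using 1(1)[rule_format, of i] that by (simp add: s1_def)
    qed
    then have "Q (s\<lparr>reg := (reg s)(5 := 1), mem := (mem s)(3 := t')\<rparr>) \<tau>'"
      using 1(3) k_pos by (intro Q) auto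
    then show "Q (s1\<lparr>reg := (reg s1)(5 := 1), mem := (mem s1)(3 := t')\<rparr>) \<tau>'" by (simp add: s1_def)
  qed
  show ?thesis
    unfolding remove_edge_def wp_Seq wp_Write wp_Assign by (rule wp_cong[OF w]) (simp_all add: s1_def j)
qed

section \<open>Positions of edges in the tournament tree\<close>

lemma below_1:
  assumes "L * L \<le> j" "j < 2 * (L * L)" shows "below 1 j"
proof -
  have "L * L = 2 ^ (2 * k)" unfolding L_def by (simp add: mult_2 power_add)
  moreover have "j div (L * L) = 1" using assms by (intro div_nat_eqI) auto
  ultimately show ?thesis unfolding below_def by metis
qed

text \<open>The leaves lie exactly \<open>k\<close> levels below the nodes \<open>L + z\<close>:
  after fewer halvings a leaf index is still at least \<open>2 * L\<close>, after more it is already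
  less than \<open>L\<close>.\<close>

lemma below_row:
  assumes "L * L \<le> j" "j < 2 * (L * L)" "z < L"
  shows "below (L + z) j \<longleftrightarrow> j div L = L + z"
proof
  assume "below (L + z) j"
  then obtain m where m: "j div 2 ^ m = L + z" by (auto simp: below_def)
  have "\<not> m < k"
  proof
    assume "m < k"
    then have p: "2 * 2 ^ m \<le> L" unfolding L_def using power_increasing[of "Suc m" k "2 :: nat"] by simp
    have "2 * L * 2 ^ m \<le> L * L" using mult_left_mono[OF p, of L] by simp
    then have "2 * L * 2 ^ m \<le> j" by (rule order_trans[OF _ assms(1)])
    then have "2 * L \<le> j div 2 ^ m" by (simp add: less_eq_div_iff_mult_less_eq)
    then show False using m assms by simp
  qed
  moreover have "\<not> k < m"
  proof
    assume "k < m"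
    then have p: "2 * L \<le> 2 ^ m" unfolding L_def using power_increasing[of "Suc k" m "2 :: nat"] by simp
    have "2 * (L * L) \<le> L * 2 ^ m" using mult_left_mono[OF p, of L] by (simp add: mult_ac)
    then have "j < L * 2 ^ m" by (rule less_le_trans[OF assms(2)])
    then have "j div 2 ^ m < L" by (simp add: div_less_iff_less_mult)
    then show False using m by simp
  qed
  ultimately show "j div L = L + z" using m L_def by simp
next
  assume "j div L = L + z"
  then show "below (L + z) j" unfolding below_def L_def by metis
qed

definition leaf :: "nat \<times> nat \<Rightarrow> nat" where
  "leaf e = L * L + fst e * L + snd e"

lemma leaf_div_mod:
  assumes "v < L"
  shows "leaf (u, v) div L = L + u" "leaf (u, v) mod L = v"
proof -
  have "leaf (u, v) = v + (L + u) * L" by (simp add: leaf_def algebra_simps)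
  then show "leaf (u, v) div L = L + u" "leaf (u, v) mod L = v" using assms by simp_all
qed

lemma leaf_inj: "inj_on leaf ({..<n} \<times> {..<n})"
proof (rule inj_onI)
  fix e e' assume e: "e \<in> {..<n} \<times> {..<n}" "e' \<in> {..<n} \<times> {..<n}" "leaf e = leaf e'"
  obtain u v u' v' where uv: "e = (u, v)" "e' = (u', v')" by (cases e, cases e')
  show "e = e'"
    using leaf_div_mod[of v u] leaf_div_mod[of v' u'] e n_less unfolding uv by auto
qed

lemma leaf_range:
  assumes "u < n" "v < n" shows "L * L \<le> leaf (u, v)" "leaf (u, v) < 2 * (L * L)"
proof -
  show "L * L \<le> leaf (u, v)" by (simp add: leaf_def)
  have "u * L + v < L * L" using row_index_less[of v L u L] assms n_less by simp
  then show "leaf (u, v) < 2 * (L * L)" by (simp add: leaf_def)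
qed

text \<open>The root and the nodes \<open>L + z\<close> act as priority queues over the same leaves,
  so a single removal updates the global queue and that of the vertex together.\<close>

lemma tournament_min:
  assumes T: "tournament (L * L) wt t (leaf ` P)" and P: "P \<subseteq> {..<n} \<times> {..<n}"
  shows "t 1 = 0 \<Longrightarrow> P = {}"
    and "t 1 \<noteq> 0 \<Longrightarrow> \<exists>x y. (x, y) \<in> P \<and> t 1 = leaf (x, y) \<and> (\<forall>e\<in>P. wt (leaf (x, y)) \<le> wt (leaf e))"
    and "z < n \<Longrightarrow> t (L + z) = 0 \<Longrightarrow> (z, y) \<notin> P"
    and "z < n \<Longrightarrow> t (L + z) \<noteq> 0 \<Longrightarrow> \<exists>y. (z, y) \<in> P \<and> t (L + z) = leaf (z, y) \<and>
      (\<forall>y'. (z, y') \<in> P \<longrightarrow> wt (leaf (z, y)) \<le> wt (leaf (z, y')))"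
proof -
  have b1: "below 1 (leaf e)" if "e \<in> P" for e
    using that P leaf_range below_1 by (cases e) auto
  have LL: "1 < 2 * (L * L)" using L_ge by (cases L) auto
  note r = tournament_node[OF T, of 1, OF order_refl LL]
  show "t 1 = 0 \<Longrightarrow> P = {}" using r b1 by auto
  show "\<exists>x y. (x, y) \<in> P \<and> t 1 = leaf (x, y) \<and> (\<forall>e\<in>P. wt (leaf (x, y)) \<le> wt (leaf e))"
    if "t 1 \<noteq> 0"
  proof -
    from that obtain e where e: "e \<in> P" "t 1 = leaf e" and min: "\<forall>j\<in>leaf ` P. below 1 j \<longrightarrow> wt (t 1) \<le> wt j"
      using r by blast
    then show ?thesis using b1 by (cases e) auto
  qed
  assume z: "z < n"
  have bz: "below (L + z) (leaf (u, v)) \<longleftrightarrow> u = z" if "(u, v) \<in> P" for u v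
  proof -
    have uv: "u < n" "v < n" using that P by auto
    show ?thesis
      using below_row[OF leaf_range[OF uv], of z] leaf_div_mod(1)[of v u] uv z n_less by simp
  qed
  have "L + z < 2 * (L * L)"
  proof -
    have "L + z < 2 * L" using z n_less by simp
    also have "\<dots> \<le> L * L" using L_le by simp
    finally show ?thesis by simp
  qed
  then have r: "(t (L + z) = 0 \<longrightarrow> (\<forall>j\<in>leaf ` P. \<not> below (L + z) j)) \<and>
     (t (L + z) \<noteq> 0 \<longrightarrow> t (L + z) \<in> leaf ` P \<and> below (L + z) (t (L + z)) \<and>
        (\<forall>j\<in>leaf ` P. below (L + z) j \<longrightarrow> wt (t (L + z)) \<le> wt j))"
    using L_ge by (intro tournament_node[OF T]) auto
  show "t (L + z) = 0 \<Longrightarrow> (z, y) \<notin> P" using r bz by blast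
  assume "t (L + z) \<noteq> 0"
  then obtain u y where uy: "(u, y) \<in> P" "t (L + z) = leaf (u, y)" "below (L + z) (leaf (u, y))"
    and min: "\<forall>j\<in>leaf ` P. below (L + z) j \<longrightarrow> wt (leaf (u, y)) \<le> wt j"
    using r by force
  have "u = z" using bz uy by blast
  then show "\<exists>y. (z, y) \<in> P \<and> t (L + z) = leaf (z, y) \<and>
      (\<forall>y'. (z, y') \<in> P \<longrightarrow> wt (leaf (z, y)) \<le> wt (leaf (z, y')))"
    using uy min bz by blast
qed
end

section \<open>Rounds\<close>

text \<open>\<open>P\<close> holds the edges (in both directions) not processed yet, \<open>R v\<close> the vertices from which
  \<open>v\<close> is known to be reachable, and \<open>D u v\<close> the label of the pair.  If an edge at \<open>u\<close> has been
  processed, then so have all edges of the same weight at \<open>u\<close>.\<close>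

definition labelled :: "nat \<Rightarrow> nat set set \<Rightarrow> (nat set \<Rightarrow> real) \<Rightarrow> (nat \<times> nat) set \<Rightarrow>
    (nat \<Rightarrow> nat set) \<Rightarrow> (nat \<Rightarrow> nat \<Rightarrow> real) \<Rightarrow> bool" where
  "labelled n E w P R D \<longleftrightarrow>
     (\<forall>u v. (u, v) \<in> P \<longrightarrow> {u, v} \<in> E \<and> (v, u) \<in> P) \<and>
     (\<forall>u v v'. (u, v) \<in> P \<longrightarrow> {u, v'} \<in> E \<longrightarrow> (u, v') \<notin> P \<longrightarrow> w {u, v'} < w {u, v}) \<and>
     (\<forall>v<n. \<forall>u\<in>R v. D u v \<in> nd_path_weights E w u v \<and> (\<forall>x y. (x, y) \<in> P \<longrightarrow> D u v \<le> w {x, y})) \<and>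
     (\<forall>x y. {x, y} \<in> E \<longrightarrow> (x, y) \<notin> P \<longrightarrow> x \<in> R x \<and> D x x \<le> w {x, y} \<and>
        (\<forall>u\<in>R x. D u x \<le> w {x, y} \<longrightarrow> u \<in> R y \<and> D u y \<le> w {x, y}))"

definition same_weight :: "nat set set \<Rightarrow> (nat set \<Rightarrow> real) \<Rightarrow> real \<Rightarrow> (nat \<times> nat) set" where
  "same_weight E w g = {(y, z). {y, z} \<in> E \<and> w {y, z} = g}"

lemma same_weight_rtrancl_sym:
  assumes "(x, y) \<in> (same_weight E w g)\<^sup>*" shows "(y, x) \<in> (same_weight E w g)\<^sup>*"
proof -
  have "sym (same_weight E w g)" by (auto simp: sym_def same_weight_def insert_commute)
  then show ?thesis using assms by (meson sym_rtrancl symD)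
qed

text \<open>Soundness of a new pair: its source reaches some \<open>z\<close> in the component with
  a label of at most \<open>g\<close>, or is \<open>z\<close> itself, and \<open>z\<close> is joined
  to the target by edges of weight \<open>g\<close>. Closure under the edges removed now: all
  vertices of \<open>Q\<close> get the same set, with labels of at most \<open>g\<close>. Closure
  under older edges: those at a vertex of \<open>Q\<close> are strictly lighter than
  \<open>g\<close>, so a new label \<open>g\<close> cannot be continued along them.\<close>

lemma labelled_round:
  assumes G: "ugraph n E" and inv: "labelled n E w P R D"
    and Q: "Q \<subseteq> {..<n}" and P1: "P1 \<subseteq> P"
    and removed: "\<And>z y. (z, y) \<in> P \<Longrightarrow> (z, y) \<notin> P1 \<Longrightarrow> z \<in> Q \<and> y \<in> Q \<and> w {z, y} = g"
    and finished: "\<And>z y. z \<in> Q \<Longrightarrow> (z, y) \<in> P1 \<Longrightarrow> g < w {z, y}"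
    and live: "\<And>z. z \<in> Q \<Longrightarrow> \<exists>y. (z, y) \<in> P \<and> w {z, y} = g"
    and min: "\<And>u v. (u, v) \<in> P \<Longrightarrow> g \<le> w {u, v}"
    and conn: "\<And>z. z \<in> Q \<Longrightarrow> (x, z) \<in> (same_weight E w g)\<^sup>*"
    and R': "\<And>v. v \<notin> Q \<Longrightarrow> R' v = R v" "\<And>v. v \<in> Q \<Longrightarrow> R' v = (\<Union>z\<in>Q. insert z (R z))"
    and D': "\<And>u v. D' u v = (if u \<in> R v then D u v else g)"
  shows "labelled n E w P1 R' D'"
proof -
  have PE: "(u, v) \<in> P \<Longrightarrow> {u, v} \<in> E" and sym: "(u, v) \<in> P \<Longrightarrow> (v, u) \<in> P" for u v
    using inv unfolding labelled_def by blast+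
  have strict: "(u, v) \<in> P \<Longrightarrow> {u, v'} \<in> E \<Longrightarrow> (u, v') \<notin> P \<Longrightarrow> w {u, v'} < w {u, v}" for u v v'
    using inv unfolding labelled_def by blast
  have sound: "v < n \<Longrightarrow> u \<in> R v \<Longrightarrow> D u v \<in> nd_path_weights E w u v"
    and below: "v < n \<Longrightarrow> u \<in> R v \<Longrightarrow> (y, z) \<in> P \<Longrightarrow> D u v \<le> w {y, z}" for u v y z
    using inv unfolding labelled_def by blast+
  have closed: "{y, z} \<in> E \<Longrightarrow> (y, z) \<notin> P \<Longrightarrow> y \<in> R y \<and> D y y \<le> w {y, z} \<and>
        (\<forall>u\<in>R y. D u y \<le> w {y, z} \<longrightarrow> u \<in> R z \<and> D u z \<le> w {y, z})" for y z
    using inv unfolding labelled_def by blast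
  have mono: "R v \<subseteq> R' v" for v using R' by (cases "v \<in> Q") auto
  \<comment> \<open>An old label is at most the weight of any edge still in \<open>P\<close>, and
    \<open>v\<close> has one of weight \<open>g\<close>.\<close>
  have le_g: "D' u v \<le> g" if v: "v \<in> Q" "u \<in> R' v" for u v
  proof -
    obtain y where "(v, y) \<in> P" "w {v, y} = g" using live[OF v(1)] by blast
    then show ?thesis using below[of v u v y] D'[of u v] v Q by auto
  qed
  have path: "g \<in> nd_path_weights E w u v" if v: "v \<in> Q" "u \<in> R' v" "u \<notin> R v" for u v
  proof -
    obtain z where z: "z \<in> Q" "u \<in> insert z (R z)" using R'(2)[OF v(1)] v(2) by blast
    have zv: "(z, v) \<in> (same_weight E w g)\<^sup>*"
      using conn[OF v(1)] same_weight_rtrancl_sym[OF conn[OF z(1)]] by simp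
    obtain y where y: "(z, y) \<in> P" "w {z, y} = g" using live[OF z(1)] by blast
    show ?thesis
    proof (cases "u = z")
      case True
      have "g \<in> nd_path_weights E w z z" using nd_path_weights_edge[OF PE[OF y(1)], of w] y(2) by simp
      then show ?thesis
        using nd_path_weights_rtrancl[of g E w z z g v] zv True unfolding same_weight_def by auto
    next
      case False
      then have "u \<in> R z" using z by simp
      then show ?thesis
        using nd_path_weights_rtrancl[of "D u z" E w u z g v] sound[of z u] below[of z u z y] y z Q zv v(3)
        unfolding same_weight_def by auto
    qed
  qed
  show ?thesis unfolding labelled_def
  proof (intro conjI ballI allI impI)
    fix u v assume uv: "(u, v) \<in> P1"
    show "{u, v} \<in> E" using uv P1 PE by blast
    \<comment> \<open>If the reverse edge had been removed, then \<open>u\<close> would lie in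
      \<open>Q\<close> and the edge would weigh \<open>g\<close>, but what remains at
      \<open>u\<close> is heavier than \<open>g\<close>.\<close>
    show "(v, u) \<in> P1"
    proof (rule ccontr)
      assume "(v, u) \<notin> P1"
      then have "u \<in> Q \<and> w {v, u} = g" using removed[of v u] sym uv P1 by blast
      then show False using finished[of u v] uv by (simp add: insert_commute)
    qed
  next
    fix u v v' assume a: "(u, v) \<in> P1" "{u, v'} \<in> E" "(u, v') \<notin> P1"
    show "w {u, v'} < w {u, v}"
    proof (cases "(u, v') \<in> P")
      case True
      then show ?thesis using removed[of u v'] a finished[of u v] by auto
    next
      case False
      then show ?thesis using strict[of u v v'] a P1 by blast
    qed
  next
    fix v u assume vu: "v < n" "u \<in> R' v"
    show "D' u v \<in> nd_path_weights E w u v"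
      using sound[OF vu(1), of u] path[of v u] D'[of u v] vu R'(1)[of v] by (cases "u \<in> R v"; cases "v \<in> Q") auto
    fix y z assume yz: "(y, z) \<in> P1"
    then show "D' u v \<le> w {y, z}"
      using below[OF vu(1), of u y z] min[of y z] D'[of u v] P1 by (cases "u \<in> R v") auto
  next
    fix y z assume yz: "{y, z} \<in> E" "(y, z) \<notin> P1"
    have "y \<in> R' y \<and> D' y y \<le> w {y, z} \<and> (\<forall>u\<in>R' y. D' u y \<le> w {y, z} \<longrightarrow> u \<in> R' z \<and> D' u z \<le> w {y, z})"
    proof (cases "(y, z) \<in> P")
      case True
      then have r: "y \<in> Q" "z \<in> Q" "w {y, z} = g" using removed yz by blast+
      have "R' y = R' z" "y \<in> R' y" using R'(2)[OF r(1)] R'(2)[OF r(2)] r by auto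
      then show ?thesis using le_g[of y] le_g[of z] r by auto
    next
      case False
      note c = closed[OF yz(1) False]
      \<comment> \<open>The strictness clause of \<open>labelled\<close>, applied to the edge of
        weight \<open>g\<close> that \<open>y\<close> still has in \<open>P\<close>.\<close>
      have lt: "w {y, z} < g" if "y \<in> Q" using live[OF that] strict[of y _ z] yz False by fastforce
      have "u \<in> R y" if "u \<in> R' y" "D' u y \<le> w {y, z}" for u
      proof (rule ccontr)
        assume "u \<notin> R y"
        then have "y \<in> Q" "D' u y = g" using that R'(1)[of y] D' by auto
        then show False using lt that by simp
      qed
      then show ?thesis using c mono D' by (metis subsetD)
    qed
    then show "y \<in> R' y" "D' y y \<le> w {y, z}"
      "\<And>u. u \<in> R' y \<Longrightarrow> D' u y \<le> w {y, z} \<Longrightarrow> u \<in> R' z"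
      "\<And>u. u \<in> R' y \<Longrightarrow> D' u y \<le> w {y, z} \<Longrightarrow> D' u z \<le> w {y, z}" by blast+
  qed
qed

context machine
begin

section \<open>Exploring a component of edges of minimum weight\<close>

definition row_root :: exp where "row_root = Op Add (Reg 1) (Reg 8)"

text \<open>\<open>Mul\<close> serves as conjunction and comparison with \<open>0\<close> as
  negation; for an empty row the comparison reads weight cell \<open>0\<close>, whose value does not
  affect the product. Removing an edge leaves its weight in place, so the leaf in register 10 keeps
  denoting the current weight.\<close>

definition scan :: com where
  "scan = While (Op Mul (Op Less (Const 0) (Read 3 row_root))
       (Op Equal (WLess 2 (Reg 10) 2 (Read 3 row_root)) (Const 0)))
     (Seq (Assign 6 (Read 3 row_root)) (Seq remove_edge (Seq (Assign 13 (Op Mod (Reg 6) (Reg 1)))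
       (com.If (Read 5 (Reg 13)) Skip
         (Seq (Write 5 (Reg 13) (Const 1)) (Seq (Write 4 (Reg 12) (Reg 13)) (inc 12)))))))"

definition explore :: com where
  "explore = Seq (Assign 10 (Read 3 (Const 1))) (Seq (Assign 7 (Op Sub (Op Div (Reg 10) (Reg 1)) (Reg 1)))
     (Seq (Write 4 (Const 0) (Reg 7)) (Seq (Write 5 (Reg 7) (Const 1)) (Seq (Assign 12 (Const 1))
     (Seq (Assign 11 (Const 0)) (While (Op Less (Reg 11) (Reg 12))
       (Seq (Assign 8 (Read 4 (Reg 11))) (Seq scan (inc 11)))))))))"

definition queue :: "state \<Rightarrow> nat list \<Rightarrow> bool" where
  "queue s q \<longleftrightarrow> reg s 12 = length q \<and> (\<forall>i<length q. mem s 4 i = q ! i) \<and>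
     (\<forall>v<n. mem s 5 v = of_bool (v \<in> set q))"

text \<open>\<open>P0\<close> are the edges before the round, \<open>Z\<close> the vertices whose
  edges have been or are being extracted. The last clause charges every queued vertex except
  \<open>x\<close> to a removed directed edge, which turns costs per vertex into costs per
  edge.\<close>

definition explored :: "nat set set \<Rightarrow> (nat set \<Rightarrow> real) \<Rightarrow> real \<Rightarrow> nat \<Rightarrow> (nat \<times> nat) set \<Rightarrow>
    nat set \<Rightarrow> nat list \<Rightarrow> (nat \<times> nat) set \<Rightarrow> bool" where
  "explored E w g x P0 Z q P \<longleftrightarrow> P \<subseteq> P0 \<and> distinct q \<and> set q \<subseteq> {..<n} \<and> x \<in> set q \<and> Z \<subseteq> set q \<and>
     (\<forall>z y. (z, y) \<in> P0 \<longrightarrow> (z, y) \<notin> P \<longrightarrow> z \<in> Z \<and> y \<in> set q \<and> w {z, y} = g) \<and>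
     (\<forall>z\<in>set q. (x, z) \<in> (same_weight E w g)\<^sup>* \<and> (\<exists>y. (z, y) \<in> P0 \<and> w {z, y} = g)) \<and>
     length q \<le> Suc (card (P0 - P))"

text \<open>One more removed edge pays for at most one more queue entry. That \<open>y\<close> has
  an edge of weight \<open>g\<close> in \<open>P0\<close> is witnessed by the reverse edge, even if
  that one has been removed meanwhile.\<close>

lemma explored_step:
  assumes X: "explored E w g x P0 Z q P" and P0: "P0 \<subseteq> {..<n} \<times> {..<n}"
    and sym: "\<And>u v. (u, v) \<in> P0 \<Longrightarrow> {u, v} \<in> E \<and> (v, u) \<in> P0"
    and e: "(z, y) \<in> P" "z \<in> Z" "w {z, y} = g"
  shows "explored E w g x P0 Z (if y \<in> set q then q else q @ [y]) (P - {(z, y)})"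
proof -
  have fin: "finite P0" using P0 by (meson finite_SigmaI finite_lessThan finite_subset)
  have PP: "P \<subseteq> P0" and zq: "z \<in> set q" and len: "length q \<le> Suc (card (P0 - P))"
    using X e by (auto simp: explored_def)
  have "P0 - (P - {(z, y)}) = insert (z, y) (P0 - P)" using e PP by auto
  then have card: "card (P0 - (P - {(z, y)})) = Suc (card (P0 - P))" using fin e by simp
  have "(x, z) \<in> (same_weight E w g)\<^sup>*" using X zq by (auto simp: explored_def)
  moreover have "(z, y) \<in> same_weight E w g"
    using e PP sym[of z y] by (auto simp: same_weight_def)
  ultimately have conn: "(x, y) \<in> (same_weight E w g)\<^sup>*" by (rule rtrancl_into_rtrancl)
  have live: "\<exists>y'. (y, y') \<in> P0 \<and> w {y, y'} = g"
    using e PP sym[of z y] by (intro exI[of _ z]) (auto simp: insert_commute)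
  have yn: "y < n" using e PP P0 by auto
  show ?thesis
    unfolding explored_def card
  proof (intro conjI allI impI ballI)
    fix z' y' assume a: "(z', y') \<in> P0" "(z', y') \<notin> P - {(z, y)}"
    then have "(z', y') = (z, y) \<or> z' \<in> Z \<and> y' \<in> set q \<and> w {z', y'} = g"
      using X unfolding explored_def by blast
    then show "z' \<in> Z" "y' \<in> set (if y \<in> set q then q else q @ [y])" "w {z', y'} = g"
      using e by auto
  next
    fix z' assume "z' \<in> set (if y \<in> set q then q else q @ [y])"
    then have "z' = y \<or> z' \<in> set q" by (auto split: if_splits)
    then show "(x, z') \<in> (same_weight E w g)\<^sup>*" "\<exists>y'. (z', y') \<in> P0 \<and> w {z', y'} = g"
      using X conn live unfolding explored_def by blast+
  qed (use X yn len in \<open>auto simp: explored_def\<close>)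
qed

text \<open>Each turn extracts an edge at \<open>z\<close>, whose removal pays
  \<open>210 * k\<close>; the \<open>16\<close> is the final test. Since \<open>g\<close> is
  minimal, an edge that is not heavier than \<open>g\<close> has weight exactly
  \<open>g\<close>.\<close>

lemma wp_scan:
  assumes st: "static s" and s: "reg s 8 = z" "wmem s 2 (reg s 10) = g"
    and P0: "P0 \<subseteq> {..<n} \<times> {..<n}" and sym: "\<And>u v. (u, v) \<in> P0 \<Longrightarrow> {u, v} \<in> E \<and> (v, u) \<in> P0"
    and wt: "\<And>u v. (u, v) \<in> P0 \<Longrightarrow> wmem s 2 (leaf (u, v)) = w {u, v}"
    and min: "\<And>u v. (u, v) \<in> P0 \<Longrightarrow> g \<le> w {u, v}"
    and T: "tournament (L * L) (wmem s 2) (mem s 3) (leaf ` P)"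
    and X: "explored E w g x P0 Z q P" and z: "z \<in> Z" and q: "queue s q"
    and Q: "\<And>s' \<tau>' q' P'. frame {5, 6, 12, 13} {3, 4, 5} {} s s' \<Longrightarrow> queue s' (q @ q') \<Longrightarrow>
       explored E w g x P0 Z (q @ q') P' \<Longrightarrow> tournament (L * L) (wmem s 2) (mem s' 3) (leaf ` P') \<Longrightarrow>
       P' \<subseteq> P \<Longrightarrow> (\<And>y. (z, y) \<in> P' \<Longrightarrow> g < w {z, y}) \<Longrightarrow>
       \<tau>' + 210 * k * card P' \<le> \<tau> + 16 + 210 * k * card P \<Longrightarrow> Q s' \<tau>'"
  shows "wp b \<rho> scan Q s \<tau>"
  unfolding scan_def
proof (rule wp_While[where B = "\<tau> + 210 * k * card P" and I = "\<lambda>s' \<tau>'. \<exists>q' P'.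
    frame {5, 6, 12, 13} {3, 4, 5} {} s s' \<and> queue s' (q @ q') \<and>
    explored E w g x P0 Z (q @ q') P' \<and> tournament (L * L) (wmem s 2) (mem s' 3) (leaf ` P') \<and>
    P' \<subseteq> P \<and> \<tau>' + 210 * k * card P' \<le> \<tau> + 210 * k * card P"])
  show "\<exists>q' P'.
    frame {5, 6, 12, 13} {3, 4, 5} {} s s \<and> queue s (q @ q') \<and>
    explored E w g x P0 Z (q @ q') P' \<and> tournament (L * L) (wmem s 2) (mem s 3) (leaf ` P') \<and>
    P' \<subseteq> P \<and> \<tau> + 210 * k * card P' \<le> \<tau> + 210 * k * card P"
    using X T q by (intro exI[of _ "[]"] exI[of _ P]) auto
next
  fix s' \<tau>'
  assume "\<exists>q' P'.
    frame {5, 6, 12, 13} {3, 4, 5} {} s s' \<and> queue s' (q @ q') \<and>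
    explored E w g x P0 Z (q @ q') P' \<and> tournament (L * L) (wmem s 2) (mem s' 3) (leaf ` P') \<and>
    P' \<subseteq> P \<and> \<tau>' + 210 * k * card P' \<le> \<tau> + 210 * k * card P" (is "\<exists>q' P'. ?I s' \<tau>' q' P'")
  then obtain q' P' where I: "?I s' \<tau>' q' P'" by blast
  have fr: "frame {5, 6, 12, 13} {3, 4, 5} {} s s'" and qu: "queue s' (q @ q')"
    and X': "explored E w g x P0 Z (q @ q') P'"
    and T': "tournament (L * L) (wmem s 2) (mem s' 3) (leaf ` P')" and PP: "P' \<subseteq> P"
    and \<tau>': "\<tau>' + 210 * k * card P' \<le> \<tau> + 210 * k * card P"
    using I by blast+
  have rs: "reg s' 1 = L" "reg s' 8 = z" "wmem s' 2 = wmem s 2" "reg s' 10 = reg s 10"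
    using st s fr by (auto simp: frame_def static_def)
  have zq: "z \<in> set (q @ q')" using z X' unfolding explored_def by blast
  then have zn: "z < n" using X' unfolding explored_def by blast
  have P'P0: "P' \<subseteq> P0" using X' unfolding explored_def by blast
  then have P'n: "P' \<subseteq> {..<n} \<times> {..<n}" using P0 by blast
  define t where "t = mem s' 3 (L + z)"
  have "L + z < 2 ^ b" using zn n_less by (intro less_word1) simp
  then have root: "eval b s2 row_root = L + z" if "reg s2 1 = L" "reg s2 8 = z" for s2
    using that by (simp add: row_root_def)
  let ?c = "Op Mul (Op Less (Const 0) (Read 3 row_root))
       (Op Equal (WLess 2 (Reg 10) 2 (Read 3 row_root)) (Const 0))"
  have cond: "eval b s' ?c \<noteq> 0 \<longleftrightarrow> t \<noteq> 0 \<and> \<not> g < wmem s 2 t"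
    using root[of s'] rs s by (simp add: t_def)
  {
    assume "eval b s' ?c \<noteq> 0"
    then have t: "t \<noteq> 0" "wmem s 2 t \<le> g" using cond by auto
    obtain y where y: "(z, y) \<in> P'" "t = leaf (z, y)"
      using tournament_min(4)[OF T' P'n zn] t(1) by (auto simp: t_def)
    have wy: "w {z, y} = g" using t(2) y P'P0 wt[of z y] min[of z y] by auto
    have yn: "y < n" using y P'n by auto
    define P2 where "P2 = P' - {(z, y)}"
    define q2 where "q2 = (if y \<in> set (q @ q') then q' else q' @ [y])"
    have "(if y \<in> set (q @ q') then q @ q' else (q @ q') @ [y]) = q @ q2" by (simp add: q2_def)
    then have X2: "explored E w g x P0 Z (q @ q2) P2"
      using explored_step[OF X' P0 sym y(1) z wy] by (simp only: P2_def)
    have "finite P'" using P'n by (meson finite_SigmaI finite_lessThan finite_subset)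
    then have card2: "card P' = Suc (card P2)" unfolding P2_def using y(1) by (metis card.remove)
    have leafP2: "leaf ` P' - {leaf (z, y)} = leaf ` P2"
      using inj_on_image_set_diff[OF leaf_inj, of P' "{(z, y)}"] P'n y(1) by (auto simp: P2_def)
    define s1 where "s1 = s'\<lparr>reg := (reg s')(6 := t)\<rparr>"
    have w: "wp b \<rho> remove_edge (wp b \<rho> (Seq (Assign 13 (Op Mod (Reg 6) (Reg 1)))
       (com.If (Read 5 (Reg 13)) Skip
         (Seq (Write 5 (Reg 13) (Const 1)) (Seq (Write 4 (Reg 12) (Reg 13)) (inc 12))))) (\<lambda>s' \<tau>'. \<exists>q' P'. ?I s' \<tau>' q' P'))
       s1 (\<tau>' + 21)"
    proof (rule wp_remove_edge)
      show "tournament (L * L) (wmem s1 2) (mem s1 3) (leaf ` P')" using T' rs by (simp add: s1_def)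
      show "reg s1 6 = t" by (simp add: s1_def)
      show "t \<in> leaf ` P'" using y by blast
      fix t' \<tau>2
      assume T2: "tournament (L * L) (wmem s1 2) t' (leaf ` P' - {t})" and \<tau>2: "\<tau>2 \<le> \<tau>' + 21 + 160 * k"
      define s2 where "s2 = s1\<lparr>reg := (reg s1)(5 := 1, 13 := y), mem := (mem s1)(3 := t')\<rparr>"
      have T2': "tournament (L * L) (wmem s 2) t' (leaf ` P2)"
        using T2 leafP2 y(2) rs by (simp add: s1_def)
      have time: "\<tau>3 + 210 * k * card P2 \<le> \<tau> + 210 * k * card P" if "\<tau>3 \<le> \<tau>2 + 17" for \<tau>3
      proof -
        have "\<tau>3 + 210 * k * card P2 \<le> \<tau>' + 210 * k * card P'"
          using that \<tau>2 k_pos by (simp add: card2)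
        then show ?thesis using \<tau>' by linarith
      qed
      have m5: "mem s2 5 y = of_bool (y \<in> set (q @ q'))"
        using qu yn by (simp add: s2_def s1_def queue_def)
      have len: "length (q @ q') < n" if "y \<notin> set (q @ q')"
      proof -
        have "length (q @ q') = card (set (q @ q'))"
          using X' unfolding explored_def by (metis distinct_card)
        moreover have "set (q @ q') \<subset> {..<n}" using X' yn that unfolding explored_def by blast
        ultimately show ?thesis using psubset_card_mono[of "{..<n}"] by simp
      qed
      have "wp b \<rho> (com.If (Read 5 (Reg 13)) Skip
         (Seq (Write 5 (Reg 13) (Const 1)) (Seq (Write 4 (Reg 12) (Reg 13)) (inc 12)))) (\<lambda>s' \<tau>'. \<exists>q' P'. ?I s' \<tau>' q' P')
         s2 (\<tau>2 + 4)"
      proof (cases "y \<in> set (q @ q')")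
        case True
        have "?I s2 (\<tau>2 + 4 + 4) q2 P2"
        proof (intro conjI)
          show "frame {5, 6, 12, 13} {3, 4, 5} {} s s2" using fr by (simp add: frame_def s2_def s1_def)
          show "queue s2 (q @ q2)" using qu True by (simp add: queue_def s2_def s1_def q2_def)
          show "tournament (L * L) (wmem s 2) (mem s2 3) (leaf ` P2)" using T2' by (simp add: s2_def)
          show "P2 \<subseteq> P" using PP by (auto simp: P2_def)
        qed (use X2 time in simp_all)
        then have "\<exists>q' P'. ?I s2 (\<tau>2 + 4 + 4) q' P'" by blast
        moreover have "mem s2 5 y = 1" using m5 True by (metis of_bool_eq(2))
        moreover have "reg s2 13 = y" by (simp add: s2_def)
        ultimately show ?thesis unfolding wp_simps by (simp add: add.commute[of _ \<tau>2])
      next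
        case False
        define s3 where "s3 = s2\<lparr>mem := (mem s2)(5 := (mem s2 5)(y := 1), 4 := (mem s2 4)(length (q @ q') := y)),
          reg := (reg s2)(12 := Suc (length (q @ q')))\<rparr>"
        have "?I s3 (\<tau>2 + 4 + 13) q2 P2"
        proof (intro conjI)
          show "frame {5, 6, 12, 13} {3, 4, 5} {} s s3" using fr by (simp add: frame_def s3_def s2_def s1_def)
          show "queue s3 (q @ q2)"
            using qu False by (auto simp: queue_def s3_def s2_def s1_def q2_def nth_append less_Suc_eq)
          show "tournament (L * L) (wmem s 2) (mem s3 3) (leaf ` P2)" using T2' by (simp add: s3_def s2_def)
          show "P2 \<subseteq> P" using PP by (auto simp: P2_def)
        qed (use X2 time in simp_all)
        then have ex: "\<exists>q' P'. ?I s3 (\<tau>2 + 4 + 13) q' P'" by blast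
        have r: "reg s2 13 = y" "reg s2 12 = length (q @ q')" "mem s2 5 y = 0"
          using m5 False qu by (simp_all add: s2_def s1_def queue_def)
        have "Suc (length (q @ q')) < 2 ^ b" using len[OF False] n_less by (intro less_word1) simp
        then have "wp b \<rho> (com.If (Read 5 (Reg 13)) Skip
           (Seq (Write 5 (Reg 13) (Const 1)) (Seq (Write 4 (Reg 12) (Reg 13)) (inc 12)))) F s2 (\<tau>2 + 4)
           \<longleftrightarrow> F s3 (\<tau>2 + 4 + 13)" for F
          using r by (simp add: wp_simps inc_def s3_def add.commute[of _ \<tau>2])
        then show ?thesis using ex by blast
      qed
      note w2 = this
      show "wp b \<rho> (Seq (Assign 13 (Op Mod (Reg 6) (Reg 1)))
       (com.If (Read 5 (Reg 13)) Skip
         (Seq (Write 5 (Reg 13) (Const 1)) (Seq (Write 4 (Reg 12) (Reg 13)) (inc 12))))) (\<lambda>s' \<tau>'. \<exists>q' P'. ?I s' \<tau>' q' P')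
         (s1\<lparr>reg := (reg s1)(5 := 1), mem := (mem s1)(3 := t')\<rparr>) \<tau>2"
        unfolding wp_Seq[of _ _ "Assign 13 _"] wp_Assign
        by (rule wp_cong[OF w2]) (use leaf_div_mod(2)[of y z] yn n_less y(2) rs in \<open>simp_all add: s2_def s1_def\<close>)
    qed
    show "wp b \<rho> (Seq (Assign 6 (Read 3 row_root)) (Seq remove_edge (Seq (Assign 13 (Op Mod (Reg 6) (Reg 1)))
       (com.If (Read 5 (Reg 13)) Skip
         (Seq (Write 5 (Reg 13) (Const 1)) (Seq (Write 4 (Reg 12) (Reg 13)) (inc 12))))))) (\<lambda>s' \<tau>'. \<exists>q' P'. ?I s' \<tau>' q' P')
       s' (\<tau>' + (1 + cost ?c))"
      unfolding wp_Seq[of _ _ "Assign 6 _"] wp_Seq[of _ _ remove_edge] wp_Assign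
      by (rule wp_cong[OF w]) (use root[of s'] rs in \<open>simp_all add: s1_def t_def row_root_def\<close>)
  next
    assume "eval b s' ?c = 0"
    then have t: "t = 0 \<or> g < wmem s 2 t" using cond by auto
    have "g < w {z, y}" if zy: "(z, y) \<in> P'" for y
    proof (cases "t = 0")
      case True
      then show ?thesis using tournament_min(3)[OF T' P'n zn] that by (simp add: t_def)
    next
      case False
      then obtain y' where "(z, y') \<in> P'" "t = leaf (z, y')" "wmem s 2 t \<le> wmem s 2 (leaf (z, y))"
        using tournament_min(4)[OF T' P'n zn] zy unfolding t_def by metis
      then show ?thesis using t False wt[of z y] that P'P0 by auto
    qed
    then show "Q s' (\<tau>' + (1 + cost ?c))"
      using \<tau>' by (intro Q[OF fr qu X' T' PP]) (auto simp: row_root_def)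
  next
    show "\<tau>' \<le> \<tau> + 210 * k * card P" using \<tau>' by simp
  }
qed

lemma wp_inc:
  assumes "Suc (reg s r) < 2 ^ b"
  shows "wp b \<rho> (inc r) Q s \<tau> \<longleftrightarrow> Q (s\<lparr>reg := (reg s)(r := Suc (reg s r))\<rparr>) (\<tau> + 4)"
proof -
  have "1 + cost (Op Add (Reg r) (Const 1)) = 4" by simp
  moreover have "eval b s (Op Add (Reg r) (Const 1)) = Suc (reg s r)" using assms by simp
  ultimately show ?thesis unfolding inc_def wp_Assign by (simp only:)
qed

text \<open>Breadth-first search from an endpoint of a lightest edge. The first \<open>p\<close>
  queue entries have only edges heavier than \<open>g\<close> left, and this persists because the
  set of remaining edges only shrinks.\<close>

lemma wp_explore:
  assumes st: "static s"
    and P: "P \<subseteq> {..<n} \<times> {..<n}" "P \<noteq> {}" and sym: "\<And>u v. (u, v) \<in> P \<Longrightarrow> {u, v} \<in> E \<and> (v, u) \<in> P"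
    and wt: "\<And>u v. (u, v) \<in> P \<Longrightarrow> wmem s 2 (leaf (u, v)) = w {u, v}"
    and T: "tournament (L * L) (wmem s 2) (mem s 3) (leaf ` P)"
    and unmarked: "\<And>v. v < n \<Longrightarrow> mem s 5 v = 0"
    and Q: "\<And>s' \<tau>' x q P' g. frame {5, 6, 7, 8, 10, 11, 12, 13} {3, 4, 5} {} s s' \<Longrightarrow> reg s' 7 = x \<Longrightarrow>
       wmem s 2 (reg s' 10) = g \<Longrightarrow> queue s' q \<Longrightarrow> explored E w g x P (set q) q P' \<Longrightarrow>
       tournament (L * L) (wmem s 2) (mem s' 3) (leaf ` P') \<Longrightarrow>
       (\<And>z y. z \<in> set q \<Longrightarrow> (z, y) \<in> P' \<Longrightarrow> g < w {z, y}) \<Longrightarrow> (\<And>u v. (u, v) \<in> P \<Longrightarrow> g \<le> w {u, v}) \<Longrightarrow>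
       card P' < card P \<Longrightarrow> length q + card P' \<le> Suc (card P) \<Longrightarrow>
       \<tau>' + 300 * k * card P' \<le> \<tau> + 300 * k * card P \<Longrightarrow> Q s' \<tau>'"
  shows "wp b \<rho> explore Q s \<tau>"
proof -
  have fin: "finite P" using P by (meson finite_SigmaI finite_lessThan finite_subset)
  have st': "reg s 0 = n" "reg s 1 = L" using st by (auto simp: static_def)
  define G where "G = mem s 3 1"
  define g where "g = wmem s 2 G"
  have "G \<noteq> 0" using tournament_min(1)[OF T P(1)] P(2) by (auto simp: G_def)
  then obtain x y where xy: "(x, y) \<in> P" "G = leaf (x, y)" and min0: "\<forall>e\<in>P. wmem s 2 G \<le> wmem s 2 (leaf e)"
    using tournament_min(2)[OF T P(1)] unfolding G_def by metis
  have xn: "x < n" "y < n" using xy P by auto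
  have wxy: "w {x, y} = g" using wt[OF xy(1)] xy(2) by (simp add: g_def)
  have min: "g \<le> w {u, v}" if "(u, v) \<in> P" for u v using min0 wt[OF that] that by (auto simp: g_def)
  have Gx: "G div L = L + x" using leaf_div_mod(1)[of y x] xn n_less xy(2) by simp
  have Lx: "(L + x + 2 ^ b - L) mod 2 ^ b = x"
  proof -
    have "L + x < 2 ^ b" using xn n_less by (intro less_word1) simp
    then show ?thesis using sub_word[of L "L + x" "2 ^ b"] by simp
  qed
  define s1 where "s1 = s\<lparr>reg := (reg s)(10 := G, 7 := x, 12 := 1, 11 := 0),
     mem := (mem s)(4 := (mem s 4)(0 := x), 5 := (mem s 5)(x := 1))\<rparr>"
  have w: "wp b \<rho> (While (Op Less (Reg 11) (Reg 12)) (Seq (Assign 8 (Read 4 (Reg 11))) (Seq scan (inc 11)))) Q s1 (\<tau> + 19)"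
  proof (rule wp_While[where B = "\<tau> + 19 + 27 * n + 210 * k * card P" and I = "\<lambda>s' \<tau>'. \<exists>p q P'.
      frame {5, 6, 8, 11, 12, 13} {3, 4, 5} {} s1 s' \<and> reg s' 11 = p \<and> p \<le> length q \<and> queue s' q \<and>
      explored E w g x P (set (take p q)) q P' \<and> tournament (L * L) (wmem s 2) (mem s' 3) (leaf ` P') \<and>
      (\<forall>z\<in>set (take p q). \<forall>y. (z, y) \<in> P' \<longrightarrow> g < w {z, y}) \<and>
      \<tau>' + 210 * k * card P' \<le> \<tau> + 19 + 27 * p + 210 * k * card P"])
    have "explored E w g x P {} [x] P"
      using xn xy wxy by (auto simp: explored_def)
    moreover have "queue s1 [x]" using unmarked by (auto simp: queue_def s1_def)
    moreover have "tournament (L * L) (wmem s 2) (mem s1 3) (leaf ` P)" using T by (simp add: s1_def)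
    ultimately show "\<exists>p q P'.
      frame {5, 6, 8, 11, 12, 13} {3, 4, 5} {} s1 s1 \<and> reg s1 11 = p \<and> p \<le> length q \<and> queue s1 q \<and>
      explored E w g x P (set (take p q)) q P' \<and> tournament (L * L) (wmem s 2) (mem s1 3) (leaf ` P') \<and>
      (\<forall>z\<in>set (take p q). \<forall>y. (z, y) \<in> P' \<longrightarrow> g < w {z, y}) \<and>
      \<tau> + 19 + 210 * k * card P' \<le> \<tau> + 19 + 27 * p + 210 * k * card P"
      by - (rule exI[of _ 0], rule exI[of _ "[x]"], rule exI[of _ P], simp add: s1_def)
  next
    fix s' \<tau>'
    assume "\<exists>p q P'.
      frame {5, 6, 8, 11, 12, 13} {3, 4, 5} {} s1 s' \<and> reg s' 11 = p \<and> p \<le> length q \<and> queue s' q \<and>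
      explored E w g x P (set (take p q)) q P' \<and> tournament (L * L) (wmem s 2) (mem s' 3) (leaf ` P') \<and>
      (\<forall>z\<in>set (take p q). \<forall>y. (z, y) \<in> P' \<longrightarrow> g < w {z, y}) \<and>
      \<tau>' + 210 * k * card P' \<le> \<tau> + 19 + 27 * p + 210 * k * card P" (is "\<exists>p q P'. ?I s' \<tau>' p q P'")
    then obtain p q P' where I: "?I s' \<tau>' p q P'" by blast
    have fr: "frame {5, 6, 8, 11, 12, 13} {3, 4, 5} {} s1 s'" and p: "reg s' 11 = p" "p \<le> length q"
      and qu: "queue s' q" and X: "explored E w g x P (set (take p q)) q P'"
      and T': "tournament (L * L) (wmem s 2) (mem s' 3) (leaf ` P')"
      and fin': "\<And>z y. z \<in> set (take p q) \<Longrightarrow> (z, y) \<in> P' \<Longrightarrow> g < w {z, y}"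
      and \<tau>': "\<tau>' + 210 * k * card P' \<le> \<tau> + 19 + 27 * p + 210 * k * card P"
      using I by blast+
    have rs: "reg s' 0 = n" "reg s' 1 = L" "reg s' 2 = L * L" "reg s' 3 = L ^ 3" "wmem s' 2 = wmem s 2" "reg s' 10 = G" "reg s' 7 = x" "reg s' 12 = length q"
      using st fr qu by (auto simp: frame_def static_def s1_def queue_def)
    have qn: "length q \<le> n"
    proof -
      have "length q = card (set q)" "set q \<subseteq> {..<n}"
        using X unfolding explored_def by (metis distinct_card, blast)
      then show ?thesis using card_mono[of "{..<n}" "set q"] by simp
    qed
    {
      assume "eval b s' (Op Less (Reg 11) (Reg 12)) \<noteq> 0"
      then have pl: "p < length q" using p rs by (simp split: if_splits)
      define s2 where "s2 = s'\<lparr>reg := (reg s')(8 := q ! p)\<rparr>"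
      have tk: "set (take (Suc p) q) = insert (q ! p) (set (take p q))"
        using pl by (simp add: take_Suc_conv_app_nth)
      have "set (take (Suc p) q) \<subseteq> set q" by (rule set_take_subset)
      then have X2: "explored E w g x P (set (take (Suc p) q)) q P'"
        using X unfolding explored_def tk by blast
      have w: "wp b \<rho> scan (wp b \<rho> (inc 11) (\<lambda>s' \<tau>'. \<exists>p q P'. ?I s' \<tau>' p q P')) s2 (\<tau>' + 7)"
      proof (rule wp_scan[where s = s2 and ?P0.0 = P and z = "q ! p" and g = g and q = q and E = E and w = w])
        show "static s2" using rs by (simp add: static_def s2_def)
        show "reg s2 8 = q ! p" by (simp add: s2_def)
        show "wmem s2 2 (reg s2 10) = g" using rs by (simp add: s2_def g_def)
        show "tournament (L * L) (wmem s2 2) (mem s2 3) (leaf ` P')" using T' rs by (simp add: s2_def)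
        show "queue s2 q" using qu by (simp add: queue_def s2_def)
        show "explored E w g x P (set (take (Suc p) q)) q P'" by fact
        show "q ! p \<in> set (take (Suc p) q)" using tk by simp
        show "wmem s2 2 (leaf (u, v)) = w {u, v}" if "(u, v) \<in> P" for u v
          using wt[OF that] rs by (simp add: s2_def)
        fix s3 \<tau>3 q' P3
        assume 3: "frame {5, 6, 12, 13} {3, 4, 5} {} s2 s3" "queue s3 (q @ q')"
          "explored E w g x P (set (take (Suc p) q)) (q @ q') P3"
          "tournament (L * L) (wmem s2 2) (mem s3 3) (leaf ` P3)" "P3 \<subseteq> P'"
          "\<And>y. (q ! p, y) \<in> P3 \<Longrightarrow> g < w {q ! p, y}"
          "\<tau>3 + 210 * k * card P3 \<le> \<tau>' + 7 + 16 + 210 * k * card P'"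
        define s4 where "s4 = s3\<lparr>reg := (reg s3)(11 := Suc p)\<rparr>"
        have r11: "reg s3 11 = p" using 3(1) p by (simp add: frame_def s2_def)
        have "frame {5, 6, 8, 11, 12, 13} {3, 4, 5} {} s1 s2"
          using fr by (simp add: frame_def s2_def)
        then have "frame {5, 6, 8, 11, 12, 13} {3, 4, 5} {} s1 s3"
          by (rule frame_trans[OF _ 3(1)]) auto
        then have "frame {5, 6, 8, 11, 12, 13} {3, 4, 5} {} s1 s4"
          by (simp add: frame_def s4_def)
        moreover have "queue s4 (q @ q')" using 3(2) by (simp add: queue_def s4_def)
        moreover have "tournament (L * L) (wmem s 2) (mem s4 3) (leaf ` P3)"
          using 3(4) rs by (simp add: s4_def s2_def)
        moreover have "take (Suc p) (q @ q') = take (Suc p) q" using pl by simp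
        moreover have "\<forall>z\<in>set (take (Suc p) q). \<forall>y. (z, y) \<in> P3 \<longrightarrow> g < w {z, y}"
          using 3(5,6) fin' unfolding tk by blast
        moreover have "\<tau>3 + 4 + 210 * k * card P3 \<le> \<tau> + 19 + 27 * Suc p + 210 * k * card P"
          using 3(7) \<tau>' by simp
        ultimately have "?I s4 (\<tau>3 + 4) (Suc p) (q @ q') P3"
          using pl 3(3) by (simp add: s4_def)
        then have ex: "\<exists>p q P'. ?I s4 (\<tau>3 + 4) p q P'" by blast
        have "Suc p < 2 ^ b" using pl qn n_less by (intro less_word1) simp
        then have "wp b \<rho> (inc 11) F s3 \<tau>3 \<longleftrightarrow> F s4 (\<tau>3 + 4)" for F
          using r11 by (simp add: wp_inc s4_def)
        then show "wp b \<rho> (inc 11) (\<lambda>s' \<tau>'. \<exists>p q P'. ?I s' \<tau>' p q P') s3 \<tau>3" using ex by blast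
      qed (use P sym min in auto)
      show "wp b \<rho> (Seq (Assign 8 (Read 4 (Reg 11))) (Seq scan (inc 11))) (\<lambda>s' \<tau>'. \<exists>p q P'. ?I s' \<tau>' p q P') s'
        (\<tau>' + (1 + cost (Op Less (Reg 11) (Reg 12))))"
        unfolding wp_Seq wp_Assign
        by (rule wp_cong[OF w]) (use qu pl p in \<open>simp_all add: s2_def queue_def\<close>)
    next
      assume "eval b s' (Op Less (Reg 11) (Reg 12)) = 0"
      then have pl: "p = length q" using p rs by (simp split: if_splits)
      have X2: "explored E w g x P (set q) q P'" using X pl by simp
      have PP: "P' \<subseteq> P" and len: "length q \<le> Suc (card (P - P'))" and xq: "x \<in> set q"
        using X unfolding explored_def by blast+
      have fP': "finite P'" using PP fin finite_subset by blast
      have cd: "card (P - P') + card P' = card P"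
        using card_Diff_subset[OF fP' PP] card_mono[OF fin PP] by simp
      have "(x, y) \<notin> P'" using fin'[of x y] wxy xq pl by auto
      then have "card P' < card P" using xy(1) PP by (intro psubset_card_mono[OF fin]) blast
      moreover have "length q + card P' \<le> Suc (card P)" using len cd by simp
      moreover have "\<tau>' + 4 + 300 * k * card P' \<le> \<tau> + 300 * k * card P"
      proof -
        define d where "d = card (P - P')"
        have d: "1 \<le> d" "p \<le> Suc d" "card P = d + card P'"
          using \<open>card P' < card P\<close> cd len pl by (auto simp: d_def)
        \<comment> \<open>From \<open>p \<le> Suc d\<close> the left side is at most
          \<open>27 * d + 50\<close>, and \<open>1 \<le> d\<close> absorbs the \<open>50\<close>:
          the edge that determined \<open>g\<close> has been removed. Together with
          \<open>210 * k\<close> per edge for scanning, \<open>90 * k\<close> makes the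
          \<open>300 * k\<close> of the claim.\<close>
        have "27 * p + 23 \<le> 77 * d" using d by linarith
        also have "\<dots> \<le> 90 * k * d" using k_pos by simp
        finally show ?thesis using \<tau>' unfolding d(3) by (simp add: algebra_simps)
      qed
      moreover have "frame {5, 6, 7, 8, 10, 11, 12, 13} {3, 4, 5} {} s s'"
        using fr by (auto simp: frame_def s1_def)
      moreover have "wmem s 2 (reg s' 10) = g" using rs by (simp add: g_def)
      ultimately show "Q s' (\<tau>' + (1 + cost (Op Less (Reg 11) (Reg 12))))"
        using rs qu X2 T' fin' min pl by (intro Q[of s' x g q P']) auto
    next
      show "\<tau>' \<le> \<tau> + 19 + 27 * n + 210 * k * card P" using \<tau>' p qn by simp
    }
  qed
  show ?thesis
    unfolding explore_def wp_Seq[of _ _ "Assign _ _"] wp_Seq[of _ _ "Write _ _ _"] wp_Assign wp_Write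
    by (rule wp_cong[OF w]) (use Gx Lx st' in \<open>simp_all add: s1_def G_def fun_eq_iff\<close>)
qed

section \<open>Merging the set trees of a component\<close>

text \<open>The first pass collects everything in the tree of the start vertex, the second one
  distributes it.\<close>

definition pass :: com where
  "pass = Seq (Assign 11 (Const 0)) (While (Op Less (Reg 11) (Reg 12))
     (Seq (Assign 8 (Read 4 (Reg 11))) (Seq (Write 5 (Reg 8) (Const 0))
       (Seq (com.If (Read 2 (node 8 row_root)) Skip (Seq (Assign 9 (Reg 8)) (Seq (Assign 5 row_root) insert_elem)))
         (Seq merge (inc 11))))))"

text \<open>One predicate for both passes, which run the same code. After the first pass, the
  unconditional clauses say that the set of \<open>x\<close> contains all others and nothing
  foreign. This is the premise of the implication, which then yields for the second pass that every
  visited vertex has exactly the set of \<open>x\<close>.\<close>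

definition spread :: "(nat \<Rightarrow> nat set) \<Rightarrow> nat list \<Rightarrow> nat \<Rightarrow> nat \<Rightarrow> (nat \<Rightarrow> nat set) \<Rightarrow> bool" where
  "spread R q x p R' \<longleftrightarrow>
     (\<forall>v. R v \<subseteq> R' v) \<and> (\<forall>v. v \<notin> set q \<longrightarrow> R' v = R v) \<and>
     (\<forall>z\<in>set q. R' z \<subseteq> (\<Union>z\<in>set q. insert z (R z))) \<and>
     (\<forall>z\<in>set (take p q). z \<in> R' z \<and> R' z \<subseteq> R' x) \<and>
     ((\<forall>z\<in>set q. z \<in> R z \<and> R z \<subseteq> R x) \<longrightarrow>
        (\<forall>z\<in>set q. R' z \<subseteq> R x) \<and> (\<forall>z\<in>set (take p q). R' z = R x))"

lemma spread_step:
  assumes S: "spread R q x p R'" and p: "p < length q" and x: "x \<in> set q" and z: "z = q ! p"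
    and R1: "R1 = (if z \<in> R' z then R' else R'(z := insert z (R' z)))"
    and R2: "R2 = R1(x := R1 x \<union> R1 z, z := R1 x \<union> R1 z)"
  shows "spread R q x (Suc p) R2"
proof -
  have tk: "set (take (Suc p) q) = insert z (set (take p q))"
    using p z by (simp add: take_Suc_conv_app_nth)
  have zq: "z \<in> set q" using p z by simp
  have R1': "R1 v = (if v = z then insert z (R' v) else R' v)" for v using R1 by auto
  have R2': "R2 v = (if v = x \<or> v = z then insert z (R' x \<union> R' z) else R' v)" for v
    unfolding R2 by (auto simp: R1')
  show ?thesis
    unfolding spread_def
  proof (intro conjI allI impI)
    show "R v \<subseteq> R2 v" for v using S unfolding R2' spread_def by (auto 4 3)
    show "R2 v = R v" if "v \<notin> set q" for v
    proof -
      have "v \<noteq> x" "v \<noteq> z" using that x zq by auto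
      then show ?thesis using S that unfolding R2' spread_def by simp
    qed
    have up: "R' v \<subseteq> (\<Union>z\<in>set q. insert z (R z))" if "v \<in> set q" for v
      using S that unfolding spread_def by blast
    have "z \<in> (\<Union>z\<in>set q. insert z (R z))" using zq by blast
    then show "\<forall>v\<in>set q. R2 v \<subseteq> (\<Union>z\<in>set q. insert z (R z))"
      using up[OF x] up[OF zq] up unfolding R2' by (auto split: if_splits)
    have old: "v \<in> R' v \<and> R' v \<subseteq> R' x" if "v \<in> set (take p q)" for v
      using S that unfolding spread_def by blast
    show "\<forall>v\<in>set (take (Suc p) q). v \<in> R2 v \<and> R2 v \<subseteq> R2 x"
    proof
      fix v assume "v \<in> set (take (Suc p) q)"
      then consider "v = z" | "v \<noteq> z" "v \<in> set (take p q)" using tk by auto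
      then show "v \<in> R2 v \<and> R2 v \<subseteq> R2 x"
        by cases (use old[of v] in \<open>auto simp: R2'\<close>)
    qed
    assume C: "\<forall>z\<in>set q. z \<in> R z \<and> R z \<subseteq> R x"
    then have le: "R' v \<subseteq> R x" if "v \<in> set q" for v using S that unfolding spread_def by blast
    \<comment> \<open>Under the premise all sets of the component are confined to
      \<open>R x\<close>, so the tree of \<open>x\<close> no longer changes.\<close>
    have xx: "R' x = R x" using le[OF x] S unfolding spread_def by blast
    have zx: "z \<in> R x" using C zq by blast
    have R3: "R2 v = (if v = x \<or> v = z then R x else R' v)" for v
      unfolding R2' using le[OF zq] xx zx by auto
    show "\<forall>z\<in>set q. R2 z \<subseteq> R x" using le unfolding R3 by auto
    have "R' v = R x" if "v \<in> set (take p q)" for v using S C that unfolding spread_def by blast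
    then show "\<forall>v\<in>set (take (Suc p) q). R2 v = R x" unfolding tk R3 by auto
  qed
qed

text \<open>Besides merging, a pass puts each vertex into its own set and resets its visited mark.
  The marks are cleared along the queue, because clearing all of them would cost time proportional
  to \<open>n\<close> in every round.\<close>

lemma wp_pass:
  assumes R: "represents0 s R D" and s: "reg s 7 = x" "reg s 12 = length q"
    and q: "\<And>i. i < length q \<Longrightarrow> mem s 4 i = q ! i" "set q \<subseteq> {..<n}" "x \<in> set q" "length q \<le> n"
    and D: "\<And>u v. u < n \<Longrightarrow> v < n \<Longrightarrow> u \<notin> R v \<Longrightarrow> D u v = wmem s 2 (reg s 10)"
    and Q: "\<And>s' \<tau>' R'. frame {4, 5, 8, 9, 11, 14} {1, 2, 5, 6} {1} s s' \<Longrightarrow> represents0 s' R' D \<Longrightarrow>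
       spread R q x (length q) R' \<Longrightarrow>
       (\<And>v. mem s' 5 v = (if v \<in> set q then 0 else mem s 5 v)) \<Longrightarrow>
       \<tau>' + 200 * k * npairs R \<le> \<tau> + 6 + 60 * length q + 200 * k * npairs R' \<Longrightarrow> Q s' \<tau>'"
  shows "wp b \<rho> pass Q s \<tau>"
proof -
  define s0 where "s0 = s\<lparr>reg := (reg s)(11 := 0)\<rparr>"
  let ?body = "Seq (Assign 8 (Read 4 (Reg 11))) (Seq (Write 5 (Reg 8) (Const 0))
       (Seq (com.If (Read 2 (node 8 row_root)) Skip (Seq (Assign 9 (Reg 8)) (Seq (Assign 5 row_root) insert_elem)))
         (Seq merge (inc 11))))"
  have xn: "x < n" using q by auto
  have w: "wp b \<rho> (While (Op Less (Reg 11) (Reg 12)) ?body) Q s0 (\<tau> + 2)"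
  proof (rule wp_While[where B = "\<tau> + 2 + 60 * n + 200 * k * (n * n)" and I = "\<lambda>s' \<tau>'. \<exists>R'.
     frame {4, 5, 8, 9, 11, 14} {1, 2, 5, 6} {1} s s' \<and> represents0 s' R' D \<and> reg s' 11 \<le> length q \<and>
     spread R q x (reg s' 11) R' \<and>
     (\<forall>v. mem s' 5 v = (if v \<in> set (take (reg s' 11) q) then 0 else mem s 5 v)) \<and>
     \<tau>' + 200 * k * npairs R \<le> \<tau> + 2 + 60 * reg s' 11 + 200 * k * npairs R'"])
    have "represents0 s0 R D" by (rule represents0_cong[OF R]) (simp_all add: s0_def)
    moreover have "spread R q x 0 R" by (auto simp: spread_def)
    ultimately show "\<exists>R'. frame {4, 5, 8, 9, 11, 14} {1, 2, 5, 6} {1} s s0 \<and> represents0 s0 R' D \<and> reg s0 11 \<le> length q \<and>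
     spread R q x (reg s0 11) R' \<and>
     (\<forall>v. mem s0 5 v = (if v \<in> set (take (reg s0 11) q) then 0 else mem s 5 v)) \<and>
     \<tau> + 2 + 200 * k * npairs R \<le> \<tau> + 2 + 60 * reg s0 11 + 200 * k * npairs R'"
      by (intro exI[of _ R]) (simp add: s0_def frame_def)
  next
    fix s' \<tau>'
    assume "\<exists>R'. frame {4, 5, 8, 9, 11, 14} {1, 2, 5, 6} {1} s s' \<and> represents0 s' R' D \<and> reg s' 11 \<le> length q \<and>
     spread R q x (reg s' 11) R' \<and>
     (\<forall>v. mem s' 5 v = (if v \<in> set (take (reg s' 11) q) then 0 else mem s 5 v)) \<and>
     \<tau>' + 200 * k * npairs R \<le> \<tau> + 2 + 60 * reg s' 11 + 200 * k * npairs R'" (is "\<exists>R'. ?I s' \<tau>' R'")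
    then obtain R' where I: "?I s' \<tau>' R'" by blast
    define p where "p = reg s' 11"
    have fr: "frame {4, 5, 8, 9, 11, 14} {1, 2, 5, 6} {1} s s'" and R': "represents0 s' R' D" and p: "p \<le> length q"
      and S: "spread R q x p R'" and marks: "\<And>v. mem s' 5 v = (if v \<in> set (take p q) then 0 else mem s 5 v)"
      and \<tau>': "\<tau>' + 200 * k * npairs R \<le> \<tau> + 2 + 60 * p + 200 * k * npairs R'"
      using I unfolding p_def by blast+
    have rs: "reg s' 0 = n" "reg s' 1 = L" "reg s' 7 = x" "reg s' 12 = length q" "reg s' 10 = reg s 10"
      "wmem s' 2 = wmem s 2" "mem s' 4 = mem s 4"
      using represents0D(5,6)[OF R'] s fr by (auto simp: frame_def)
    {
      assume "eval b s' (Op Less (Reg 11) (Reg 12)) \<noteq> 0"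
      then have pl: "p < length q" using rs by (simp add: p_def split: if_splits)
      define z where "z = q ! p"
      have zn: "z < n" using nth_mem[OF pl] q(2) by (auto simp: z_def)
      have tk: "set (take (Suc p) q) = insert z (set (take p q))"
        using pl by (simp add: take_Suc_conv_app_nth z_def)
      define s2 where "s2 = s'\<lparr>reg := (reg s')(8 := z), mem := (mem s')(5 := (mem s' 5)(z := 0))\<rparr>"
      have R2: "represents0 s2 R' D" by (rule represents0_cong[OF R']) (simp_all add: s2_def)
      have root: "eval b s3 row_root = L + z" if "reg s3 = reg s2 \<or> reg s3 = (reg s2)(9 := z)" for s3
      proof -
        have "L + z < 2 ^ b" using zn n_less by (intro less_word1) simp
        then show ?thesis using that rs by (auto simp: row_root_def s2_def)
      qed
      have entry: "eval b s2 (Read 2 (node 8 row_root)) = of_bool (z \<in> R' z)"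
        using eval_node[of s2 8 row_root] root[of s2] rs zn n_less represents0D(4)[OF R2 zn, of z]
        by (simp add: s2_def rd_def)
      define R1 where "R1 = (if z \<in> R' z then R' else R'(z := insert z (R' z)))"
      have DR': "D u v = wmem s 2 (reg s 10)" if "u < n" "v < n" "u \<notin> R' v" for u v
      proof -
        have "R v \<subseteq> R' v" using S unfolding spread_def by blast
        then show ?thesis using D[OF that(1,2)] that(3) by blast
      qed
      have fr2: "frame {4, 5, 8, 9, 11, 14} {1, 2, 5, 6} {1} s s2"
        using fr by (auto simp: frame_def s2_def)
      have rest: "wp b \<rho> (Seq merge (inc 11)) (\<lambda>s' \<tau>'. \<exists>R'. ?I s' \<tau>' R') s3 \<tau>3"
        if 3: "frame {4, 5, 9, 14} {1, 2, 6} {1} s2 s3" "represents0 s3 R1 D"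
          "\<tau>3 + 200 * k * npairs R' \<le> \<tau>' + 28 + 200 * k * npairs R1" for s3 \<tau>3
        unfolding wp_Seq
      proof (rule wp_merge[OF 3(2), of x z])
        have rs3: "reg s3 7 = x" "reg s3 8 = z" "reg s3 10 = reg s 10" "wmem s3 2 = wmem s 2" "reg s3 11 = p"
          using 3(1) rs by (auto simp: frame_def s2_def p_def)
        then show "reg s3 7 = x" "reg s3 8 = z" "x < n" "z < n" using xn zn by auto
        show "D u v = wmem s3 2 (reg s3 10)" if "u < n" "v < n" "u \<notin> R1 v" for u v
          using DR'[OF that(1,2)] that(3) rs3 by (auto simp: R1_def split: if_splits)
        fix s4 \<tau>4 R4
        assume 4: "frame {4, 5, 9, 14} {1, 2, 6} {1} s3 s4" "represents0 s4 R4 D"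
          "R4 = R1(x := R1 x \<union> R1 z, z := R1 x \<union> R1 z)" "npairs R1 \<le> npairs R4"
          "\<tau>4 + 200 * k * npairs R1 \<le> \<tau>3 + 20 + 200 * k * npairs R4"
        define s5 where "s5 = s4\<lparr>reg := (reg s4)(11 := Suc p)\<rparr>"
        have r11: "reg s4 11 = p" using 4(1) rs3 by (simp add: frame_def)
        have "?I s5 (\<tau>4 + 4) R4"
        proof (intro conjI)
          have "frame {4, 5, 8, 9, 11, 14} {1, 2, 5, 6} {1} s s3" by (rule frame_trans[OF fr2 3(1)]) auto
          then have "frame {4, 5, 8, 9, 11, 14} {1, 2, 5, 6} {1} s s4" by (rule frame_trans[OF _ 4(1)]) auto
          then show "frame {4, 5, 8, 9, 11, 14} {1, 2, 5, 6} {1} s s5" by (simp add: frame_def s5_def)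
          show "represents0 s5 R4 D" by (rule represents0_cong[OF 4(2)]) (simp_all add: s5_def)
          show "reg s5 11 \<le> length q" using pl by (simp add: s5_def)
          have "spread R q x (Suc p) R4" by (rule spread_step[OF S pl q(3) z_def R1_def 4(3)])
          then show "spread R q x (reg s5 11) R4" by (simp add: s5_def)
          have "mem s5 5 = (mem s' 5)(z := 0)" using 3(1) 4(1) by (simp add: frame_def s5_def s2_def)
          then show "\<forall>v. mem s5 5 v = (if v \<in> set (take (reg s5 11) q) then 0 else mem s 5 v)"
            using marks by (simp add: s5_def tk)
          show "\<tau>4 + 4 + 200 * k * npairs R \<le> \<tau> + 2 + 60 * reg s5 11 + 200 * k * npairs R4"
            using 4(5) 3(3) \<tau>' by (simp add: s5_def)
        qed
        then have ex: "\<exists>R'. ?I s5 (\<tau>4 + 4) R'" by blast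
        have "Suc p < 2 ^ b" using pl q(4) n_less by (intro less_word1) simp
        then show "wp b \<rho> (inc 11) (\<lambda>s' \<tau>'. \<exists>R'. ?I s' \<tau>' R') s4 \<tau>4"
          using ex r11 wp_inc[of s4 11 "\<lambda>s' \<tau>'. \<exists>R'. ?I s' \<tau>' R'" \<tau>4] by (simp only: s5_def)
      qed
      have w2: "wp b \<rho> (com.If (Read 2 (node 8 row_root)) Skip (Seq (Assign 9 (Reg 8)) (Seq (Assign 5 row_root) insert_elem)))
        (wp b \<rho> (Seq merge (inc 11)) (\<lambda>s' \<tau>'. \<exists>R'. ?I s' \<tau>' R')) s2 (\<tau>' + 10)"
      proof (cases "z \<in> R' z")
        case True
        then have "R1 = R'" by (simp add: R1_def)
        then have "wp b \<rho> (Seq merge (inc 11)) (\<lambda>s' \<tau>'. \<exists>R'. ?I s' \<tau>' R') s2 (\<tau>' + 22)"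
          by (intro rest) (use R2 in auto)
        then show ?thesis unfolding wp_If entry wp_Skip using True by (simp add: row_root_def add.commute[of _ \<tau>'])
      next
        case False
        then have R1': "R1 = R'(z := insert z (R' z))" by (simp add: R1_def)
        define s3 where "s3 = s2\<lparr>reg := (reg s2)(9 := z, 5 := L + z)\<rparr>"
        have "wp b \<rho> insert_elem (wp b \<rho> (Seq merge (inc 11)) (\<lambda>s' \<tau>'. \<exists>R'. ?I s' \<tau>' R')) s3 (\<tau>' + 27)"
        proof (rule wp_insert_elem[of s3 R' D z z])
          show "represents0 s3 R' D" by (rule represents0_cong[OF R2]) (simp_all add: s3_def)
          show "reg s3 9 = z" "reg s3 5 = L + z" by (simp_all add: s3_def)
          show "D z z = wmem s3 2 (reg s3 10)" using DR'[OF zn zn False] rs by (simp add: s3_def s2_def)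
          fix s4 \<tau>4
          assume 4: "frame {4, 5, 14} {1, 2, 6} {1} s3 s4" "represents0 s4 (R'(z := insert z (R' z))) D"
            "\<tau>4 \<le> \<tau>' + 27 + 100 * k"
          show "wp b \<rho> (Seq merge (inc 11)) (\<lambda>s' \<tau>'. \<exists>R'. ?I s' \<tau>' R') s4 \<tau>4"
          proof (rule rest)
            have "frame {4, 5, 9, 14} {1, 2, 6} {1} s2 s3" by (simp add: frame_def s3_def)
            then show "frame {4, 5, 9, 14} {1, 2, 6} {1} s2 s4" by (rule frame_trans[OF _ 4(1)]) auto
            show "represents0 s4 R1 D" using 4(2) R1' by simp
            have "npairs R1 = Suc (npairs R')"
              unfolding R1' using represents0D(2)[OF R'] zn False by (intro npairs_insert) auto
            then show "\<tau>4 + 200 * k * npairs R' \<le> \<tau>' + 28 + 200 * k * npairs R1"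
              using 4(3) by simp
          qed
        qed (use zn False in simp_all)
        note w3 = this
        have e: "eval b s2 (Reg 8) = z" by (simp add: s2_def)
        have e2: "eval b (s2\<lparr>reg := (reg s2)(9 := z)\<rparr>) row_root = L + z" by (rule root) simp
        show ?thesis
          unfolding wp_If entry wp_Seq[of _ _ "Assign _ _"] wp_Assign e e2 using False
          by (simp only: of_bool_eq if_False simp_thms) (rule wp_cong[OF w3], simp_all add: s3_def row_root_def)
      qed
      show "wp b \<rho> ?body (\<lambda>s' \<tau>'. \<exists>R'. ?I s' \<tau>' R') s' (\<tau>' + (1 + cost (Op Less (Reg 11) (Reg 12))))"
        unfolding wp_Seq[of _ _ "Assign _ _"] wp_Seq[of _ _ "Write _ _ _"] wp_Seq[of _ _ "com.If _ _ _"] wp_Assign wp_Write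
        by (rule wp_cong[OF w2]) (use rs q(1)[OF pl] in \<open>simp_all add: s2_def z_def p_def[symmetric]\<close>)
    next
      assume "eval b s' (Op Less (Reg 11) (Reg 12)) = 0"
      then have "p = length q" using p rs by (simp add: p_def split: if_splits)
      then show "Q s' (\<tau>' + (1 + cost (Op Less (Reg 11) (Reg 12))))"
        using S marks \<tau>' by (intro Q[OF fr R']) simp_all
    next
      have "200 * k * npairs R' \<le> 200 * k * (n * n)" using represents0D(3)[OF R'] by simp
      then show "\<tau>' \<le> \<tau> + 2 + 60 * n + 200 * k * (n * n)" using \<tau>' p q(4) by linarith
    }
  qed
  show ?thesis
    unfolding pass_def wp_Seq[of _ _ "Assign 11 _"] wp_Assign by (rule wp_cong[OF w]) (simp_all add: s0_def)
qed

section \<open>The main loop\<close>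

definition round :: com where
  "round = Seq explore (Seq pass pass)"

definition ready :: "nat set set \<Rightarrow> (nat set \<Rightarrow> real) \<Rightarrow> (nat \<times> nat) set \<Rightarrow> (nat \<Rightarrow> nat set) \<Rightarrow>
    (nat \<Rightarrow> nat \<Rightarrow> real) \<Rightarrow> state \<Rightarrow> bool" where
  "ready E w P R D s \<longleftrightarrow> represents0 s R D \<and> labelled n E w P R D \<and> P \<subseteq> {..<n} \<times> {..<n} \<and>
     tournament (L * L) (wmem s 2) (mem s 3) (leaf ` P) \<and> (\<forall>v<n. mem s 5 v = 0) \<and>
     (\<forall>u v. (u, v) \<in> P \<longrightarrow> wmem s 2 (leaf (u, v)) = w {u, v})"

text \<open>Removed edges pay twice \<open>300 * k\<close>, once for the exploration and once for
  the overhead of the passes per vertex; the merging itself is paid by new pairs. The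
  \<open>3\<close> is reserved for the loop test of \<open>main\<close>.\<close>

lemma wp_round:
  assumes G: "ugraph n E" and A: "ready E w P R D s" and ne: "P \<noteq> {}"
    and Q: "\<And>s' \<tau>' P' R' D'. ready E w P' R' D' s' \<Longrightarrow>
      \<tau>' + 3 + 300 * k * card P' + 200 * k * npairs R \<le> \<tau> + 300 * k * card P + 300 * k * (card P - card P') + 200 * k * npairs R' \<Longrightarrow>
      card P' < card P \<Longrightarrow> Q s' \<tau>'"
  shows "wp b \<rho> round Q s \<tau>"
proof -
  have R: "represents0 s R D" and lab: "labelled n E w P R D" and P: "P \<subseteq> {..<n} \<times> {..<n}"
    and T: "tournament (L * L) (wmem s 2) (mem s 3) (leaf ` P)" and un: "\<And>v. v < n \<Longrightarrow> mem s 5 v = 0"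
    and wt: "\<And>u v. (u, v) \<in> P \<Longrightarrow> wmem s 2 (leaf (u, v)) = w {u, v}"
    using A unfolding ready_def by blast+
  have sym: "{u, v} \<in> E \<and> (v, u) \<in> P" if "(u, v) \<in> P" for u v
    using lab that unfolding labelled_def by blast
  show ?thesis
    unfolding round_def wp_Seq[of _ _ explore]
  proof (rule wp_explore[where E = E and w = w, OF represents0D(1)[OF R] P ne sym wt T un])
    fix s1 \<tau>1 x q P1 g
    assume fr1: "frame {5, 6, 7, 8, 10, 11, 12, 13} {3, 4, 5} {} s s1" and s1: "reg s1 7 = x"
      and g: "wmem s 2 (reg s1 10) = g" and qu: "queue s1 q" and X: "explored E w g x P (set q) q P1"
      and T1: "tournament (L * L) (wmem s 2) (mem s1 3) (leaf ` P1)"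
      and fin: "\<And>z y. z \<in> set q \<Longrightarrow> (z, y) \<in> P1 \<Longrightarrow> g < w {z, y}"
      and min: "\<And>u v. (u, v) \<in> P \<Longrightarrow> g \<le> w {u, v}" and less: "card P1 < card P"
      and len: "length q + card P1 \<le> Suc (card P)"
      and \<tau>1: "\<tau>1 + 300 * k * card P1 \<le> \<tau> + 300 * k * card P"
    \<comment> \<open>The final labels are fixed before any merging; \<open>represents0\<close>
      holds for \<open>D'\<close> because it agrees with \<open>D\<close> on all pairs
      present.\<close>
    define D' where "D' = (\<lambda>u v. if u \<in> R v then D u v else g)"
    have "represents0 s1 R D"
      by (rule represents0_cong[OF R]) (use fr1 in \<open>simp_all add: frame_def\<close>)
    then have R1: "represents0 s1 R D'"
      unfolding represents0_def represents_def D'_def by simp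
    have xq: "x \<in> set q" and qn: "set q \<subseteq> {..<n}" and dq: "distinct q"
      using X unfolding explored_def by blast+
    have lq: "length q \<le> n" using card_mono[OF _ qn] distinct_card[OF dq] by simp
    have wm1: "wmem s1 2 = wmem s 2" using fr1 by (simp add: frame_def)
    have q1: "reg s1 12 = length q" "\<And>i. i < length q \<Longrightarrow> mem s1 4 i = q ! i"
      "\<And>v. v < n \<Longrightarrow> mem s1 5 v = of_bool (v \<in> set q)"
      using qu by (auto simp: queue_def)
    show "wp b \<rho> (Seq pass pass) Q s1 \<tau>1"
      unfolding wp_Seq
    proof (rule wp_pass[OF R1 s1 q1(1,2) qn xq lq])
      show "D' u v = wmem s1 2 (reg s1 10)" if "u < n" "v < n" "u \<notin> R v" for u v
        using that wm1 g by (simp add: D'_def)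
      fix s2 \<tau>2 R2
      assume fr2: "frame {4, 5, 8, 9, 11, 14} {1, 2, 5, 6} {1} s1 s2" and R2: "represents0 s2 R2 D'"
        and S2: "spread R q x (length q) R2" and m2: "\<And>v. mem s2 5 v = (if v \<in> set q then 0 else mem s1 5 v)"
        and \<tau>2: "\<tau>2 + 200 * k * npairs R \<le> \<tau>1 + 6 + 60 * length q + 200 * k * npairs R2"
      have s2: "reg s2 7 = x" "reg s2 12 = length q" "reg s2 10 = reg s1 10" "wmem s2 2 = wmem s 2"
        "mem s2 4 = mem s1 4" "mem s2 3 = mem s1 3"
        using fr2 s1 q1 wm1 by (auto simp: frame_def)
      show "wp b \<rho> pass Q s2 \<tau>2"
      proof (rule wp_pass[OF R2 s2(1,2) _ qn xq lq])
        show "mem s2 4 i = q ! i" if "i < length q" for i using q1(2)[OF that] s2 by simp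
        show "D' u v = wmem s2 2 (reg s2 10)" if "u < n" "v < n" "u \<notin> R2 v" for u v
        proof -
          have "u \<notin> R v" using S2 that unfolding spread_def by blast
          then show ?thesis using s2 g by (simp add: D'_def)
        qed
        fix s3 \<tau>3 R3
        assume fr3: "frame {4, 5, 8, 9, 11, 14} {1, 2, 5, 6} {1} s2 s3" and R3: "represents0 s3 R3 D'"
          and S3: "spread R2 q x (length q) R3" and m3: "\<And>v. mem s3 5 v = (if v \<in> set q then 0 else mem s2 5 v)"
          and \<tau>3: "\<tau>3 + 200 * k * npairs R2 \<le> \<tau>2 + 6 + 60 * length q + 200 * k * npairs R3"
        have s3: "wmem s3 2 = wmem s 2" "mem s3 3 = mem s1 3" using fr3 s2 by (auto simp: frame_def)
        \<comment> \<open>The first pass makes the set of \<open>x\<close> an upper bound of all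
          others, which is the premise for the exact clause in the second pass.\<close>
        have all2: "z \<in> R2 z \<and> R2 z \<subseteq> R2 x" if "z \<in> set q" for z using S2 that unfolding spread_def by simp
        have eq3: "R3 z = R2 x" if "z \<in> set q" for z using S3 that all2 unfolding spread_def by simp
        have R2x: "R2 x = (\<Union>z\<in>set q. insert z (R z))"
        proof
          show "R2 x \<subseteq> (\<Union>z\<in>set q. insert z (R z))" using S2 xq unfolding spread_def by blast
          have "R z \<subseteq> R2 z" for z using S2 unfolding spread_def by blast
          then show "(\<Union>z\<in>set q. insert z (R z)) \<subseteq> R2 x" using all2 by blast
        qed
        have lab3: "labelled n E w P1 R3 D'"
        proof (rule labelled_round[OF G lab qn, where g = g and x = x])
          show "P1 \<subseteq> P" using X unfolding explored_def by blast
          show "z \<in> set q \<and> y \<in> set q \<and> w {z, y} = g" if "(z, y) \<in> P" "(z, y) \<notin> P1" for z y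
            using X that unfolding explored_def by blast
          show "\<exists>y. (z, y) \<in> P \<and> w {z, y} = g" "(x, z) \<in> (same_weight E w g)\<^sup>*" if "z \<in> set q" for z
            using X that unfolding explored_def by blast+
          show "R3 v = R v" if "v \<notin> set q" for v using S2 S3 that unfolding spread_def by simp
          show "R3 v = (\<Union>z\<in>set q. insert z (R z))" if "v \<in> set q" for v using eq3[OF that] R2x by simp
          show "D' u v = (if u \<in> R v then D u v else g)" for u v by (simp add: D'_def)
        qed (use fin min in blast)+
        have P1P: "P1 \<subseteq> P" using X unfolding explored_def by blast
        show "Q s3 \<tau>3"
        proof (rule Q[OF _ _ less])
          show "ready E w P1 R3 D' s3"
            unfolding ready_def
          proof (intro conjI allI impI)
            show "mem s3 5 v = 0" if "v < n" for v using m3[of v] m2[of v] q1(3)[OF that] by simp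
          qed (use R3 lab3 P1P P T1 s3 wt in auto)
          define d where "d = card P - card P1"
          have d: "1 \<le> d" "length q \<le> Suc d" using less len by (auto simp: d_def)
          \<comment> \<open>The \<open>15\<close> consists of \<open>6\<close> for each pass and the
            reserved \<open>3\<close>; two passes cost \<open>60\<close> each per vertex. With
            \<open>length q \<le> Suc d\<close> the sum is at most \<open>120 * d + 135\<close>, and
            \<open>1 \<le> d\<close> suffices.\<close>
          then have "15 + 120 * length q \<le> 300 * d" by linarith
          also have "\<dots> \<le> 300 * k * d" using k_pos by simp
          finally show "\<tau>3 + 3 + 300 * k * card P1 + 200 * k * npairs R
            \<le> \<tau> + 300 * k * card P + 300 * k * (card P - card P1) + 200 * k * npairs R3"
            using \<tau>1 \<tau>2 \<tau>3 unfolding d_def by linarith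
        qed
      qed
    qed
  qed
qed

definition main :: com where
  "main = While (Read 3 (Const 1)) round"

text \<open>The clock plus \<open>600 * k\<close> times the remaining edges minus
  \<open>200 * k\<close> times the reached pairs never increases; both counts are at most
  \<open>n * n\<close> for edges and pairs inside the vertex set.\<close>

lemma wp_main:
  assumes G: "ugraph n E" and A: "ready E w P R D s"
    and Q: "\<And>s' \<tau>' R' D'. ready E w {} R' D' s' \<Longrightarrow>
      \<tau>' \<le> \<tau> + 600 * k * card P + 200 * k * (n * n) + 3 \<Longrightarrow> Q s' \<tau>'"
  shows "wp b \<rho> main Q s \<tau>"
  unfolding main_def
proof (rule wp_While[where B = "\<tau> + 600 * k * card P + 200 * k * (n * n)" and I = "\<lambda>s' \<tau>'. \<exists>P' R' D'.
    ready E w P' R' D' s' \<and> \<tau>' + 600 * k * card P' + 200 * k * npairs R \<le> \<tau> + 600 * k * card P + 200 * k * npairs R'"])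
  show "\<exists>P' R' D'. ready E w P' R' D' s \<and>
      \<tau> + 600 * k * card P' + 200 * k * npairs R \<le> \<tau> + 600 * k * card P + 200 * k * npairs R'"
    using A by blast
next
  fix s' \<tau>'
  assume "\<exists>P' R' D'. ready E w P' R' D' s' \<and>
      \<tau>' + 600 * k * card P' + 200 * k * npairs R \<le> \<tau> + 600 * k * card P + 200 * k * npairs R'"
  then obtain P' R' D' where A': "ready E w P' R' D' s'"
    and \<tau>': "\<tau>' + 600 * k * card P' + 200 * k * npairs R \<le> \<tau> + 600 * k * card P + 200 * k * npairs R'" by blast
  have T: "tournament (L * L) (wmem s' 2) (mem s' 3) (leaf ` P')" and P': "P' \<subseteq> {..<n} \<times> {..<n}"
    using A' unfolding ready_def by blast+
  have LL: "0 < L * L" using L_ge by simp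
  have iff: "eval b s' (Read 3 (Const 1)) = 0 \<longleftrightarrow> P' = {}"
  proof
    show "P' = {}" if "eval b s' (Read 3 (Const 1)) = 0" using tournament_min(1)[OF T P'] that by simp
    show "eval b s' (Read 3 (Const 1)) = 0" if "P' = {}"
      using tournament_node[OF T, of 1] LL that by (cases "mem s' 3 1 = 0") auto
  qed
  have "npairs R' \<le> n * n" using A' represents0D(3) unfolding ready_def by blast
  then have np: "200 * k * npairs R' \<le> 200 * k * (n * n)" by simp
  {
    assume "eval b s' (Read 3 (Const 1)) \<noteq> 0"
    then have ne: "P' \<noteq> {}" using iff by simp
    show "wp b \<rho> round (\<lambda>s' \<tau>'. \<exists>P' R' D'. ready E w P' R' D' s' \<and>
      \<tau>' + 600 * k * card P' + 200 * k * npairs R \<le> \<tau> + 600 * k * card P + 200 * k * npairs R') s'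
      (\<tau>' + (1 + cost (Read 3 (Const 1))))"
    proof (rule wp_round[OF G A' ne])
      fix s2 \<tau>2 P2 R2 D2
      assume 2: "ready E w P2 R2 D2 s2" "\<tau>2 + 3 + 300 * k * card P2 + 200 * k * npairs R' \<le>
        \<tau>' + (1 + cost (Read 3 (Const 1))) + 300 * k * card P' + 300 * k * (card P' - card P2) + 200 * k * npairs R2"
        "card P2 < card P'"
      show "\<exists>P' R' D'. ready E w P' R' D' s2 \<and>
        \<tau>2 + 600 * k * card P' + 200 * k * npairs R \<le> \<tau> + 600 * k * card P + 200 * k * npairs R'"
      proof (intro exI conjI)
        show "ready E w P2 R2 D2 s2" by fact
        define d where "d = card P' - card P2"
        have d: "card P' = card P2 + d" using 2(3) by (simp add: d_def)
        show "\<tau>2 + 600 * k * card P2 + 200 * k * npairs R \<le> \<tau> + 600 * k * card P + 200 * k * npairs R2"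
        proof -
          have "600 * k * card P' = 600 * k * card P2 + 600 * k * d" "300 * k * card P' = 300 * k * card P2 + 300 * k * d"
            "cost (Read 3 (Const 1)) = 2" by (simp_all add: d distrib_left)
          then show ?thesis using 2(2)[folded d_def] \<tau>' by linarith
        qed
      qed
    qed
  next
    assume "eval b s' (Read 3 (Const 1)) = 0"
    then have "ready E w {} R' D' s'" "P' = {}" using A' iff by auto
    moreover have "\<tau>' \<le> \<tau> + 600 * k * card P + 200 * k * (n * n)" using \<tau>' np by linarith
    ultimately show "Q s' (\<tau>' + (1 + cost (Read 3 (Const 1))))" by (intro Q) simp_all
  next
    show "\<tau>' \<le> \<tau> + 600 * k * card P + 200 * k * (n * n)" using \<tau>' np by linarith
  }
qed

text \<open>Without remaining edges, the last clause of \<open>labelled\<close> applies to every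
  edge and is exactly the closure that \<open>labels_complete\<close> asks for.\<close>

lemma ready_solution:
  assumes G: "ugraph n E" and A: "ready E w {} R D s"
  shows "apnp_solution n E w s"
  unfolding apnp_solution_def
proof (intro allI impI)
  fix u v assume uv: "u < n" "v < n"
  have lab: "labelled n E w {} R D" and rep: "represents0 s R D" using A unfolding ready_def by blast+
  have out: "mem s 1 (u * n + v) = of_bool (u \<in> R v)" "u \<in> R v \<Longrightarrow> wmem s 1 (u * n + v) = D u v"
    using rep uv by (auto simp: represents0_def represents_def)
  have sound: "u \<in> R v \<Longrightarrow> D u v \<in> nd_path_weights E w u v"
    using lab uv unfolding labelled_def by blast
  have complete: "u \<in> R v \<and> D u v \<le> x" if "x \<in> nd_path_weights E w u v" for x
  proof (rule labels_complete[OF G _ _ that])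
    show "y \<in> R y \<and> D y y \<le> w {y, z}" if "{y, z} \<in> E" for y z
      using lab that unfolding labelled_def by blast
    show "a \<in> R z \<and> D a z \<le> w {y, z}" if "{y, z} \<in> E" "a \<in> R y" "D a y \<le> w {y, z}" for y z a
      using lab that unfolding labelled_def by blast
  qed
  show "if nd_path_weights E w u v = {} then mem s 1 (u * n + v) = 0
    else mem s 1 (u * n + v) = 1 \<and> wmem s 1 (u * n + v) \<in> nd_path_weights E w u v \<and>
      (\<forall>x\<in>nd_path_weights E w u v. wmem s 1 (u * n + v) \<le> x)"
    using out sound complete by (cases "nd_path_weights E w u v = {}") auto
qed

section \<open>Initialisation\<close>

definition find_L :: com where
  "find_L = Seq (Assign 1 (Const 1))
     (Seq (While (Op Less (Reg 1) (Op Add (Reg 0) (Const 2))) (Assign 1 (dbl (Reg 1))))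
       (Seq (Assign 2 (Op Mul (Reg 1) (Reg 1))) (Assign 3 (Op Mul (Reg 2) (Reg 1)))))"

definition load :: com where
  "load = While (Op Less (Reg 5) (Op Mul (Reg 0) (Reg 0)))
     (Seq (com.If (Read 0 (Reg 5))
        (Seq (Assign 6 (Op Add (Op Add (Reg 2) (Op Mul (Op Div (Reg 5) (Reg 0)) (Reg 1))) (Op Mod (Reg 5) (Reg 0))))
          (Seq (Write 3 (Reg 6) (Reg 6)) (WCopy 2 (Reg 6) 0 (Reg 5))))
        Skip) (inc 5))"

definition build :: com where
  "build = Seq (Assign 5 (Reg 2)) (While (Op Less (Const 1) (Reg 5)) (Seq (Assign 5 (Op Sub (Reg 5) (Const 1))) play))"

definition apnp :: com where
  "apnp = Seq find_L (Seq load (Seq build main))"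

text \<open>With the hypothesis on \<open>k\<close>, \<open>L\<close> is the least power of two
  above \<open>n + 1\<close>, so doubling stops exactly there. The same hypothesis later bounds
  \<open>L\<close> by \<open>2 * (n + 1)\<close>.\<close>

lemma wp_find_L:
  assumes s: "reg s 0 = n" and k: "2 ^ (k - 1) \<le> Suc n"
    and Q: "\<And>\<tau>'. \<tau>' \<le> \<tau> + 20 * k + 30 \<Longrightarrow> Q (s\<lparr>reg := (reg s)(1 := L, 2 := L * L, 3 := L ^ 3)\<rparr>) \<tau>'"
  shows "wp b \<rho> find_L Q s \<tau>"
proof -
  define rest where "rest = Seq (Assign 2 (Op Mul (Reg 1) (Reg 1))) (Assign 3 (Op Mul (Reg 2) (Reg 1)))"
  have n2: "Suc (Suc n) < 2 ^ b" using n_less L_ge by (intro less_word1) simp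
  have fin: "wp b \<rho> rest Q (s\<lparr>reg := (reg s)(1 := L)\<rparr>) \<tau>'" if "\<tau>' \<le> \<tau> + 10 * k + 10" for \<tau>'
  proof -
    have LL: "L * L < 2 ^ b" "L * (L * L) < 2 ^ b"
      using less_word3[of "L * L"] less_word3[of "L * (L * L)"] L_le by (simp_all add: power3_eq_cube)
    have q: "Q (s\<lparr>reg := (reg s)(1 := L, 2 := L * L, 3 := L * (L * L))\<rparr>) t" if "t = \<tau>' + 8" for t
      using Q[of t] that \<open>\<tau>' \<le> \<tau> + 10 * k + 10\<close> by (simp add: power3_eq_cube mult.assoc)
    show ?thesis
      unfolding rest_def wp_simps using LL by (simp add: mult.assoc) (rule q[simplified], simp)
  qed
  define s1 where "s1 = s\<lparr>reg := (reg s)(1 := 1)\<rparr>"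
  have w: "wp b \<rho> (While (Op Less (Reg 1) (Op Add (Reg 0) (Const 2))) (Assign 1 (dbl (Reg 1)))) (wp b \<rho> rest Q) s1 (\<tau> + 2)"
  proof (rule wp_While[where B = "\<tau> + 2 + 10 * k" and
      I = "\<lambda>s' \<tau>'. \<exists>i. s' = s\<lparr>reg := (reg s)(1 := 2 ^ i)\<rparr> \<and> i \<le> k \<and> \<tau>' \<le> \<tau> + 2 + 10 * i"])
    show "\<exists>i. s1 = s\<lparr>reg := (reg s)(1 := 2 ^ i)\<rparr> \<and> i \<le> k \<and> \<tau> + 2 \<le> \<tau> + 2 + 10 * i"
      by (rule exI[of _ 0]) (simp add: s1_def)
  next
    fix s' \<tau>'
    assume "\<exists>i. s' = s\<lparr>reg := (reg s)(1 := 2 ^ i)\<rparr> \<and> i \<le> k \<and> \<tau>' \<le> \<tau> + 2 + 10 * i" (is "\<exists>i. ?I s' \<tau>' i")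
    then obtain i where s': "s' = s\<lparr>reg := (reg s)(1 := 2 ^ i)\<rparr>" and i: "i \<le> k" "\<tau>' \<le> \<tau> + 2 + 10 * i" by blast
    have c: "eval b s' (Op Less (Reg 1) (Op Add (Reg 0) (Const 2))) \<noteq> 0 \<longleftrightarrow> 2 ^ i < n + 2"
      using s n2 by (simp add: s')
    {
      assume "eval b s' (Op Less (Reg 1) (Op Add (Reg 0) (Const 2))) \<noteq> 0"
      then have lt: "2 ^ i < n + 2" using c by simp
      have "i \<noteq> k" using lt n_less L_def by auto
      then have ik: "Suc i \<le> k" using i by simp
      have "(2 :: nat) ^ i \<le> L" using lt n_less by simp
      then have "2 * 2 ^ i + 1 < (2 :: nat) ^ b" using L_ge L_le by (intro less_word2) linarith
      then have "eval b s' (dbl (Reg 1)) = 2 ^ Suc i" using eval_dbl(1)[of s' "Reg 1"] by (simp add: s')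
      then have "s'\<lparr>reg := (reg s')(1 := eval b s' (dbl (Reg 1)))\<rparr> = s\<lparr>reg := (reg s)(1 := 2 ^ Suc i)\<rparr>"
        by (simp add: s')
      then show "wp b \<rho> (Assign 1 (dbl (Reg 1))) (\<lambda>s' \<tau>'. \<exists>i. ?I s' \<tau>' i) s'
        (\<tau>' + (1 + cost (Op Less (Reg 1) (Op Add (Reg 0) (Const 2)))))"
        unfolding wp_Assign using ik i by (intro exI[of _ "Suc i"]) auto
    next
      assume "eval b s' (Op Less (Reg 1) (Op Add (Reg 0) (Const 2))) = 0"
      then have ge: "n + 2 \<le> 2 ^ i" using c by simp
      have "k - 1 < i"
      proof (rule ccontr)
        assume "\<not> k - 1 < i"
        then have "(2 :: nat) ^ i \<le> 2 ^ (k - 1)" by (intro power_increasing) auto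
        then show False using ge k by linarith
      qed
      then have "i = k" using i by simp
      show "wp b \<rho> rest Q s' (\<tau>' + (1 + cost (Op Less (Reg 1) (Op Add (Reg 0) (Const 2)))))"
        unfolding s' \<open>i = k\<close> L_def[symmetric] by (rule fin) (use i \<open>i = k\<close> in simp)
    next
      show "\<tau>' \<le> \<tau> + 2 + 10 * k" using i by simp
    }
  qed
  show ?thesis
    unfolding find_L_def rest_def[symmetric] wp_Seq[of _ _ "Assign 1 _"] wp_Seq[of _ _ "While _ _"] wp_Assign
    by (rule wp_cong[OF w]) (simp_all add: s1_def)
qed

text \<open>The edges among the first \<open>j\<close> cells of the input matrix; an undirected edge
  is met once in each direction.\<close>

definition edges_below :: "nat set set \<Rightarrow> nat \<Rightarrow> (nat \<times> nat) set" where
  "edges_below E j = {(u, v). u < n \<and> v < n \<and> {u, v} \<in> E \<and> u * n + v < j}"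

lemma edges_below_Suc:
  assumes "j < n * n"
  shows "edges_below E (Suc j) = (if {j div n, j mod n} \<in> E then insert (j div n, j mod n) (edges_below E j) else edges_below E j)"
    and "(j div n, j mod n) \<notin> edges_below E j" "j div n < n" "j mod n < n"
proof -
  have n0: "0 < n" using assms by (cases n) auto
  show jn: "j div n < n" "j mod n < n" using assms n0 by (simp_all add: div_less_iff_less_mult)
  have "u * n + v = j \<longleftrightarrow> u = j div n \<and> v = j mod n" if "v < n" for u v
    using row_index_inj[OF that jn(2), of u "j div n"] by simp
  then show "edges_below E (Suc j) = (if {j div n, j mod n} \<in> E then insert (j div n, j mod n) (edges_below E j) else edges_below E j)"
    using jn unfolding edges_below_def less_Suc_eq by auto
  show "(j div n, j mod n) \<notin> edges_below E j" by (simp add: edges_below_def)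
qed

lemma wp_load:
  assumes st: "static s" and s: "reg s 5 = 0" "mem s 3 = (\<lambda>_. 0)"
    and m0: "\<And>i. i < n * n \<Longrightarrow> mem s 0 i = of_bool ({i div n, i mod n} \<in> E)"
    and w0: "\<And>i. i < n * n \<Longrightarrow> {i div n, i mod n} \<in> E \<Longrightarrow> wmem s 0 i = w {i div n, i mod n}"
    and Q: "\<And>s' \<tau>'. frame {5, 6} {3} {2} s s' \<Longrightarrow>
      mem s' 3 = (\<lambda>a. if a \<in> leaf ` edges_below E (n * n) then a else 0) \<Longrightarrow>
      (\<And>u v. (u, v) \<in> edges_below E (n * n) \<Longrightarrow> wmem s' 2 (leaf (u, v)) = w {u, v}) \<Longrightarrow>
      \<tau>' \<le> \<tau> + 40 * (n * n) + 6 \<Longrightarrow> Q s' \<tau>'"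
  shows "wp b \<rho> load Q s \<tau>"
  unfolding load_def
proof (rule wp_While[where B = "\<tau> + 40 * (n * n)" and I = "\<lambda>s' \<tau>'.
    frame {5, 6} {3} {2} s s' \<and> reg s' 5 \<le> n * n \<and>
    mem s' 3 = (\<lambda>a. if a \<in> leaf ` edges_below E (reg s' 5) then a else 0) \<and>
    (\<forall>u v. (u, v) \<in> edges_below E (reg s' 5) \<longrightarrow> wmem s' 2 (leaf (u, v)) = w {u, v}) \<and>
    \<tau>' \<le> \<tau> + 40 * reg s' 5"])
  show "frame {5, 6} {3} {2} s s \<and> reg s 5 \<le> n * n \<and>
    mem s 3 = (\<lambda>a. if a \<in> leaf ` edges_below E (reg s 5) then a else 0) \<and>
    (\<forall>u v. (u, v) \<in> edges_below E (reg s 5) \<longrightarrow> wmem s 2 (leaf (u, v)) = w {u, v}) \<and>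
    \<tau> \<le> \<tau> + 40 * reg s 5"
    using s by (simp add: edges_below_def)
next
  fix s' \<tau>'
  let ?I = "\<lambda>s' \<tau>'. frame {5, 6} {3} {2} s s' \<and> reg s' 5 \<le> n * n \<and>
    mem s' 3 = (\<lambda>a. if a \<in> leaf ` edges_below E (reg s' 5) then a else 0) \<and>
    (\<forall>u v. (u, v) \<in> edges_below E (reg s' 5) \<longrightarrow> wmem s' 2 (leaf (u, v)) = w {u, v}) \<and>
    \<tau>' \<le> \<tau> + 40 * reg s' 5"
  assume I: "?I s' \<tau>'"
  define j where "j = reg s' 5"
  have fr: "frame {5, 6} {3} {2} s s'" and jn: "j \<le> n * n"
    and t: "mem s' 3 = (\<lambda>a. if a \<in> leaf ` edges_below E j then a else 0)"
    and wt: "\<And>u v. (u, v) \<in> edges_below E j \<Longrightarrow> wmem s' 2 (leaf (u, v)) = w {u, v}"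
    and \<tau>': "\<tau>' \<le> \<tau> + 40 * j"
    using I unfolding j_def by blast+
  have rs: "reg s' 0 = n" "reg s' 1 = L" "reg s' 2 = L * L" "mem s' 0 = mem s 0" "wmem s' 0 = wmem s 0" "reg s' 5 = j"
    using st fr by (auto simp: frame_def static_def j_def)
  have nn: "n * n < L * L" using n_less by (intro mult_strict_mono) auto
  have nnb: "n * n < 2 ^ b" using nn by (intro less_word2) simp
  have cond: "eval b s' (Op Less (Reg 5) (Op Mul (Reg 0) (Reg 0))) \<noteq> 0 \<longleftrightarrow> j < n * n"
    using rs nnb by simp
  {
    assume "eval b s' (Op Less (Reg 5) (Op Mul (Reg 0) (Reg 0))) \<noteq> 0"
    then have j: "j < n * n" using cond by simp
    define u v where "u = j div n" and "v = j mod n"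
    note eb = edges_below_Suc(1)[OF j, of E, folded u_def v_def]
      and uv = edges_below_Suc(3,4)[OF j, folded u_def v_def]
    have sj: "Suc j < 2 ^ b" using j nn by (intro less_word2) simp
    have m: "mem s' 0 j = of_bool ({u, v} \<in> E)" using m0[OF j] rs by (simp add: u_def v_def)
    have inc: "wp b \<rho> (inc 5) ?I s3 \<tau>3"
      if "frame {5, 6} {3} {2} s s3" "reg s3 5 = j" "\<tau>3 \<le> \<tau>' + 30"
        "mem s3 3 = (\<lambda>a. if a \<in> leaf ` edges_below E (Suc j) then a else 0)"
        "\<And>u v. (u, v) \<in> edges_below E (Suc j) \<Longrightarrow> wmem s3 2 (leaf (u, v)) = w {u, v}" for s3 \<tau>3
    proof -
      have I3: "?I (s3\<lparr>reg := (reg s3)(5 := Suc j)\<rparr>) (\<tau>3 + 4)"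
        using that j \<tau>' by (simp add: frame_def)
      have "Suc (reg s3 5) < 2 ^ b" using that(2) sj by simp
      from wp_inc[OF this] show ?thesis unfolding that(2) using I3 by blast
    qed
    show "wp b \<rho> (Seq (com.If (Read 0 (Reg 5))
        (Seq (Assign 6 (Op Add (Op Add (Reg 2) (Op Mul (Op Div (Reg 5) (Reg 0)) (Reg 1))) (Op Mod (Reg 5) (Reg 0))))
          (Seq (Write 3 (Reg 6) (Reg 6)) (WCopy 2 (Reg 6) 0 (Reg 5))))
        Skip) (inc 5)) ?I s' (\<tau>' + (1 + cost (Op Less (Reg 5) (Op Mul (Reg 0) (Reg 0)))))"
    proof (cases "{u, v} \<in> E")
      case True
      define a where "a = leaf (u, v)"
      have ab: "a < 2 ^ b" using leaf_range(2)[OF uv] by (intro less_word2) (simp add: a_def)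
      have "u * L \<le> a" "L * L + u * L \<le> a" by (simp_all add: a_def leaf_def)
      then have "u * L < 2 ^ b" "L * L + u * L < 2 ^ b" using ab by linarith+
      then have e: "eval b s' (Op Add (Op Add (Reg 2) (Op Mul (Op Div (Reg 5) (Reg 0)) (Reg 1))) (Op Mod (Reg 5) (Reg 0))) = a"
        using rs ab by (simp add: a_def leaf_def u_def v_def)
      define s3 where "s3 = s'\<lparr>reg := (reg s')(6 := a), mem := (mem s')(3 := (mem s' 3)(a := a)),
        wmem := (wmem s')(2 := (wmem s' 2)(a := wmem s 0 j))\<rparr>"
      have "wp b \<rho> (inc 5) ?I s3 (\<tau>' + 27)"
      proof (rule inc)
        show "frame {5, 6} {3} {2} s s3" using fr by (simp add: frame_def s3_def)
        show "reg s3 5 = j" using rs by (simp add: s3_def)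
        show "mem s3 3 = (\<lambda>a. if a \<in> leaf ` edges_below E (Suc j) then a else 0)"
          using eb True t by (auto simp: s3_def a_def fun_eq_iff)
        show "wmem s3 2 (leaf (u', v')) = w {u', v'}" if "(u', v') \<in> edges_below E (Suc j)" for u' v'
        proof (cases "(u', v') = (u, v)")
          case True
          then show ?thesis using w0[OF j] \<open>{u, v} \<in> E\<close> by (simp add: s3_def a_def u_def v_def)
        next
          case False
          then have old: "(u', v') \<in> edges_below E j" using that eb True by auto
          then have "leaf (u', v') \<noteq> a"
            using inj_onD[OF leaf_inj, of "(u', v')" "(u, v)"] False uv
            by (auto simp: a_def edges_below_def)
          then show ?thesis using wt[OF old] by (simp add: s3_def)
        qed
      qed simp
      note w3 = this
      have ev: "eval b s' (Read 0 (Reg 5)) \<noteq> 0" using rs m True by simp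
      show ?thesis
        unfolding wp_Seq wp_If if_P[OF ev] wp_Assign wp_Write wp_WCopy e
        by (rule wp_cong[OF w3]) (simp_all add: s3_def rs)
    next
      case False
      have "wp b \<rho> (inc 5) ?I s' (\<tau>' + 10)"
        by (rule inc) (use fr rs t wt eb False in simp_all)
      note w3 = this
      have ev: "\<not> eval b s' (Read 0 (Reg 5)) \<noteq> 0" using rs m False by simp
      show ?thesis
        unfolding wp_Seq wp_If if_not_P[OF ev] wp_Skip by (rule wp_cong[OF w3]) simp_all
    qed
  next
    assume "eval b s' (Op Less (Reg 5) (Op Mul (Reg 0) (Reg 0))) = 0"
    then have "j = n * n" using cond jn by simp
    then show "Q s' (\<tau>' + (1 + cost (Op Less (Reg 5) (Op Mul (Reg 0) (Reg 0)))))"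
      using t wt \<tau>' by (intro Q[OF fr]) auto
  next
    show "\<tau>' \<le> \<tau> + 40 * (n * n)" using \<tau>' jn by simp
  }
qed

lemma wp_build:
  assumes st: "static s" and A: "A \<subseteq> {L * L..<2 * (L * L)}"
    and t: "mem s 3 = (\<lambda>a. if a \<in> A then a else 0)"
    and Q: "\<And>s' \<tau>'. frame {5} {3} {} s s' \<Longrightarrow> tournament (L * L) (wmem s 2) (mem s' 3) A \<Longrightarrow>
      \<tau>' \<le> \<tau> + 60 * (L * L) + 6 \<Longrightarrow> Q s' \<tau>'"
  shows "wp b \<rho> build Q s \<tau>"
proof -
  have LL: "1 \<le> L * L" using L_ge by simp
  define s1 where "s1 = s\<lparr>reg := (reg s)(5 := L * L)\<rparr>"
  let ?I = "\<lambda>s' \<tau>'. frame {5} {3} {} s s' \<and> 1 \<le> reg s' 5 \<and> reg s' 5 \<le> L * L \<and>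
      (\<forall>a\<ge>L * L. mem s' 3 a = mem s 3 a) \<and>
      (\<forall>i. reg s' 5 \<le> i \<longrightarrow> i < L * L \<longrightarrow> mem s' 3 i = best (wmem s 2) (mem s' 3 (2 * i)) (mem s' 3 (2 * i + 1))) \<and>
      \<tau>' + 60 * reg s' 5 \<le> \<tau> + 2 + 60 * (L * L)"
  have w: "wp b \<rho> (While (Op Less (Const 1) (Reg 5)) (Seq (Assign 5 (Op Sub (Reg 5) (Const 1))) play)) Q s1 (\<tau> + 2)"
  proof (rule wp_While[where B = "\<tau> + 2 + 60 * (L * L)" and I = ?I])
    show "?I s1 (\<tau> + 2)" using LL by (simp add: s1_def frame_def)
  next
    fix s' \<tau>'
    assume I: "?I s' \<tau>'"
    have wm: "wmem s' 2 = wmem s 2" using I by (simp add: frame_def)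
    {
      assume "eval b s' (Op Less (Const 1) (Reg 5)) \<noteq> 0"
      then have gt: "1 < reg s' 5" by (simp split: if_splits)
      define h where "h = reg s' 5 - 1"
      have h: "1 \<le> h" "h < L * L" "reg s' 5 = Suc h" using gt I by (auto simp: h_def)
      define s2 where "s2 = s'\<lparr>reg := (reg s')(5 := h)\<rparr>"
      have sub: "eval b s' (Op Sub (Reg 5) (Const 1)) = h"
      proof -
        have "Suc h < 2 ^ b" using h by (intro less_word2) simp
        then show ?thesis using sub_word[of 1 "Suc h" "2 ^ b"] h by simp
      qed
      have w: "wp b \<rho> play ?I s2 (\<tau>' + 8)"
      proof (rule wp_play[where i = h])
        show "reg s2 5 = h" by (simp add: s2_def)
        show "2 * h + 1 < 2 ^ b" using h by (intro less_word2) simp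
        fix \<tau>2 assume \<tau>2: "\<tau>2 \<le> \<tau>' + 8 + 40"
        define t2 where "t2 = (mem s' 3)(h := best (wmem s 2) (mem s' 3 (2 * h)) (mem s' 3 (2 * h + 1)))"
        define s3 where "s3 = s2\<lparr>mem := (mem s2)(3 := t2)\<rparr>"
        have I3: "?I s3 \<tau>2"
        proof (intro conjI allI impI)
          show "frame {5} {3} {} s s3" using I by (simp add: frame_def s3_def s2_def)
          show "1 \<le> reg s3 5" "reg s3 5 \<le> L * L" using h by (simp_all add: s3_def s2_def)
          show "mem s3 3 a = mem s 3 a" if "L * L \<le> a" for a
            using I h that by (simp add: s3_def t2_def)
          show "\<tau>2 + 60 * reg s3 5 \<le> \<tau> + 2 + 60 * (L * L)" using I \<tau>2 h by (simp add: s3_def s2_def)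
          fix i assume i: "reg s3 5 \<le> i" "i < L * L"
          then have hi: "h \<le> i" by (simp add: s3_def s2_def)
          \<comment> \<open>The nodes are computed from the last inner one down to the root, so the
            children of a finished node have larger indices than \<open>h\<close> and are not
            overwritten.\<close>
          have ne: "2 * i \<noteq> h" "2 * i + 1 \<noteq> h" using hi h by auto
          have "t2 i = best (wmem s 2) (t2 (2 * i)) (t2 (2 * i + 1))"
          proof (cases "i = h")
            case True
            then show ?thesis using ne by (simp add: t2_def)
          next
            case False
            then have "reg s' 5 \<le> i" using hi h by simp
            then have "mem s' 3 i = best (wmem s 2) (mem s' 3 (2 * i)) (mem s' 3 (2 * i + 1))"
              using I i(2) by blast
            then show ?thesis using ne False by (simp add: t2_def)
          qed
          then show "mem s3 3 i = best (wmem s 2) (mem s3 3 (2 * i)) (mem s3 3 (2 * i + 1))"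
            by (simp add: s3_def)
        qed
        have eq: "s2\<lparr>mem := (mem s2)(3 := (mem s2 3)(h := best (wmem s2 2) (mem s2 3 (2 * h)) (mem s2 3 (2 * h + 1))))\<rparr> = s3"
          using wm by (simp add: s3_def s2_def t2_def)
        show "?I (s2\<lparr>mem := (mem s2)(3 := (mem s2 3)(h := best (wmem s2 2) (mem s2 3 (2 * h)) (mem s2 3 (2 * h + 1))))\<rparr>) \<tau>2"
          unfolding eq by (rule I3)
      qed
      show "wp b \<rho> (Seq (Assign 5 (Op Sub (Reg 5) (Const 1))) play) ?I s' (\<tau>' + (1 + cost (Op Less (Const 1) (Reg 5))))"
        unfolding wp_Seq wp_Assign sub by (rule wp_cong[OF w]) (simp_all add: s2_def)
    next
      assume "eval b s' (Op Less (Const 1) (Reg 5)) = 0"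
      then have 1: "reg s' 5 = 1" using I by (simp split: if_splits)
      have "tournament (L * L) (wmem s 2) (mem s' 3) A"
        unfolding tournament_def
      proof (intro conjI ballI)
        show "mem s' 3 j = (if j \<in> A then j else 0)" if "j \<in> {L * L..<2 * (L * L)}" for j
          using I t that by simp
        show "mem s' 3 i = best (wmem s 2) (mem s' 3 (2 * i)) (mem s' 3 (2 * i + 1))" if "i \<in> {1..<L * L}" for i
        proof -
          have "reg s' 5 \<le> i" "i < L * L" using 1 that by auto
          then show ?thesis using I by blast
        qed
      qed (fact A)
      then show "Q s' (\<tau>' + (1 + cost (Op Less (Const 1) (Reg 5))))"
        using I 1 by (intro Q) auto
    next
      show "\<tau>' \<le> \<tau> + 2 + 60 * (L * L)" using I by linarith
    }
  qed
  show ?thesis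
    unfolding build_def wp_Seq[of _ _ "Assign 5 (Reg 2)"] wp_Assign
    by (rule wp_cong[OF w]) (use st in \<open>simp_all add: s1_def static_def\<close>)
qed

lemma wp_apnp:
  assumes G: "ugraph n E" and k: "2 ^ (k - 1) \<le> Suc n"
  shows "wp b \<rho> apnp (\<lambda>s \<tau>. apnp_solution n E w s \<and> \<tau> \<le> 1000 * (L * L * k)) (input n E w) 0"
proof -
  define s0 where "s0 = input n E w"
  define s1 where "s1 = s0\<lparr>reg := (reg s0)(1 := L, 2 := L * L, 3 := L ^ 3)\<rparr>"
  define P where "P = edges_below E (n * n)"
  have Pn: "P \<subseteq> {..<n} \<times> {..<n}" by (auto simp: P_def edges_below_def)
  have PE: "(u, v) \<in> P \<longleftrightarrow> {u, v} \<in> E" for u v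
  proof
    assume e: "{u, v} \<in> E"
    then have uv: "u < n" "v < n" using G by (auto simp: ugraph_def)
    then show "(u, v) \<in> P" using row_index_less[of v n u n] e by (simp add: P_def edges_below_def)
  qed (simp add: P_def edges_below_def)
  have st1: "static s1" by (simp add: static_def s1_def s0_def input_def)
  have "wp b \<rho> (Seq find_L (Seq load (Seq build main))) (\<lambda>s \<tau>. apnp_solution n E w s \<and> \<tau> \<le> 1000 * (L * L * k)) s0 0"
    unfolding wp_Seq
  proof (rule wp_find_L[OF _ k], fold s1_def)
    show "reg s0 0 = n" by (simp add: s0_def input_def)
    fix \<tau>1 assume \<tau>1: "\<tau>1 \<le> 0 + 20 * k + 30"
    show "wp b \<rho> load (wp b \<rho> build (wp b \<rho> main (\<lambda>s \<tau>. apnp_solution n E w s \<and> \<tau> \<le> 1000 * (L * L * k)))) s1 \<tau>1"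
    proof (rule wp_load[OF st1, where E = E and w = w], fold P_def)
      show "reg s1 5 = 0" "mem s1 3 = (\<lambda>_. 0)" by (simp_all add: s1_def s0_def input_def)
      show "mem s1 0 i = of_bool ({i div n, i mod n} \<in> E)" if "i < n * n" for i
        using that by (simp add: s1_def s0_def input_def)
      show "wmem s1 0 i = w {i div n, i mod n}" if "i < n * n" "{i div n, i mod n} \<in> E" for i
        using that by (simp add: s1_def s0_def input_def)
      fix s2 \<tau>2
      assume fr2: "frame {5, 6} {3} {2} s1 s2" and t2: "mem s2 3 = (\<lambda>a. if a \<in> leaf ` P then a else 0)"
        and w2: "\<And>u v. (u, v) \<in> P \<Longrightarrow> wmem s2 2 (leaf (u, v)) = w {u, v}"
        and \<tau>2: "\<tau>2 \<le> \<tau>1 + 40 * (n * n) + 6"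
      have st2: "static s2" using st1 fr2 by (simp add: static_def frame_def)
      show "wp b \<rho> build (wp b \<rho> main (\<lambda>s \<tau>. apnp_solution n E w s \<and> \<tau> \<le> 1000 * (L * L * k))) s2 \<tau>2"
      proof (rule wp_build[OF st2 _ t2])
        show "leaf ` P \<subseteq> {L * L..<2 * (L * L)}" using Pn leaf_range by auto
        fix s3 \<tau>3
        assume fr3: "frame {5} {3} {} s2 s3" and T3: "tournament (L * L) (wmem s2 2) (mem s3 3) (leaf ` P)"
          and \<tau>3: "\<tau>3 \<le> \<tau>2 + 60 * (L * L) + 6"
        have fr: "frame {5, 6} {3} {2} s1 s3" by (rule frame_trans[OF fr2 fr3]) auto
        have s3: "mem s3 1 = (\<lambda>_. 0)" "mem s3 2 = (\<lambda>_. 0)" "mem s3 5 = (\<lambda>_. 0)" "mem s3 6 = (\<lambda>_. 0)" "reg s3 4 = 0"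
          "wmem s3 2 = wmem s2 2" "static s3"
          using frameD(2)[OF fr, of 1] frameD(2)[OF fr, of 2] frameD(2)[OF fr, of 5] frameD(2)[OF fr, of 6]
            frameD(1)[OF fr, of 4] frameD(3)[OF fr3, of 2] st2 frameD(1)[OF fr3]
          by (simp_all add: s1_def s0_def input_def static_def)
        \<comment> \<open>Zero memory is a forest of empty trees with an empty table, so the table,
          which is far larger than the time bound, costs nothing to set up.\<close>
        have rep: "represents0 s3 (\<lambda>_. {}) (\<lambda>_ _. 0)"
          using s3 by (simp add: represents0_def represents_def forest_def rd_def npairs_def)
        have lab: "labelled n E w P (\<lambda>_. {}) (\<lambda>_ _. 0)"
          unfolding labelled_def by (auto simp: PE insert_commute)
        have "ready E w P (\<lambda>_. {}) (\<lambda>_ _. 0) s3"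
          using rep lab Pn T3 s3 w2 by (simp add: ready_def)
        then show "wp b \<rho> main (\<lambda>s \<tau>. apnp_solution n E w s \<and> \<tau> \<le> 1000 * (L * L * k)) s3 \<tau>3"
        proof (rule wp_main[OF G])
          fix s4 \<tau>4 R D
          assume 4: "ready E w {} R D s4" "\<tau>4 \<le> \<tau>3 + 600 * k * card P + 200 * k * (n * n) + 3"
          have nL: "n * n \<le> L * L" using n_less by (intro mult_mono) auto
          have "card P \<le> n * n" using card_mono[OF _ Pn] by (simp add: card_cartesian_product)
          then have "600 * k * card P + 200 * k * (n * n) \<le> 600 * k * (L * L) + 200 * k * (L * L)"
            using nL by (intro add_mono mult_left_mono) auto
          also have "\<dots> = 800 * (L * L * k)" by simp
          finally have 5: "600 * k * card P + 200 * k * (n * n) \<le> 800 * (L * L * k)" .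
          have 6: "L * L \<le> L * L * k" using k_pos by simp
          have "4 * k \<le> L * L * k" using mult_mono[OF L_ge L_ge] by (intro mult_right_mono) auto
          \<comment> \<open>The main loop contributes \<open>800\<close>, loading and building at
            most \<open>100\<close>; the terms linear in \<open>k\<close> and the constants fit into
            the rest because \<open>4 * k \<le> L * L * k\<close>.\<close>
          then have "\<tau>4 \<le> 1000 * (L * L * k)"
            using 4(2) \<tau>1 \<tau>2 \<tau>3 5 6 nL k_pos by linarith
          then show "apnp_solution n E w s4 \<and> \<tau>4 \<le> 1000 * (L * L * k)"
            using ready_solution[OF G 4(1)] by blast
        qed
      qed
    qed
  qed
  then show ?thesis by (simp add: apnp_def s0_def)
qed

end

theorem theoremA1:
  shows "\<forall>k::nat. \<exists>(P::com) (c::nat) (T::nat \<Rightarrow> nat).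
    2 \<le> c \<and>
    (\<lambda>n. real (T n)) \<in> O(\<lambda>n. real n ^ 2 * ln (real n)) \<and>
    (\<forall>(n::nat) (E::nat set set) (w::nat set \<Rightarrow> real). ugraph n E \<longrightarrow>
      (\<forall>\<rho> \<in> set_pmf (random_tape (word_size c n) (T n)).
         \<exists>t s. exec (word_size c n) \<rho> P (input n E w) t s \<and> t \<le> T n) \<and>
      measure_pmf.prob (random_tape (word_size c n) (T n))
        {\<rho>. \<exists>t s. exec (word_size c n) \<rho> P (input n E w) t s \<and> apnp_solution n E w s}
        \<ge> 1 - 1 / real n ^ k)"
proof
  fix k :: nat
  \<comment> \<open>The factor in \<open>word_size\<close>, so that \<open>word_size 8 n\<close> is
    the word size \<open>8 * k\<close> of the locale with \<open>k = bits n\<close>.\<close>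
  define bits where "bits n = floorlog 2 (Suc n)" for n :: nat
  define T where "T n = 1000 * (2 ^ bits n * 2 ^ bits n * bits n)" for n
  \<comment> \<open>The tape is arbitrary here, so termination, correctness and the time bound hold
    on every tape at once.\<close>
  have run: "\<exists>t s. exec (word_size 8 n) \<rho> machine.apnp (input n E w) t s \<and> apnp_solution n E w s \<and> t \<le> T n"
    if "ugraph n E" for n E w \<rho>
  proof -
    have "2 ^ (bits n - 1) \<le> Suc n" "Suc n < 2 ^ bits n"
      using floorlog_bounds[of "Suc n" 2] by (auto simp: bits_def)
    then interpret machine n "bits n" "2 ^ bits n" "word_size 8 n" \<rho>
      by unfold_locales (simp_all add: word_size_def bits_def)
    show ?thesis
      using wp_apnp[OF that \<open>2 ^ (bits n - 1) \<le> Suc n\<close>] unfolding wp_def T_def by auto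
  qed
  have bound: "real (T n) \<le> 4000 * (real n + 1)\<^sup>2 * (log 2 (real n + 1) + 1)" for n
  proof -
    have b1: "1 \<le> bits n" by (simp add: bits_def floorlog_def)
    have "2 ^ (bits n - 1) \<le> Suc n" using floorlog_bounds[of "Suc n" 2] by (auto simp: bits_def)
    then have "real (2 ^ (bits n - 1)) \<le> real (Suc n)" by (simp only: of_nat_le_iff)
    then have p: "(2 :: real) ^ (bits n - 1) \<le> real n + 1" by simp
    \<comment> \<open>Since \<open>2 ^ (bits n - 1)\<close> is at most \<open>n + 1\<close>,
      rounding up to a power of two at most doubles \<open>n + 1\<close>; squaring gives the factor
      \<open>4\<close> in \<open>4000\<close>.\<close>
    have e: "(2 :: real) ^ bits n = 2 * 2 ^ (bits n - 1)" using b1 by (cases "bits n") auto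
    have "real (bits n - 1) \<le> log 2 (real n + 1)"
      using p by (simp add: le_log_iff powr_realpow)
    then have l: "real (bits n) \<le> log 2 (real n + 1) + 1" using b1 by simp
    have "real (T n) = 1000 * ((2 ^ bits n)\<^sup>2 * real (bits n))" by (simp add: T_def power2_eq_square)
    also have "\<dots> \<le> 1000 * ((2 * (real n + 1))\<^sup>2 * (log 2 (real n + 1) + 1))"
      using p e l by (intro mult_left_mono mult_mono power_mono) auto
    also have "(2 * (real n + 1))\<^sup>2 = 4 * (real n + 1)\<^sup>2" by (simp only: power_mult_distrib) simp
    finally show ?thesis by (simp add: mult.assoc)
  qed
  have "(\<lambda>n. real (T n)) \<in> O(\<lambda>n. 4000 * (real n + 1)\<^sup>2 * (log 2 (real n + 1) + 1))"
    using bound by (intro landau_o.big_mono always_eventually allI) (smt (verit) of_nat_0_le_iff real_norm_def)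
  also have "(\<lambda>n. 4000 * (real n + 1)\<^sup>2 * (log 2 (real n + 1) + 1)) \<in> O(\<lambda>n::nat. real n ^ 2 * ln (real n))"
    by real_asymp
  finally have T: "(\<lambda>n. real (T n)) \<in> O(\<lambda>n. real n ^ 2 * ln (real n))" .
  show "\<exists>(P::com) (c::nat) (T::nat \<Rightarrow> nat).
    2 \<le> c \<and>
    (\<lambda>n. real (T n)) \<in> O(\<lambda>n. real n ^ 2 * ln (real n)) \<and>
    (\<forall>(n::nat) (E::nat set set) (w::nat set \<Rightarrow> real). ugraph n E \<longrightarrow>
      (\<forall>\<rho> \<in> set_pmf (random_tape (word_size c n) (T n)).
         \<exists>t s. exec (word_size c n) \<rho> P (input n E w) t s \<and> t \<le> T n) \<and>
      measure_pmf.prob (random_tape (word_size c n) (T n))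
        {\<rho>. \<exists>t s. exec (word_size c n) \<rho> P (input n E w) t s \<and> apnp_solution n E w s}
        \<ge> 1 - 1 / real n ^ k)"
  \<comment> \<open>The program text mentions no locale parameter, so \<open>machine.apnp\<close> is
    a single constant that works for all \<open>n\<close>.\<close>
  proof (rule exI[of _ machine.apnp], rule exI[of _ 8], rule exI[of _ T], intro conjI allI impI ballI)
    fix n E and w :: "nat set \<Rightarrow> real"
    assume G: "ugraph n E"
    show "\<exists>t s. exec (word_size 8 n) \<rho> machine.apnp (input n E w) t s \<and> t \<le> T n" for \<rho>
      using run[OF G] by blast
    have "{\<rho>. \<exists>t s. exec (word_size 8 n) \<rho> machine.apnp (input n E w) t s \<and> apnp_solution n E w s} = UNIV"
      using run[OF G] by blast
    then show "measure_pmf.prob (random_tape (word_size 8 n) (T n))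
        {\<rho>. \<exists>t s. exec (word_size 8 n) \<rho> machine.apnp (input n E w) t s \<and> apnp_solution n E w s}
        \<ge> 1 - 1 / real n ^ k" by simp
  qed (simp, rule T)
qed
end
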